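(* Let $D$ and $D'$ be bounded finitely connected domains in $\mathbb{C}$, let $Q:\mathbb{C}\to(0,\infty)$ be a measurable function, and let $f:D\to D'$ be a lower $Q$-homeomorphism with $Q\in L^1(D)$. Then $f^{-1}$ can be extended to a continuous mapping of $\overline{D'}_P$ onto $\overline{D}_P$.
   Context: Notation: $S(z_0,r)=\{z\in\mathbb{C}:|z-z_0|=r\}$; $dm$ is Lebesgue measure in $\mathbb{C}$. Prime ends. For a bounded finitely connected domain $D\subset\mathbb{C}$, $\overline{D}_P$ is the completion of $D$ by its Carathéodory prime ends with the topology of prime ends, described as follows. There is a conformal mapping $g_0$ of $D$ onto a bounded circular domain $D_0$ (a domain whose boundary consists of finitely many mutually disjoint circles and isolated points), prime ends of $D$ are in natural one-to-one correspondence with points of $\partial D_0$, and so $g_0$ extends to a bijection $\widetilde{g_0}:\overline{D}_P\to\overline{D_0}$. The topology of $\overline{D}_P$ is induced by the metric $\rho_0(p_1,p_2)=|\widetilde{g_0}(p_1)-\widetilde{g_0}(p_2)|$ (so $\overline{D}_P$ is the metric completion of $D$ with respect to $|g_0(z)-g_0(w)|$); it does not depend on the choice of $g_0$. Continuity of maps between $\overline{D}_P$ and $\overline{D'}_P$ refers to these topologies. Modulus. A dashed line is a continuous mapping $\gamma$ of an open subset of $\mathbb{R}$ or of a circle into the plane. For a family $\Gamma$ of dashed lines, a Borel function $\varrho:\mathbb{C}\to[0,\infty]$ is admissible, $\varrho\in\mathrm{adm}\,\Gamma$, if $\int_\gamma\varrho\,ds\ge 1$ for every $\gamma\in\Gamma$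 (integration with respect to length, i.e. one-dimensional Hausdorff measure counted with multiplicity). The modulus is $M(\Gamma)=\inf_{\varrho\in\mathrm{adm}\,\Gamma}\int_{\mathbb{C}}\varrho^2\,dm$. A property holds for a.e. $\gamma\in\Gamma$ if the subfamily where it fails has modulus zero. A Lebesgue measurable $\varrho:\mathbb{C}\to[0,\infty]$ is extensively admissible, $\varrho\in\mathrm{ext\,adm}\,\Gamma$, if $\int_\gamma\varrho\,ds\ge1$ for a.e. $\gamma\in\Gamma$. Lower $Q$-homeomorphism. For bounded domains $D,D'\subset\mathbb{C}$, $z_0\in\overline{D}$ and measurable $Q:\mathbb{C}\to(0,\infty)$, a homeomorphism $f$ of $D$ onto $D'$ is a lower $Q$-homeomorphism at $z_0$ if, with $d_0=\sup_{z\in D}|z-z_0|$, for all $\varepsilon_0\in(0,d_0)$ and $\varepsilon\in(0,\varepsilon_0)$, $$M(f\Sigma_\varepsilon)\ \ge\ \inf_{\varrho\in\mathrm{ext\,adm}\,\Sigma_\varepsilon}\int_{D\cap R_\varepsilon}\frac{\varrho^2(z)}{Q(z)}\,dm(z),$$ where $R_\varepsilon=\{z:\varepsilon<|z-z_0|<\varepsilon_0\}$ and $\Sigma_\varepsilon$ is the family of all intersections $D\cap S(z_0,r)$, $r\in(\varepsilon,\varepsilon_0)$. $f$ is a lower $Q$-homeomorphism if this holds at every $z_0\in\overline{D}$. *)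

theory Defs
  imports "HOL-Complex_Analysis.Complex_Analysis"
begin

section \<open>Domains and circular domains\<close>

definition bounded_domain :: "complex set \<Rightarrow> bool" where
  "bounded_domain D \<longleftrightarrow> open D \<and> connected D \<and> D \<noteq> {} \<and> bounded D"

text \<open>
  For bounded \<open>D\<close>, exactly one component of the complement in the plane is unbounded;
  adding the point at infinity to it gives the complement in the Riemann sphere, so the number of
  components is the same in the plane and in the sphere.
\<close>
definition finitely_connected :: "complex set \<Rightarrow> bool" where
  "finitely_connected D \<longleftrightarrow> finite (components (- D))"

text \<open>
  \<open>sphere a 0 = {a}\<close>, so the case \<open>r = 0\<close> accounts for the isolated boundary points.
\<close>
definition bounded_circular_domain :: "complex set \<Rightarrow> bool" where
  "bounded_circular_domain D \<longleftrightarrow>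
     bounded_domain D \<and>
     (\<exists>K. finite K \<and> disjoint K \<and> (\<forall>k\<in>K. \<exists>a r. 0 \<le> r \<and> k = sphere a r) \<and>
          frontier D = \<Union>K)"

definition circular_uniformization :: "(complex \<Rightarrow> complex) \<Rightarrow> complex set \<Rightarrow> bool" where
  "circular_uniformization g D \<longleftrightarrow>
     g holomorphic_on D \<and> inj_on g D \<and> bounded_circular_domain (g ` D)"


section \<open>The completion by prime ends\<close>

text \<open>
  For a conformal mapping \<open>g\<close> of \<open>D\<close> onto a bounded circular domain, the completion of \<open>D\<close> by
  prime ends is realised as the metric completion of \<open>D\<close> with respect to \<open>\<bar>g z - g w\<bar>\<close>: its points
  are the equivalence classes of sequences in \<open>D\<close> that are Cauchy for this metric. The classes of
  sequences whose images approach the frontier of \<open>g ` D\<close> are the prime ends. Neither the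
  classes nor the topology depend on the choice of \<open>g\<close>, by the boundary correspondence
  between circular domains.
\<close>
definition pe_Cauchy :: "(complex \<Rightarrow> complex) \<Rightarrow> complex set \<Rightarrow> (nat \<Rightarrow> complex) set" where
  "pe_Cauchy g D = {x. range x \<subseteq> D \<and> Cauchy (g \<circ> x)}"

definition pe_rel ::
  "(complex \<Rightarrow> complex) \<Rightarrow> complex set \<Rightarrow> ((nat \<Rightarrow> complex) \<times> (nat \<Rightarrow> complex)) set" where
  "pe_rel g D = {(x, y). x \<in> pe_Cauchy g D \<and> y \<in> pe_Cauchy g D \<and>
                        (\<lambda>n. dist (g (x n)) (g (y n))) \<longlonglongrightarrow> 0}"

definition pe_completion :: "(complex \<Rightarrow> complex) \<Rightarrow> complex set \<Rightarrow> (nat \<Rightarrow> complex) set set" where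
  "pe_completion g D = pe_Cauchy g D // pe_rel g D"

definition pe_embed :: "(complex \<Rightarrow> complex) \<Rightarrow> complex set \<Rightarrow> complex \<Rightarrow> (nat \<Rightarrow> complex) set" where
  "pe_embed g D z = pe_rel g D `` {\<lambda>_. z}"

definition pe_extension :: "(complex \<Rightarrow> complex) \<Rightarrow> (nat \<Rightarrow> complex) set \<Rightarrow> complex" where
  "pe_extension g p = (THE l. \<forall>x\<in>p. (g \<circ> x) \<longlonglongrightarrow> l)"

definition pe_dist ::
  "(complex \<Rightarrow> complex) \<Rightarrow> (nat \<Rightarrow> complex) set \<Rightarrow> (nat \<Rightarrow> complex) set \<Rightarrow> real" where
  "pe_dist g p q = dist (pe_extension g p) (pe_extension g q)"

definition pe_topology ::
  "(complex \<Rightarrow> complex) \<Rightarrow> complex set \<Rightarrow> (nat \<Rightarrow> complex) set topology" where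
  "pe_topology g D = Metric_space.mtopology (pe_completion g D) (pe_dist g)"

lemma pe_rel_class:
  assumes x: "x \<in> pe_Cauchy g D" and l: "(g \<circ> x) \<longlonglongrightarrow> l"
  shows "pe_rel g D `` {x} = {y. range y \<subseteq> D \<and> (g \<circ> y) \<longlonglongrightarrow> l}"
proof -
  have "(\<lambda>n. dist (g (x n)) (g (y n))) \<longlonglongrightarrow> 0 \<longleftrightarrow> (g \<circ> y) \<longlonglongrightarrow> l" for y
  proof -
    have "(\<lambda>n. dist (g (x n)) (g (y n))) \<longlonglongrightarrow> 0 \<longleftrightarrow> (\<lambda>n. g (x n) - g (y n)) \<longlonglongrightarrow> 0"
      by (simp add: dist_norm tendsto_norm_zero_iff)
    also have "\<dots> \<longleftrightarrow> (g \<circ> y) \<longlonglongrightarrow> l"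
    proof
      assume "(\<lambda>n. g (x n) - g (y n)) \<longlonglongrightarrow> 0"
      with l have "(\<lambda>n. (g \<circ> x) n - (g (x n) - g (y n))) \<longlonglongrightarrow> l - 0"
        by (rule tendsto_diff)
      then show "(g \<circ> y) \<longlonglongrightarrow> l" by (simp add: o_def)
    next
      assume "(g \<circ> y) \<longlonglongrightarrow> l"
      with l have "(\<lambda>n. (g \<circ> x) n - (g \<circ> y) n) \<longlonglongrightarrow> l - l"
        by (rule tendsto_diff)
      then show "(\<lambda>n. g (x n) - g (y n)) \<longlonglongrightarrow> 0" by (simp add: o_def)
    qed
    finally show ?thesis .
  qed
  moreover have "Cauchy (g \<circ> y)" if "(g \<circ> y) \<longlonglongrightarrow> l" for y
    using that by (rule LIMSEQ_imp_Cauchy)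
  ultimately show ?thesis
    using x by (auto simp: pe_rel_def pe_Cauchy_def)
qed

lemma pe_completion_eq:
  "pe_completion g D = (\<lambda>l. {y. range y \<subseteq> D \<and> (g \<circ> y) \<longlonglongrightarrow> l}) ` closure (g ` D)"
proof (intro equalityI subsetI)
  fix p assume "p \<in> pe_completion g D"
  then obtain x where x: "x \<in> pe_Cauchy g D" "p = pe_rel g D `` {x}"
    by (auto simp: pe_completion_def elim: quotientE)
  then obtain l where l: "(g \<circ> x) \<longlonglongrightarrow> l"
    by (auto simp: pe_Cauchy_def Cauchy_convergent_iff convergent_def)
  have "l \<in> closure (g ` D)"
    unfolding closure_sequential using l x(1) by (intro exI[of _ "g \<circ> x"]) (auto simp: pe_Cauchy_def)
  with pe_rel_class[OF x(1) l] x(2)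
  show "p \<in> (\<lambda>l. {y. range y \<subseteq> D \<and> (g \<circ> y) \<longlonglongrightarrow> l}) ` closure (g ` D)" by blast
next
  fix p assume "p \<in> (\<lambda>l. {y. range y \<subseteq> D \<and> (g \<circ> y) \<longlonglongrightarrow> l}) ` closure (g ` D)"
  then obtain l where l: "l \<in> closure (g ` D)" "p = {y. range y \<subseteq> D \<and> (g \<circ> y) \<longlonglongrightarrow> l}" by blast
  then obtain u where u: "\<And>n. u n \<in> g ` D" "u \<longlonglongrightarrow> l"
    by (auto simp: closure_sequential)
  then obtain x where x: "\<And>n. x n \<in> D" "\<And>n. u n = g (x n)"
    unfolding image_iff by metis
  have gx: "(g \<circ> x) \<longlonglongrightarrow> l"
    using u(2) x(2) by (simp add: o_def flip: x(2))
  then have "x \<in> pe_Cauchy g D"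
    using x(1) LIMSEQ_imp_Cauchy by (auto simp: pe_Cauchy_def)
  then show "p \<in> pe_completion g D"
    unfolding pe_completion_def l(2) pe_rel_class[OF \<open>x \<in> pe_Cauchy g D\<close> gx, symmetric]
    by (rule quotientI)
qed

lemma pe_extension_eq:
  assumes "l \<in> closure (g ` D)"
  shows "pe_extension g {y. range y \<subseteq> D \<and> (g \<circ> y) \<longlonglongrightarrow> l} = l"
proof -
  obtain u where u: "\<And>n. u n \<in> g ` D" "u \<longlonglongrightarrow> l"
    using assms by (auto simp: closure_sequential)
  then obtain x where x: "\<And>n. x n \<in> D" "\<And>n. u n = g (x n)"
    unfolding image_iff by metis
  have "range x \<subseteq> D \<and> (g \<circ> x) \<longlonglongrightarrow> l"
    using u(2) x by (auto simp: o_def simp flip: x(2))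
  then show ?thesis
    unfolding pe_extension_def using LIMSEQ_unique by (intro the_equality) blast+
qed

lemma bij_betw_pe_extension: "bij_betw (pe_extension g) (pe_completion g D) (closure (g ` D))"
  by (rule bij_betw_byWitness[where f' = "\<lambda>l. {y. range y \<subseteq> D \<and> (g \<circ> y) \<longlonglongrightarrow> l}"])
     (auto simp: pe_completion_eq pe_extension_eq)

lemma pe_embed_eq:
  assumes "z \<in> D"
  shows "pe_embed g D z = {y. range y \<subseteq> D \<and> (g \<circ> y) \<longlonglongrightarrow> g z}"
  unfolding pe_embed_def
  by (rule pe_rel_class) (use assms in \<open>auto simp: pe_Cauchy_def o_def intro: LIMSEQ_imp_Cauchy\<close>)

lemma pe_embed_in_completion: "z \<in> D \<Longrightarrow> pe_embed g D z \<in> pe_completion g D"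
  using closure_subset[of "g ` D"] by (auto simp: pe_embed_eq pe_completion_eq)

lemma pe_extension_embed: "z \<in> D \<Longrightarrow> pe_extension g (pe_embed g D z) = g z"
  using closure_subset[of "g ` D"] by (auto simp: pe_embed_eq intro: pe_extension_eq)

lemma Metric_space_pe: "Metric_space (pe_completion g D) (pe_dist g)"
proof
  fix p q assume "p \<in> pe_completion g D" "q \<in> pe_completion g D"
  then show "pe_dist g p q = 0 \<longleftrightarrow> p = q"
    using bij_betw_pe_extension[of g D] by (auto simp: pe_dist_def bij_betw_def inj_on_def)
qed (auto simp: pe_dist_def dist_commute dist_triangle)


section \<open>One-dimensional Hausdorff measure in the plane\<close>

definition hausdorff1_pre :: "real \<Rightarrow> complex set \<Rightarrow> ennreal" where
  "hausdorff1_pre \<delta> A =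
     (INF U \<in> {U :: nat \<Rightarrow> complex set. A \<subseteq> (\<Union>i. U i) \<and> (\<forall>i. bounded (U i) \<and> diameter (U i) \<le> \<delta>)}.
        \<Sum>i. ennreal (diameter (U i)))"

definition hausdorff1_outer :: "complex set \<Rightarrow> ennreal" where
  "hausdorff1_outer A = (SUP \<delta>\<in>{0<..}. hausdorff1_pre \<delta> A)"

definition hausdorff1 :: "complex measure" where
  "hausdorff1 = measure_of UNIV (lambda_system UNIV UNIV hausdorff1_outer) hausdorff1_outer"

lemma hausdorff1_pre_subadditive:
  assumes "\<delta> > 0"
  shows "hausdorff1_pre \<delta> (\<Union>i. A i) \<le> (\<Sum>i. hausdorff1_pre \<delta> (A i))"
proof (rule ennreal_le_epsilon)
  let ?C = "\<lambda>A. {U :: nat \<Rightarrow> complex set. A \<subseteq> (\<Union>i. U i) \<and> (\<forall>i. bounded (U i) \<and> diameter (U i) \<le> \<delta>)}"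
  fix e :: real assume e: "0 < e" and fin: "(\<Sum>i. hausdorff1_pre \<delta> (A i)) < top"
  have "\<exists>U\<in>?C (A n). (\<Sum>i. ennreal (diameter (U i))) \<le> hausdorff1_pre \<delta> (A n) + ennreal (e * (1/2)^Suc n)" for n
  proof -
    have "hausdorff1_pre \<delta> (A n) \<noteq> top"
      using ennreal_suminf_lessD[OF fin, of n] by (rule less_imp_neq)
    moreover have "0 < ennreal (e * (1/2)^Suc n)" using e by (simp add: ennreal_zero_less_mult_iff)
    ultimately have "hausdorff1_pre \<delta> (A n) < hausdorff1_pre \<delta> (A n) + ennreal (e * (1/2)^Suc n)"
      by (simp add: ennreal_add_left_cancel_less less_top)
    then show ?thesis
      unfolding hausdorff1_pre_def[of \<delta> "A n"] INF_less_iff by (auto intro: less_imp_le)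
  qed
  then have "\<forall>n. \<exists>U. U \<in> ?C (A n) \<and>
      (\<Sum>i. ennreal (diameter (U i))) \<le> hausdorff1_pre \<delta> (A n) + ennreal (e * (1/2)^Suc n)"
    by blast
  from choice[OF this] obtain U where U: "\<And>n. U n \<in> ?C (A n)"
    "\<And>n. (\<Sum>i. ennreal (diameter (U n i))) \<le> hausdorff1_pre \<delta> (A n) + ennreal (e * (1/2)^Suc n)"
    by blast
  define V where "V = (\<lambda>k. case prod_decode k of (n, i) \<Rightarrow> U n i)"
  have "V \<in> ?C (\<Union>i. A i)"
  proof -
    have "\<exists>k. z \<in> V k" if "z \<in> A n" for z n
    proof -
      from U(1)[of n] that obtain i where "z \<in> U n i" by blast
      then show ?thesis by (intro exI[of _ "prod_encode (n, i)"]) (simp add: V_def)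
    qed
    moreover have "bounded (V k) \<and> diameter (V k) \<le> \<delta>" for k
      using U(1) by (auto simp: V_def split: prod.split)
    ultimately show ?thesis by blast
  qed
  then have "hausdorff1_pre \<delta> (\<Union>i. A i) \<le> (\<Sum>k. ennreal (diameter (V k)))"
    unfolding hausdorff1_pre_def by (rule INF_lower)
  also have "\<dots> = (\<Sum>n. \<Sum>i. ennreal (diameter (U n i)))"
    using suminf_ennreal_2dimen[where f = "\<lambda>(n, i). ennreal (diameter (U n i))"
        and g = "\<lambda>n. \<Sum>i. ennreal (diameter (U n i))"]
    by (simp add: V_def o_def split_def)
  also have "\<dots> \<le> (\<Sum>n. hausdorff1_pre \<delta> (A n) + ennreal (e * (1/2)^Suc n))"
    by (intro suminf_le U(2)) auto
  also have "\<dots> = (\<Sum>n. hausdorff1_pre \<delta> (A n)) + (\<Sum>n. ennreal (e * (1/2)^Suc n))"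
    by (rule suminf_add[symmetric]) auto
  also have "(\<Sum>n. ennreal (e * (1/2)^Suc n)) = ennreal e"
    using sums_mult[OF power_half_series, of e] e by (intro suminf_ennreal_eq) auto
  finally show "hausdorff1_pre \<delta> (\<Union>i. A i) \<le> (\<Sum>i. hausdorff1_pre \<delta> (A i)) + ennreal e" .
qed

lemma outer_measure_space_hausdorff1: "outer_measure_space UNIV hausdorff1_outer"
  unfolding outer_measure_space_def
proof (intro conjI)
  have "hausdorff1_pre \<delta> {} = 0" if "\<delta> > 0" for \<delta>
  proof -
    have "hausdorff1_pre \<delta> {} \<le> (\<Sum>i. ennreal (diameter ((\<lambda>_. {}) i :: complex set)))"
      unfolding hausdorff1_pre_def using that by (intro INF_lower) auto
    then show ?thesis by simp
  qed
  then show "positive UNIV hausdorff1_outer"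
    by (auto simp: positive_def hausdorff1_outer_def image_constant_conv)
  show "increasing UNIV hausdorff1_outer"
    unfolding increasing_def hausdorff1_outer_def hausdorff1_pre_def
    by (auto intro!: SUP_mono' INF_superset_mono)
  show "countably_subadditive UNIV hausdorff1_outer"
    unfolding countably_subadditive_def
  proof (intro allI impI)
    fix A :: "nat \<Rightarrow> complex set"
    show "hausdorff1_outer (\<Union>i. A i) \<le> (\<Sum>i. hausdorff1_outer (A i))"
      unfolding hausdorff1_outer_def[of "\<Union>i. A i"]
    proof (rule SUP_least)
      fix \<delta> :: real assume \<delta>: "\<delta> \<in> {0<..}"
      then have "hausdorff1_pre \<delta> (\<Union>i. A i) \<le> (\<Sum>i. hausdorff1_pre \<delta> (A i))"
        by (intro hausdorff1_pre_subadditive) auto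
      also have "\<dots> \<le> (\<Sum>i. hausdorff1_outer (A i))"
        using \<delta> by (intro suminf_le) (auto simp: hausdorff1_outer_def intro: SUP_upper)
      finally show "hausdorff1_pre \<delta> (\<Union>i. A i) \<le> (\<Sum>i. hausdorff1_outer (A i))" .
    qed
  qed
qed

lemma measure_space_hausdorff1:
  "measure_space UNIV (lambda_system UNIV UNIV hausdorff1_outer) hausdorff1_outer"
proof -
  interpret sigma_algebra "UNIV :: complex set" UNIV
    using sigma_algebra_Pow[of "UNIV :: complex set"] by simp
  show ?thesis
    by (rule caratheodory_lemma[OF outer_measure_space_hausdorff1])
qed

lemma sets_hausdorff1: "sets hausdorff1 = lambda_system UNIV UNIV hausdorff1_outer"
  unfolding hausdorff1_def
  by (rule sigma_algebra.sets_measure_of_eq)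
     (use measure_space_hausdorff1 in \<open>simp add: measure_space_def\<close>)

lemma emeasure_hausdorff1:
  "A \<in> sets hausdorff1 \<Longrightarrow> emeasure hausdorff1 A = hausdorff1_outer A"
  using measure_space_hausdorff1 unfolding sets_hausdorff1 unfolding hausdorff1_def
  by (intro emeasure_measure_of_sigma) (auto simp: measure_space_def)


section \<open>Dashed lines and modulus\<close>

text \<open>
  A dashed line is represented by its parameter set, a subset of the plane which is open in the
  real axis or in some circle, together with the mapping (only its values on the parameter set
  matter).
\<close>
type_synonym dashed_line = "complex set \<times> (complex \<Rightarrow> complex)"

definition is_dashed_line :: "dashed_line \<Rightarrow> bool" where
  "is_dashed_line \<gamma> \<longleftrightarrow>
     (openin (top_of_set \<real>) (fst \<gamma>) \<or>
      (\<exists>a r. 0 < r \<and> openin (top_of_set (sphere a r)) (fst \<gamma>))) \<and>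
     continuous_on (fst \<gamma>) (snd \<gamma>)"

definition multiplicity_at :: "dashed_line \<Rightarrow> complex \<Rightarrow> ennreal" where
  "multiplicity_at \<gamma> z = emeasure (count_space UNIV) {t \<in> fst \<gamma>. snd \<gamma> t = z}"

definition line_integral :: "dashed_line \<Rightarrow> (complex \<Rightarrow> ennreal) \<Rightarrow> ennreal" where
  "line_integral \<gamma> \<rho> = (\<integral>\<^sup>+ z. \<rho> z * multiplicity_at \<gamma> z \<partial>hausdorff1)"

definition adm :: "dashed_line set \<Rightarrow> (complex \<Rightarrow> ennreal) set" where
  "adm \<Gamma> = {\<rho>. \<rho> \<in> borel_measurable borel \<and> (\<forall>\<gamma>\<in>\<Gamma>. 1 \<le> line_integral \<gamma> \<rho>)}"

definition modulus :: "dashed_line set \<Rightarrow> ennreal" where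
  "modulus \<Gamma> = (INF \<rho>\<in>adm \<Gamma>. \<integral>\<^sup>+ z. (\<rho> z)\<^sup>2 \<partial>lebesgue)"

text \<open>
  For Lebesgue measurable \<open>\<rho>\<close> the integrand of the line integral may fail to be measurable, but
  only for a subfamily of modulus zero, so the value of the integral there is irrelevant here.
\<close>
definition ext_adm :: "dashed_line set \<Rightarrow> (complex \<Rightarrow> ennreal) set" where
  "ext_adm \<Gamma> = {\<rho>. \<rho> \<in> borel_measurable lebesgue \<and>
                    modulus {\<gamma> \<in> \<Gamma>. \<not> 1 \<le> line_integral \<gamma> \<rho>} = 0}"

definition image_family :: "(complex \<Rightarrow> complex) \<Rightarrow> dashed_line set \<Rightarrow> dashed_line set" where
  "image_family f \<Gamma> = (\<lambda>\<gamma>. (fst \<gamma>, f \<circ> snd \<gamma>)) ` \<Gamma>"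


section \<open>Lower Q-homeomorphisms\<close>

definition annulus :: "complex \<Rightarrow> real \<Rightarrow> real \<Rightarrow> complex set" where
  "annulus z0 \<epsilon> \<epsilon>0 = {z. \<epsilon> < dist z z0 \<and> dist z z0 < \<epsilon>0}"

definition circle_family :: "complex set \<Rightarrow> complex \<Rightarrow> real \<Rightarrow> real \<Rightarrow> dashed_line set" where
  "circle_family D z0 \<epsilon> \<epsilon>0 = (\<lambda>r. (D \<inter> sphere z0 r, id)) ` {\<epsilon><..<\<epsilon>0}"

definition lower_Q_at ::
  "(complex \<Rightarrow> real) \<Rightarrow> complex set \<Rightarrow> (complex \<Rightarrow> complex) \<Rightarrow> complex \<Rightarrow> bool" where
  "lower_Q_at Q D f z0 \<longleftrightarrow>
     (\<forall>\<epsilon>0 \<epsilon>. 0 < \<epsilon>0 \<longrightarrow> \<epsilon>0 < (SUP z\<in>D. dist z z0) \<longrightarrow> 0 < \<epsilon> \<longrightarrow> \<epsilon> < \<epsilon>0 \<longrightarrow>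
        (INF \<rho>\<in>ext_adm (circle_family D z0 \<epsilon> \<epsilon>0).
           \<integral>\<^sup>+ z\<in>D \<inter> annulus z0 \<epsilon> \<epsilon>0. ((\<rho> z)\<^sup>2 / ennreal (Q z)) \<partial>lebesgue)
        \<le> modulus (image_family f (circle_family D z0 \<epsilon> \<epsilon>0)))"

definition lower_Q_homeomorphism ::
  "(complex \<Rightarrow> real) \<Rightarrow> complex set \<Rightarrow> complex set \<Rightarrow> (complex \<Rightarrow> complex) \<Rightarrow> bool" where
  "lower_Q_homeomorphism Q D D' f \<longleftrightarrow>
     (\<exists>f'. homeomorphism D D' f f') \<and> (\<forall>z0\<in>closure D. lower_Q_at Q D f z0)"

lemma is_dashed_line_circle_family:
  assumes "open D" "0 < \<epsilon>" "\<gamma> \<in> circle_family D z0 \<epsilon> \<epsilon>0"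
  shows "is_dashed_line \<gamma>"
proof -
  from assms(3) obtain r where r: "r \<in> {\<epsilon><..<\<epsilon>0}" "\<gamma> = (D \<inter> sphere z0 r, id)"
    by (auto simp: circle_family_def)
  have "openin (top_of_set (sphere z0 r)) (D \<inter> sphere z0 r)"
    by (subst Int_commute) (rule openin_open_Int[OF assms(1)])
  with r assms(2) show ?thesis
    unfolding is_dashed_line_def by (force simp: continuous_on_id)
qed

lemma is_dashed_line_image_circle_family:
  assumes "open D" "0 < \<epsilon>" "continuous_on D f" "\<gamma> \<in> image_family f (circle_family D z0 \<epsilon> \<epsilon>0)"
  shows "is_dashed_line \<gamma>"
proof -
  from assms(4) obtain \<gamma>' where \<gamma>': "\<gamma>' \<in> circle_family D z0 \<epsilon> \<epsilon>0" "\<gamma> = (fst \<gamma>', f \<circ> snd \<gamma>')"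
    unfolding image_family_def by blast
  then obtain r where r: "\<gamma>' = (D \<inter> sphere z0 r, id)"
    unfolding circle_family_def by blast
  have "continuous_on (D \<inter> sphere z0 r) f"
    using assms(3) by (rule continuous_on_subset) simp
  with is_dashed_line_circle_family[OF assms(1,2) \<gamma>'(1)] show ?thesis
    unfolding is_dashed_line_def \<gamma>'(2) r by simp
qed

end

theory Submission
  imports Defs
begin

text \<open>
  Let \<open>\<Psi> = g \<circ> f\<inverse> \<circ> h\<inverse>\<close> between the circular domains \<open>h ` D'\<close> and \<open>g ` D\<close>. If it had no
  continuous extension, two distinct boundary points \<open>\<zeta>\<close>, \<open>\<xi>\<close> of \<open>g ` D\<close> would be cluster values of \<open>\<Psi>\<close> at the
  same boundary point \<open>w\<close>. By the length-area principle some small circular arcs around \<open>\<zeta>\<close> are mapped by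
  \<open>g\<inverse>\<close> to short curves, which accumulate at a principal point \<open>z\<^sub>0\<close>, while a further one is mapped
  to a curve that stays away from \<open>z\<^sub>0\<close>. A circle about \<open>z\<^sub>0\<close> that separates the two kinds of curves
  contains an arc that separates \<open>\<zeta>\<close> from \<open>\<xi>\<close>, so the image of this arc under \<open>f\<close> ends at \<open>w\<close>.
  Hence the images of the circles for a whole interval of radii all contain arcs ending at \<open>w\<close>, and
  their modulus is \<open>0\<close>. But \<open>Q \<in> L\<^sup>1(D)\<close> and the Cauchy-Schwarz inequality make the lower bound for
  this modulus positive.
\<close>

section \<open>Borel sets are measurable for the Hausdorff measure\<close>

text \<open>The contradiction only has to tell zero from positive and finite from infinite, so
  constants may be wasted: exact coarea and change of variables formulas are replaced by one-sided
  inequalities obtained from coverings. One weight, of the size of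
  \<open>1 / (t * ln (1 / t))\<close>, does three jobs. Placed in the source of a conformal map, it
  finds circles with short images. Placed in the target, it finds a circle whose image keeps away
  from a given point. Pulled back by \<open>h\<close>, it has infinite integral along every
  connected set in \<open>D'\<close> whose image under \<open>h\<close> clusters at
  \<open>w\<close>, although its square has finite integral. In this way the prime end
  \<open>w\<close> is handled without any reference to the Euclidean frontier of \<open>D'\<close>.
  The separating arc is a problem of planar topology: a level set of the distance to the principal
  point may have many components, and one of them has to do all the separating. This is true in
  simply connected domains but fails in an annulus, which is why an isolated boundary point is
  treated by filling it in.\<close>

lemma hausdorff1_outer_mono: "A \<subseteq> B \<Longrightarrow> hausdorff1_outer A \<le> hausdorff1_outer B"
  using outer_measure_space_hausdorff1 by (auto simp: outer_measure_space_def increasing_def)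

lemma hausdorff1_outer_empty [simp]: "hausdorff1_outer {} = 0"
  using outer_measure_space_hausdorff1 by (auto simp: outer_measure_space_def positive_def)

lemma hausdorff1_outer_UN:
  fixes A :: "nat \<Rightarrow> complex set"
  shows "hausdorff1_outer (\<Union>i. A i) \<le> (\<Sum>i. hausdorff1_outer (A i))"
  unfolding hausdorff1_outer_def[of "\<Union>i. A i"]
proof (rule SUP_least)
  fix \<delta> :: real assume \<delta>: "\<delta> \<in> {0<..}"
  then have "hausdorff1_pre \<delta> (\<Union>i. A i) \<le> (\<Sum>i. hausdorff1_pre \<delta> (A i))"
    by (intro hausdorff1_pre_subadditive) auto
  also have "\<dots> \<le> (\<Sum>i. hausdorff1_outer (A i))"
    using \<delta> by (intro suminf_le) (auto simp: hausdorff1_outer_def intro: SUP_upper)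
  finally show "hausdorff1_pre \<delta> (\<Union>i. A i) \<le> (\<Sum>i. hausdorff1_outer (A i))" .
qed

lemma hausdorff1_outer_Un: "hausdorff1_outer (A \<union> B) \<le> hausdorff1_outer A + hausdorff1_outer B"
proof -
  define C where "C i = (if i = 0 then A else if i = 1 then B else {})" for i :: nat
  have "A \<union> B \<subseteq> (\<Union>i. C i)" by (auto simp: C_def split: if_splits)
  then have "hausdorff1_outer (A \<union> B) \<le> (\<Sum>i. hausdorff1_outer (C i))"
    using hausdorff1_outer_mono hausdorff1_outer_UN order_trans by blast
  also have "\<dots> = (\<Sum>i<2. hausdorff1_outer (C i))"
    by (rule suminf_finite) (auto simp: C_def)
  also have "\<dots> = hausdorff1_outer A + hausdorff1_outer B"
    by (simp add: C_def numeral_2_eq_2)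
  finally show ?thesis .
qed

lemma hausdorff1_pre_antimono: "\<delta> \<le> \<delta>' \<Longrightarrow> hausdorff1_pre \<delta>' A \<le> hausdorff1_pre \<delta> A"
  unfolding hausdorff1_pre_def by (intro INF_superset_mono subsetI) (auto dest: spec intro: order_trans)

text \<open>A covering set of diameter less than \<open>d\<close> cannot meet both \<open>A\<close>
  and \<open>B\<close>, so every sufficiently fine cover of the union splits into a cover of
  \<open>A\<close> and a cover of \<open>B\<close>.\<close>

lemma hausdorff1_outer_separated:
  assumes d: "0 < d" "\<And>x y. x \<in> A \<Longrightarrow> y \<in> B \<Longrightarrow> d \<le> dist x y"
  shows "hausdorff1_outer A + hausdorff1_outer B \<le> hausdorff1_outer (A \<union> B)"
proof -
  have le: "hausdorff1_pre \<delta> A + hausdorff1_pre \<delta> B \<le> hausdorff1_pre \<delta> (A \<union> B)"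
    if \<delta>: "0 < \<delta>" "\<delta> < d" for \<delta>
    unfolding hausdorff1_pre_def[of \<delta> "A \<union> B"]
  proof (rule INF_greatest)
    fix U :: "nat \<Rightarrow> complex set"
    assume "U \<in> {U. A \<union> B \<subseteq> (\<Union>i. U i) \<and> (\<forall>i. bounded (U i) \<and> diameter (U i) \<le> \<delta>)}"
    then have U: "A \<union> B \<subseteq> (\<Union>i. U i)" "\<And>i. bounded (U i)" "\<And>i. diameter (U i) \<le> \<delta>" by auto
    define V where "V i = (if U i \<inter> A \<noteq> {} then U i else {})" for i
    define W where "W i = (if U i \<inter> A = {} then U i else {})" for i
    have "A \<subseteq> (\<Union>i. V i)"
    proof
      fix x assume "x \<in> A"
      with U(1) obtain i where "x \<in> U i" by blast
      with \<open>x \<in> A\<close> show "x \<in> (\<Union>i. V i)" by (auto simp: V_def intro!: exI[of _ i])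
    qed
    then have 1: "hausdorff1_pre \<delta> A \<le> (\<Sum>i. ennreal (diameter (V i)))"
      unfolding hausdorff1_pre_def using U \<delta> by (intro INF_lower) (auto simp: V_def)
    have "B \<subseteq> (\<Union>i. W i)"
    proof
      fix y assume y: "y \<in> B"
      with U(1) obtain i where i: "y \<in> U i" by blast
      have "U i \<inter> A = {}"
      proof (rule ccontr)
        assume "U i \<inter> A \<noteq> {}"
        then obtain x where x: "x \<in> U i" "x \<in> A" by blast
        have "d \<le> dist x y" using x y d by blast
        also have "\<dots> \<le> \<delta>" using diameter_bounded_bound[OF U(2) x(1) i] U(3)[of i] by simp
        finally show False using \<delta> by simp
      qed
      with i show "y \<in> (\<Union>i. W i)" by (auto simp: W_def intro!: exI[of _ i])
    qed
    then have 2: "hausdorff1_pre \<delta> B \<le> (\<Sum>i. ennreal (diameter (W i)))"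
      unfolding hausdorff1_pre_def using U \<delta> by (intro INF_lower) (auto simp: W_def)
    have "(\<Sum>i. ennreal (diameter (V i))) + (\<Sum>i. ennreal (diameter (W i)))
        = (\<Sum>i. ennreal (diameter (V i)) + ennreal (diameter (W i)))"
      by (rule suminf_add) auto
    also have "\<dots> = (\<Sum>i. ennreal (diameter (U i)))"
      by (rule arg_cong[where f = suminf]) (auto simp: V_def W_def)
    finally show "hausdorff1_pre \<delta> A + hausdorff1_pre \<delta> B \<le> (\<Sum>i. ennreal (diameter (U i)))"
      using add_mono[OF 1 2] by simp
  qed
  have "hausdorff1_pre \<delta> A + hausdorff1_pre \<eta> B \<le> hausdorff1_outer (A \<union> B)"
    if "0 < \<delta>" "0 < \<eta>" for \<delta> \<eta>
  proof -
    \<comment> \<open>The two suprema run over independent scales. Refining both to one common scale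
      below \<open>d\<close> only increases the left-hand side.\<close>
    define m where "m = min (min \<delta> \<eta>) (d/2)"
    have m: "0 < m" "m < d" "m \<le> \<delta>" "m \<le> \<eta>" using that d by (auto simp: m_def)
    have "hausdorff1_pre \<delta> A + hausdorff1_pre \<eta> B \<le> hausdorff1_pre m A + hausdorff1_pre m B"
      using m by (intro add_mono hausdorff1_pre_antimono)
    also have "\<dots> \<le> hausdorff1_pre m (A \<union> B)" using m by (intro le)
    also have "\<dots> \<le> hausdorff1_outer (A \<union> B)"
      unfolding hausdorff1_outer_def using m by (intro SUP_upper) auto
    finally show ?thesis .
  qed
  then show ?thesis
    unfolding hausdorff1_outer_def[of A] hausdorff1_outer_def[of B]
    by (subst ennreal_SUP_add_left[symmetric], simp, subst ennreal_SUP_add_right, simp)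
      (auto intro!: SUP_least)
qed

text \<open>Caratheodory's criterion. The shells around the closed set with even index, and those with
  odd index, are pairwise at positive distance, so their measures are summable.\<close>
lemma closed_sets_hausdorff1:
  assumes F: "closed F"
  shows "F \<in> sets hausdorff1"
proof (cases "F = {}")
  case False
  let ?H = hausdorff1_outer
  have main: "?H (X \<inter> F) + ?H (X - F) \<le> ?H X" for X
  proof (cases "?H X = \<infinity>")
    case fin: False
    define A where "A n = {x \<in> X. 1 / real (Suc n) \<le> infdist x F}" for n
    define R where "R n = {x \<in> X. 1 / real (n + 2) \<le> infdist x F \<and> infdist x F < 1 / real (Suc n)}" for n
    have dist_le: "infdist x F - infdist y F \<le> dist x y" for x y
      using infdist_triangle[of x F y] by simp
    have part: "(\<Sum>k<n. ?H (R (2*k+p))) \<le> ?H (\<Union>k<n. R (2*k+p))" for n p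
    proof (induction n)
      case (Suc n)
      \<comment> \<open>The width of the shell \<open>R (2*n+p-1)\<close>, which separates
        \<open>R (2*n+p)\<close> from all earlier shells of the same parity. For
        \<open>n = 0\<close> there are no earlier shells, and the quotient may be a division by
        zero; hence the case distinction below.\<close>
      define d where "d = 1 / real (2*n+p) - 1 / real (2*n+p+1)"
      have "(\<Sum>k<Suc n. ?H (R (2*k+p))) \<le> ?H (\<Union>k<n. R (2*k+p)) + ?H (R (2*n+p))"
        using Suc by (simp add: add_mono)
      also have "\<dots> \<le> ?H ((\<Union>k<n. R (2*k+p)) \<union> R (2*n+p))"
      proof (cases "n = 0")
        case False
        show ?thesis
        proof (rule hausdorff1_outer_separated[of d])
          show "0 < d" using False unfolding d_def by (simp add: divide_strict_left_mono)
          fix x y assume x: "x \<in> (\<Union>k<n. R (2*k+p))" and y: "y \<in> R (2*n+p)"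
          then obtain k where k: "k < n" "x \<in> R (2*k+p)" by auto
          have "1 / real (2*n+p) \<le> 1 / real (2*k+p+2)" using k by (intro divide_left_mono) auto
          also have "\<dots> \<le> infdist x F" using k by (auto simp: R_def)
          finally show "d \<le> dist x y"
            using y dist_le[of x y] by (auto simp: R_def d_def)
        qed
      qed simp
      also have "(\<Union>k<n. R (2*k+p)) \<union> R (2*n+p) = (\<Union>k<Suc n. R (2*k+p))"
        by (auto simp: lessThan_Suc)
      finally show ?case .
    qed simp
    have part2: "(\<Sum>k. ?H (R (2*k+p))) \<le> ?H X" for p
    proof (rule suminf_le_const[OF summableI])
      fix n show "(\<Sum>k<n. ?H (R (2*k+p))) \<le> ?H X"
        by (rule order_trans[OF part hausdorff1_outer_mono]) (auto simp: R_def)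
    qed
    have bound: "(\<Sum>k<n. ?H (R k)) \<le> ?H X + ?H X" for n
    proof -
      have "(\<Sum>k<n. ?H (R k)) \<le> (\<Sum>k<2*n. ?H (R k))" by (intro sum_mono2) auto
      also have "\<dots> = (\<Sum>k<n. ?H (R (2*k+0))) + (\<Sum>k<n. ?H (R (2*k+1)))"
        by (induction n) (auto simp: algebra_simps)
      also have "\<dots> \<le> ?H X + ?H X"
        by (intro add_mono order_trans[OF sum_le_suminf part2]) auto
      finally show ?thesis .
    qed
    have tot: "(\<Sum>k. ?H (R k)) \<noteq> \<infinity>"
      using suminf_le_const[OF summableI bound] fin by (auto simp: top_unique)
    show ?thesis
    proof (rule ennreal_le_epsilon)
      fix e :: real assume e: "0 < e"
      have "(\<lambda>n. \<Sum>k<n. ?H (R k)) \<longlonglongrightarrow> (\<Sum>k. ?H (R k))"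
        by (rule summable_LIMSEQ) simp
      then obtain n where n: "(\<Sum>k. ?H (R k)) \<le> (\<Sum>k<n. ?H (R k)) + ennreal e"
      proof -
        obtain t where t: "(\<Sum>k. ?H (R k)) = ennreal t" "0 \<le> t" using tot by (cases "\<Sum>k. ?H (R k)") auto
        have "\<exists>n. (\<Sum>k. ?H (R k)) \<le> (\<Sum>k<n. ?H (R k)) + ennreal e"
        proof (cases "t < e")
          case True
          then show ?thesis using t by (intro exI[of _ 0]) (auto intro: ennreal_leI)
        next
          case False
          then have "ennreal (t - e) < (\<Sum>k. ?H (R k))"
            using e t by (simp add: ennreal_lessI)
          from order_tendstoD(1)[OF \<open>(\<lambda>n. \<Sum>k<n. ?H (R k)) \<longlonglongrightarrow> _\<close> this]
          obtain n where "ennreal (t - e) < (\<Sum>k<n. ?H (R k))"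
            by (auto simp: eventually_sequentially)
          then have "ennreal (t - e) + ennreal e \<le> (\<Sum>k<n. ?H (R k)) + ennreal e"
            by (intro add_right_mono) auto
          then show ?thesis using t e False by (auto simp flip: ennreal_plus)
        qed
        then show ?thesis using that by blast
      qed
      have split: "(\<Sum>k. ?H (R k)) = (\<Sum>k. ?H (R (k + n))) + (\<Sum>k<n. ?H (R k))"
        by (rule suminf_offset) simp
      have "(\<Sum>k<n. ?H (R k)) \<le> (\<Sum>k. ?H (R k))"
        by (rule sum_le_suminf) auto
      with tot have S: "(\<Sum>k<n. ?H (R k)) \<noteq> \<infinity>"
        using neq_top_trans by auto
      have "(\<Sum>k<n. ?H (R k)) + (\<Sum>k. ?H (R (k + n))) \<le> (\<Sum>k<n. ?H (R k)) + ennreal e"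
        using n unfolding split by (simp only: add.commute)
      then have tail: "(\<Sum>k. ?H (R (k + n))) \<le> ennreal e"
        using S unfolding ennreal_add_left_cancel_le by simp
      have "X - F \<subseteq> A n \<union> (\<Union>k. R (k + n))"
      proof
        fix x assume x: "x \<in> X - F"
        \<comment> \<open>Closedness of \<open>F\<close> gives every point outside it a positive
          distance, hence a place in \<open>A n\<close> or in one of the shells beyond it.\<close>
        then have pos: "0 < infdist x F" using F False by (intro infdist_pos_not_in_closed) auto
        show "x \<in> A n \<union> (\<Union>k. R (k + n))"
        proof (cases "1 / real (Suc n) \<le> infdist x F")
          case nn: False
          let ?P = "\<lambda>m. 1 / real (Suc m) \<le> infdist x F"
          define m where "m = (LEAST m. ?P m)"
          obtain m0 where "?P m0"
            using reals_Archimedean[OF pos] by (auto simp: inverse_eq_divide dest: less_imp_le)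
          then have m: "1 / real (Suc m) \<le> infdist x F"
            unfolding m_def by (rule LeastI[of ?P])
          have "n < m"
          proof (rule ccontr)
            assume "\<not> n < m"
            then have "1 / real (Suc n) \<le> 1 / real (Suc m)" by (intro divide_left_mono) auto
            with m nn show False by simp
          qed
          then have "m - 1 < (LEAST m. ?P m)" unfolding m_def by simp
          then have "\<not> ?P (m - 1)" by (rule not_less_Least)
          with m \<open>n < m\<close> x have "x \<in> R ((m - 1 - n) + n)"
            by (auto simp: R_def)
          then show ?thesis by blast
        qed (use x in \<open>auto simp: A_def\<close>)
      qed
      then have "?H (X - F) \<le> ?H (A n) + ?H (\<Union>k. R (k + n))"
        using hausdorff1_outer_mono hausdorff1_outer_Un order_trans by blast
      also have "\<dots> \<le> ?H (A n) + ennreal e"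
        using hausdorff1_outer_UN[of "\<lambda>k. R (k + n)"] tail by (intro add_left_mono) auto
      finally have "?H (X \<inter> F) + ?H (X - F) \<le> (?H (X \<inter> F) + ?H (A n)) + ennreal e"
        by (simp add: add.assoc add_left_mono)
      also have "?H (X \<inter> F) + ?H (A n) \<le> ?H ((X \<inter> F) \<union> A n)"
      proof (rule hausdorff1_outer_separated[of "1 / real (Suc n)"])
        fix x y assume "x \<in> X \<inter> F" "y \<in> A n"
        then show "1 / real (Suc n) \<le> dist x y"
          using infdist_le[of x F y] by (auto simp: A_def dist_commute)
      qed simp
      also have "\<dots> \<le> ?H X" by (rule hausdorff1_outer_mono) (auto simp: A_def)
      finally show "?H (X \<inter> F) + ?H (X - F) \<le> ?H X + ennreal e" by (simp add: add_right_mono)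
    qed
  qed simp
  have "?H (F \<inter> X) + ?H ((UNIV - F) \<inter> X) = ?H X" for X
  proof (rule antisym)
    show "?H (F \<inter> X) + ?H ((UNIV - F) \<inter> X) \<le> ?H X"
      using main[of X] by (simp add: Int_commute Diff_eq)
    have "X = (F \<inter> X) \<union> ((UNIV - F) \<inter> X)" by auto
    then show "?H X \<le> ?H (F \<inter> X) + ?H ((UNIV - F) \<inter> X)"
      using hausdorff1_outer_Un by metis
  qed
  then show ?thesis by (simp add: sets_hausdorff1 lambda_system_def)
qed (auto)

lemma space_hausdorff1 [simp]: "space hausdorff1 = UNIV"
  unfolding hausdorff1_def by (rule space_measure_of) simp

lemma borel_sets_hausdorff1: "A \<in> sets borel \<Longrightarrow> A \<in> sets hausdorff1"
proof -
  have "sigma_sets UNIV (Collect closed) \<subseteq> sets hausdorff1"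
    using sets.sigma_sets_subset[of "Collect closed" hausdorff1] closed_sets_hausdorff1 by auto
  then show "A \<in> sets borel \<Longrightarrow> A \<in> sets hausdorff1"
    by (subst (asm) borel_eq_closed) (auto simp: sets_measure_of)
qed

lemma borel_measurable_hausdorff1 [measurable (raw)]:
  "f \<in> borel_measurable borel \<Longrightarrow> f \<in> borel_measurable hausdorff1"
  by (auto simp: measurable_def borel_sets_hausdorff1)

lemma emeasure_hausdorff1_borel: "A \<in> sets borel \<Longrightarrow> emeasure hausdorff1 A = hausdorff1_outer A"
  by (intro emeasure_hausdorff1 borel_sets_hausdorff1)

section \<open>Eilenberg's inequality\<close>

lemma one_over_Suc_tendsto_0: "(\<lambda>n. 1 / real (Suc n)) \<longlonglongrightarrow> 0"
  using LIMSEQ_inverse_real_of_nat by (simp add: inverse_eq_divide)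

text \<open>Links Hausdorff-type sums to area. The covering sets are squares with disjoint interiors
  inside an open set of almost the same area as \<open>A\<close>. The factor 2 is the ratio of the
  squared diagonal of a square to its area.\<close>

lemma small_square_cover:
  fixes A :: "complex set"
  assumes A: "A \<in> sets borel" "bounded A" and pos: "0 < \<delta>" "0 < \<eta>"
  obtains U :: "nat \<Rightarrow> complex set"
  where "A \<subseteq> (\<Union>i. U i)" "\<And>i. compact (U i)" "\<And>i. diameter (U i) \<le> \<delta>"
    "(\<Sum>i. ennreal ((diameter (U i))\<^sup>2)) \<le> 2 * (emeasure lborel A + ennreal \<eta>)"
proof -
  obtain W where W: "open W" "A \<subseteq> W" "emeasure lborel (W - A) < \<eta>"
    using outer_regular_lborel[OF A(1) pos(2)] by blast
  obtain r where r: "0 < r" "A \<subseteq> ball 0 r"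
    using A(2) bounded_subset_ballD by blast
  define a where "a = Complex (- r) (- r)"
  define b where "b = Complex r r"
  have "A \<subseteq> cbox a b"
  proof
    fix z assume "z \<in> A"
    then have "cmod z < r" using r by auto
    then show "z \<in> cbox a b"
      using abs_Re_le_cmod[of z] abs_Im_le_cmod[of z] by (auto simp: a_def b_def in_cbox_complex_iff)
  qed
  moreover have "box a b \<noteq> {}"
    using r by (auto simp: box_ne_empty a_def b_def Basis_complex_def)
  \<comment> \<open>On \<open>W\<close> the gauge forces each square both into \<open>W\<close> and
    to diameter at most \<delta>. Tags lie in \<open>A\<close>, so off \<open>W\<close> any open
    neighbourhood will do.\<close>
  moreover define g where "g x = (if x \<in> W then W \<inter> ball x (\<delta>/2) else ball x 1)" for x
  have "gauge g"
    using W pos by (auto simp: gauge_def g_def)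
  ultimately obtain \<D> where D: "countable \<D>" "\<Union>\<D> \<subseteq> cbox a b"
    "\<And>K. K \<in> \<D> \<Longrightarrow> interior K \<noteq> {} \<and> (\<exists>c d. K = cbox c d)"
    "pairwise (\<lambda>A B. interior A \<inter> interior B = {}) \<D>"
    "\<And>K. K \<in> \<D> \<Longrightarrow> \<exists>x \<in> A \<inter> K. K \<subseteq> g x"
    "\<And>u v. cbox u v \<in> \<D> \<Longrightarrow> \<exists>n. \<forall>i \<in> Basis. v \<bullet> i - u \<bullet> i = (b \<bullet> i - a \<bullet> i) / 2^n"
    "A \<subseteq> \<Union>\<D>"
    by (rule covering_lemma) blast
  have KW: "K \<subseteq> W" "diameter K \<le> \<delta>" if "K \<in> \<D>" for K
  proof -
    obtain x where x: "x \<in> A" "x \<in> K" "K \<subseteq> g x" using D(5)[OF \<open>K \<in> \<D>\<close>] by blast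
    then have g: "g x = W \<inter> ball x (\<delta>/2)" using W by (auto simp: g_def)
    show "K \<subseteq> W" using x g by auto
    have "K \<subseteq> ball x (\<delta>/2)" using x g by auto
    then have "diameter K \<le> diameter (ball x (\<delta>/2))" by (rule diameter_subset) simp
    then show "diameter K \<le> \<delta>" using pos by (simp add: diameter_ball)
  qed
  have Karea: "ennreal ((diameter K)\<^sup>2) = 2 * emeasure lborel (interior K)" if "K \<in> \<D>" for K
  proof -
    obtain c d where K: "K = cbox c d" using D(3)[OF \<open>K \<in> \<D>\<close>] by blast
    then obtain n where n: "\<forall>i \<in> Basis. d \<bullet> i - c \<bullet> i = (b \<bullet> i - a \<bullet> i) / 2^n"
      using D(6) \<open>K \<in> \<D>\<close> by blast
    \<comment> \<open>The initial box is a square and \<open>covering_lemma\<close> gives both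
      coordinates the same exponent \<open>n\<close>, so every cell is a square.\<close>
    define s where "s = 2 * r / 2^n"
    have s: "Re d - Re c = s" "Im d - Im c = s" "0 \<le> s"
      using n r by (auto simp: Basis_complex_def s_def a_def b_def)
    then have le: "\<forall>i\<in>Basis. c \<bullet> i \<le> d \<bullet> i" by (auto simp: Basis_complex_def)
    have "diameter K = dist c d" unfolding K by (rule diameter_cbox) (use le in blast)
    then have "(diameter K)\<^sup>2 = 2 * s\<^sup>2"
      using s by (simp add: dist_norm cmod_power2 power2_commute[of "Re c"] power2_commute[of "Im c"])
    moreover have "emeasure lborel (interior K) = ennreal (s\<^sup>2)"
      unfolding K interior_cbox using le s
      by (subst emeasure_lborel_box) (auto simp: Basis_complex_def power2_eq_square)
    ultimately show ?thesis using s by (simp add: ennreal_mult flip: ennreal_numeral)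
  qed
  define I where "I = to_nat_on \<D> ` \<D>"
  \<comment> \<open>Numbers that do not encode a square give the empty set, so finite families are
    included.\<close>
  define U where "U i = (if i \<in> I then from_nat_into \<D> i else {})" for i
  have UD: "U i \<in> \<D>" if "i \<in> I" for i
    using that D(1) by (auto simp: U_def I_def)
  show thesis
  proof (rule that)
    show "A \<subseteq> (\<Union>i. U i)"
    proof
      fix x assume "x \<in> A"
      with D(7) obtain K where "K \<in> \<D>" "x \<in> K" by blast
      then have "x \<in> U (to_nat_on \<D> K)" using D(1) by (simp add: U_def I_def)
      then show "x \<in> (\<Union>i. U i)" by blast
    qed
    show "compact (U i)" for i
    proof (cases "i \<in> I")
      case True
      then show ?thesis using D(3)[OF UD[OF True]] by (metis compact_cbox)
    qed (simp add: U_def)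
    show "diameter (U i) \<le> \<delta>" for i
      using KW(2)[OF UD[of i]] pos by (cases "i \<in> I") (auto simp: U_def)
    have disj: "disjoint_family (\<lambda>i. interior (U i))"
      unfolding disjoint_family_on_def
    proof safe
      fix i j x assume ij: "i \<noteq> j" "x \<in> interior (U i)" "x \<in> interior (U j)"
      then have I: "i \<in> I" "j \<in> I" by (auto simp: U_def split: if_splits)
      then have "U i \<noteq> U j"
        using ij(1) by (simp add: U_def I_def) (metis to_nat_on_from_nat_into)
      with I UD D(4) ij show "x \<in> {}" unfolding pairwise_def by blast
    qed
    have "(\<Sum>i. ennreal ((diameter (U i))\<^sup>2)) = (\<Sum>i. 2 * emeasure lborel (interior (U i)))"
    proof (rule arg_cong[where f = suminf], rule ext)
      fix i show "ennreal ((diameter (U i))\<^sup>2) = 2 * emeasure lborel (interior (U i))"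
        using Karea[OF UD[of i]] by (cases "i \<in> I") (auto simp: U_def)
    qed
    also have "\<dots> = 2 * (\<Sum>i. emeasure lborel (interior (U i)))" by simp
    finally have sq: "(\<Sum>i. ennreal ((diameter (U i))\<^sup>2)) = 2 * (\<Sum>i. emeasure lborel (interior (U i)))" .
    have "(\<Sum>i. emeasure lborel (interior (U i))) = emeasure lborel (\<Union>i. interior (U i))"
      by (rule suminf_emeasure) (use disj in auto)
    also have "\<dots> \<le> emeasure lborel W"
    proof (rule emeasure_mono)
      have "U i \<subseteq> W" for i using KW(1)[OF UD[of i]] by (cases "i \<in> I") (auto simp: U_def)
      then show "(\<Union>i. interior (U i)) \<subseteq> W" using interior_subset by blast
    qed (use W in simp)
    also have "\<dots> = emeasure lborel (A \<union> (W - A))" using W by (simp add: Un_absorb1)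
    also have "\<dots> \<le> emeasure lborel A + emeasure lborel (W - A)"
      using A W by (intro emeasure_subadditive) auto
    also have "\<dots> \<le> emeasure lborel A + ennreal \<eta>"
      using W by (intro add_left_mono) simp
    finally show "(\<Sum>i. ennreal ((diameter (U i))\<^sup>2)) \<le> 2 * (emeasure lborel A + ennreal \<eta>)"
      unfolding sq by (rule mult_left_mono) simp
  qed
qed

text \<open>A covering set \<open>U\<close> contributes its diameter to the levels in
  \<open>u\<close> \<open>U\<close>, a set of length at most twice that diameter. Integrating over
  the levels gives at most twice the sum of squared diameters, which
  \<open>small_square_cover\<close> bounds by twice the area: hence the constant 4. Letting the mesh
  tend to 0, the lower limit of these sums dominates the Hausdorff measure of each level set, and
  Fatou's lemma keeps the bound on the integral.\<close>

lemma eilenberg_set: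
  fixes u :: "complex \<Rightarrow> real"
  assumes A: "A \<in> sets borel" "bounded A" and u: "\<And>x y. \<bar>u x - u y\<bar> \<le> dist x y"
  obtains \<Phi> where "\<Phi> \<in> borel_measurable borel"
    "\<And>r. hausdorff1_outer {z \<in> A. u z = r} \<le> \<Phi> r"
    "(\<integral>\<^sup>+ r. \<Phi> r \<partial>lborel) \<le> 4 * emeasure lborel A"
proof -
  define \<delta> where "\<delta> n = 1 / real (Suc n)" for n
  have \<delta>: "0 < \<delta> n" for n by (simp add: \<delta>_def)
  have "\<exists>U :: nat \<Rightarrow> complex set. A \<subseteq> (\<Union>i. U i) \<and> (\<forall>i. compact (U i)) \<and> (\<forall>i. diameter (U i) \<le> \<delta> n) \<and>
    (\<Sum>i. ennreal ((diameter (U i))\<^sup>2)) \<le> 2 * (emeasure lborel A + ennreal (\<delta> n))" for n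
    using small_square_cover[OF A \<delta>[of n] \<delta>[of n]] by metis
  then obtain U :: "nat \<Rightarrow> nat \<Rightarrow> complex set" where U: "\<And>n. A \<subseteq> (\<Union>i. U n i)"
    "\<And>n i. compact (U n i)" "\<And>n i. diameter (U n i) \<le> \<delta> n"
    "\<And>n. (\<Sum>i. ennreal ((diameter (U n i))\<^sup>2)) \<le> 2 * (emeasure lborel A + ennreal (\<delta> n))"
    by metis
  have cont: "continuous_on S u" for S
    by (rule lipschitz_on_continuous_on[of 1]) (auto simp: lipschitz_on_def dist_real_def u)
  have meas: "u ` U n i \<in> sets borel" for n i
    using compact_continuous_image[OF cont U(2)] by (simp add: borel_compact)
  define \<phi> where "\<phi> n r = (\<Sum>i. ennreal (diameter (U n i)) * indicator (u ` U n i) r)" for n r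
  have \<phi>_meas [measurable]: "\<phi> n \<in> borel_measurable borel" for n
    unfolding \<phi>_def using meas by measurable
  have "hausdorff1_pre (\<delta> n) {z \<in> A. u z = r} \<le> \<phi> n r" for n r
  proof -
    define V where "V i = (if r \<in> u ` U n i then U n i else {})" for i
    have "{z \<in> A. u z = r} \<subseteq> (\<Union>i. V i)"
    proof
      fix z assume z: "z \<in> {z \<in> A. u z = r}"
      with U(1)[of n] obtain i where "z \<in> U n i" by blast
      with z have "z \<in> V i" by (auto simp: V_def)
      then show "z \<in> (\<Union>i. V i)" by blast
    qed
    then have "hausdorff1_pre (\<delta> n) {z \<in> A. u z = r} \<le> (\<Sum>i. ennreal (diameter (V i)))"
      unfolding hausdorff1_pre_def using U(2,3) less_imp_le[OF \<delta>]
      by (intro INF_lower) (auto simp: V_def compact_imp_bounded)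
    also have "\<dots> = \<phi> n r"
      unfolding \<phi>_def by (rule arg_cong[where f = suminf]) (auto simp: V_def)
    finally show ?thesis .
  qed
  note pre = this
  define \<Phi> where "\<Phi> r = liminf (\<lambda>n. \<phi> n r)" for r
  show thesis
  proof (rule that)
    show "\<Phi> \<in> borel_measurable borel" unfolding \<Phi>_def by measurable
    fix r
    show "hausdorff1_outer {z \<in> A. u z = r} \<le> \<Phi> r"
      unfolding hausdorff1_outer_def
    proof (rule SUP_least)
      fix e :: real assume "e \<in> {0<..}"
      then have "0 < e" by simp
      then obtain N where N: "\<delta> N < e" using reals_Archimedean by (auto simp: \<delta>_def inverse_eq_divide)
      show "hausdorff1_pre e {z \<in> A. u z = r} \<le> \<Phi> r"
        unfolding \<Phi>_def
      proof (intro Liminf_bounded eventually_sequentiallyI[of N])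
        fix n assume "N \<le> n"
        then have "\<delta> n \<le> \<delta> N" unfolding \<delta>_def by (intro divide_left_mono) auto
        with N have "hausdorff1_pre e {z \<in> A. u z = r} \<le> hausdorff1_pre (\<delta> n) {z \<in> A. u z = r}"
          by (intro hausdorff1_pre_antimono) simp
        then show "hausdorff1_pre e {z \<in> A. u z = r} \<le> \<phi> n r" using pre order_trans by blast
      qed
    qed
  next
    have int: "(\<integral>\<^sup>+ r. \<phi> n r \<partial>lborel) \<le> 4 * (emeasure lborel A + ennreal (\<delta> n))" for n
    proof -
      have "emeasure lborel (u ` U n i) \<le> ennreal (2 * diameter (U n i))" for i
      proof (cases "U n i = {}")
        case False
        then obtain x where x: "x \<in> U n i" by blast
        let ?d = "diameter (U n i)"
        have "\<bar>u y - u x\<bar> \<le> ?d" if "y \<in> U n i" for y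
          using u[of y x] diameter_bounded_bound[OF compact_imp_bounded[OF U(2)] that x] by simp
        then have "u ` U n i \<subseteq> {u x - ?d .. u x + ?d}" by (force simp: abs_le_iff)
        then have "emeasure lborel (u ` U n i) \<le> emeasure lborel {u x - ?d .. u x + ?d}"
          by (rule emeasure_mono) simp
        also have "\<dots> = ennreal (2 * ?d)"
          using diameter_ge_0[OF compact_imp_bounded[OF U(2)[of n i]]] by simp
        finally show ?thesis .
      qed simp
      note len = this
      have "(\<integral>\<^sup>+ r. \<phi> n r \<partial>lborel) = (\<Sum>i. \<integral>\<^sup>+ r. ennreal (diameter (U n i)) * indicator (u ` U n i) r \<partial>lborel)"
        unfolding \<phi>_def using meas by (intro nn_integral_suminf borel_measurable_times_ennreal borel_measurable_indicator) auto
      also have "\<dots> = (\<Sum>i. ennreal (diameter (U n i)) * emeasure lborel (u ` U n i))"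
        using meas by (simp add: nn_integral_cmult_indicator)
      also have "\<dots> \<le> (\<Sum>i. ennreal (diameter (U n i)) * ennreal (2 * diameter (U n i)))"
        by (intro suminf_le mult_left_mono len) auto
      also have "\<dots> = (\<Sum>i. 2 * ennreal ((diameter (U n i))\<^sup>2))"
      proof (rule arg_cong[where f = suminf], rule ext)
        fix i
        have "0 \<le> diameter (U n i)" by (rule diameter_ge_0[OF compact_imp_bounded[OF U(2)]])
        then show "ennreal (diameter (U n i)) * ennreal (2 * diameter (U n i)) = 2 * ennreal ((diameter (U n i))\<^sup>2)"
          by (simp add: power2_eq_square mult_ac flip: ennreal_mult ennreal_numeral)
      qed
      also have "\<dots> = 2 * (\<Sum>i. ennreal ((diameter (U n i))\<^sup>2))" by simp
      also have "\<dots> \<le> 2 * (2 * (emeasure lborel A + ennreal (\<delta> n)))"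
        by (intro mult_left_mono U(4)) simp
      finally show ?thesis by (simp add: mult.assoc[symmetric])
    qed
    have "(\<integral>\<^sup>+ r. \<Phi> r \<partial>lborel) \<le> liminf (\<lambda>n. \<integral>\<^sup>+ r. \<phi> n r \<partial>lborel)"
      unfolding \<Phi>_def by (rule nn_integral_liminf) simp
    also have "\<dots> \<le> liminf (\<lambda>n. 4 * (emeasure lborel A + ennreal (\<delta> n)))"
      using int by (intro Liminf_mono always_eventually allI)
    also have "\<dots> = 4 * (emeasure lborel A + ennreal 0)"
    proof (rule lim_imp_Liminf)
      have "\<delta> \<longlonglongrightarrow> 0" unfolding \<delta>_def by (rule one_over_Suc_tendsto_0)
      then show "(\<lambda>n. 4 * (emeasure lborel A + ennreal (\<delta> n))) \<longlonglongrightarrow> 4 * (emeasure lborel A + ennreal 0)"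
        by (intro ennreal_tendsto_cmult tendsto_add tendsto_const tendsto_ennrealI) simp
    qed simp
    finally show "(\<integral>\<^sup>+ r. \<Phi> r \<partial>lborel) \<le> 4 * emeasure lborel A" by simp
  qed
qed

text \<open>The integral over a level set need not be measurable in the level, hence the majorant \<open>\<Phi>\<close>.\<close>
lemma eilenberg:
  fixes u :: "complex \<Rightarrow> real"
  assumes \<rho>: "\<rho> \<in> borel_measurable borel" and B: "B \<in> sets borel" "bounded B"
    and u: "\<And>x y. \<bar>u x - u y\<bar> \<le> dist x y"
  obtains \<Phi> where "\<Phi> \<in> borel_measurable borel"
    "\<And>r. (\<integral>\<^sup>+ z\<in>{z \<in> B. u z = r}. \<rho> z \<partial>hausdorff1) \<le> \<Phi> r"
    "(\<integral>\<^sup>+ r. \<Phi> r \<partial>lborel) \<le> 4 * (\<integral>\<^sup>+ z\<in>B. \<rho> z \<partial>lborel)"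
proof -
  have [measurable]: "u \<in> borel_measurable borel"
    by (intro borel_measurable_continuous_onI lipschitz_on_continuous_on[of 1])
      (auto simp: lipschitz_on_def dist_real_def u)
  note B(1)[measurable]
  have lev: "{z \<in> B. u z = r} \<in> sets borel" for r
    using B(1) by measurable
  have lev1 [measurable]: "{z \<in> B. u z = r} \<in> sets hausdorff1" for r
    using lev by (rule borel_sets_hausdorff1)
  have "\<exists>\<Phi> \<in> borel_measurable borel. (\<forall>r. (\<integral>\<^sup>+ z\<in>{z \<in> B. u z = r}. \<rho> z \<partial>hausdorff1) \<le> \<Phi> r) \<and>
    (\<integral>\<^sup>+ r. \<Phi> r \<partial>lborel) \<le> 4 * (\<integral>\<^sup>+ z\<in>B. \<rho> z \<partial>lborel)"
    using \<rho>
  proof (induction rule: borel_measurable_induct)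
    case (cong f g)
    then have "f = g" by auto
    with cong show ?case by simp
  next
    case (set A)
    then have [measurable]: "A \<in> sets borel" by simp
    have "A \<inter> B \<in> sets borel" "bounded (A \<inter> B)" using B by auto
    then obtain \<Phi> where \<Phi>: "\<Phi> \<in> borel_measurable borel"
      "\<And>r. hausdorff1_outer {z \<in> A \<inter> B. u z = r} \<le> \<Phi> r"
      "(\<integral>\<^sup>+ r. \<Phi> r \<partial>lborel) \<le> 4 * emeasure lborel (A \<inter> B)"
      using eilenberg_set u by blast
    have "(\<integral>\<^sup>+ z\<in>{z \<in> B. u z = r}. indicator A z \<partial>hausdorff1) \<le> \<Phi> r" for r
    proof -
      have b: "{z \<in> A \<inter> B. u z = r} \<in> sets borel" by measurable
      have "(\<integral>\<^sup>+ z\<in>{z \<in> B. u z = r}. indicator A z \<partial>hausdorff1) =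
          (\<integral>\<^sup>+ z. indicator {z \<in> A \<inter> B. u z = r} z \<partial>hausdorff1)"
        by (rule nn_integral_cong) (auto split: split_indicator)
      also have "\<dots> = hausdorff1_outer {z \<in> A \<inter> B. u z = r}"
        using b by (simp add: borel_sets_hausdorff1 emeasure_hausdorff1_borel)
      finally show ?thesis using \<Phi>(2) by simp
    qed
    moreover have "(\<integral>\<^sup>+ z\<in>B. indicator A z \<partial>lborel) = emeasure lborel (A \<inter> B)"
    proof -
      have "(\<integral>\<^sup>+ z\<in>B. indicator A z \<partial>lborel) = (\<integral>\<^sup>+ z. indicator (A \<inter> B) z \<partial>lborel)"
        by (rule nn_integral_cong) (auto split: split_indicator)
      then show ?thesis by simp
    qed
    ultimately show ?case using \<Phi> by (intro bexI[of _ \<Phi>]) auto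
  next
    case (mult v c)
    then obtain \<Phi> where \<Phi>: "\<Phi> \<in> borel_measurable borel"
      "\<And>r. (\<integral>\<^sup>+ z\<in>{z \<in> B. u z = r}. v z \<partial>hausdorff1) \<le> \<Phi> r"
      "(\<integral>\<^sup>+ r. \<Phi> r \<partial>lborel) \<le> 4 * (\<integral>\<^sup>+ z\<in>B. v z \<partial>lborel)"
      by blast
    note [measurable] = \<Phi>(1) \<open>v \<in> borel_measurable borel\<close>
    have "(\<integral>\<^sup>+ z\<in>{z \<in> B. u z = r}. c * v z \<partial>hausdorff1) \<le> c * \<Phi> r" for r
      using \<Phi>(2)[of r] by (simp add: mult.assoc nn_integral_cmult mult_left_mono)
    moreover have "(\<integral>\<^sup>+ r. c * \<Phi> r \<partial>lborel) \<le> 4 * (\<integral>\<^sup>+ z\<in>B. c * v z \<partial>lborel)"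
      using mult_left_mono[OF \<Phi>(3), of c] by (simp add: mult.assoc nn_integral_cmult mult_ac)
    ultimately show ?case using \<Phi>(1) by (intro bexI[of _ "\<lambda>r. c * \<Phi> r"]) auto
  next
    case (add v w)
    then obtain \<Phi> \<Psi> where \<Phi>: "\<Phi> \<in> borel_measurable borel"
      "\<And>r. (\<integral>\<^sup>+ z\<in>{z \<in> B. u z = r}. v z \<partial>hausdorff1) \<le> \<Phi> r"
      "(\<integral>\<^sup>+ r. \<Phi> r \<partial>lborel) \<le> 4 * (\<integral>\<^sup>+ z\<in>B. v z \<partial>lborel)"
      and \<Psi>: "\<Psi> \<in> borel_measurable borel"
      "\<And>r. (\<integral>\<^sup>+ z\<in>{z \<in> B. u z = r}. w z \<partial>hausdorff1) \<le> \<Psi> r"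
      "(\<integral>\<^sup>+ r. \<Psi> r \<partial>lborel) \<le> 4 * (\<integral>\<^sup>+ z\<in>B. w z \<partial>lborel)"
      by blast
    note [measurable] = \<Phi>(1) \<Psi>(1) \<open>v \<in> borel_measurable borel\<close> \<open>w \<in> borel_measurable borel\<close>
    have "(\<integral>\<^sup>+ z\<in>{z \<in> B. u z = r}. w z + v z \<partial>hausdorff1) \<le> \<Psi> r + \<Phi> r" for r
      using add_mono[OF \<Psi>(2) \<Phi>(2), of r r] by (simp add: distrib_right nn_integral_add)
    moreover have "(\<integral>\<^sup>+ r. \<Psi> r + \<Phi> r \<partial>lborel) \<le> 4 * (\<integral>\<^sup>+ z\<in>B. w z + v z \<partial>lborel)"
      using add_mono[OF \<Psi>(3) \<Phi>(3)] by (simp add: distrib_right nn_integral_add distrib_left)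
    ultimately show ?case using \<Phi>(1) by (intro bexI[of _ "\<lambda>r. \<Psi> r + \<Phi> r"]) auto
  next
    case (seq V)
    note [measurable] = seq.hyps(1)
    have "\<forall>i. \<exists>\<phi>. \<phi> \<in> borel_measurable borel \<and>
      (\<forall>r. (\<integral>\<^sup>+ z\<in>{z \<in> B. u z = r}. V i z \<partial>hausdorff1) \<le> \<phi> r) \<and>
      (\<integral>\<^sup>+ r. \<phi> r \<partial>lborel) \<le> 4 * (\<integral>\<^sup>+ z\<in>B. V i z \<partial>lborel)"
      using seq.IH by blast
    from choice[OF this] obtain \<phi> where \<phi>: "\<And>i. \<phi> i \<in> borel_measurable borel"
      "\<And>i r. (\<integral>\<^sup>+ z\<in>{z \<in> B. u z = r}. V i z \<partial>hausdorff1) \<le> \<phi> i r"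
      "\<And>i. (\<integral>\<^sup>+ r. \<phi> i r \<partial>lborel) \<le> 4 * (\<integral>\<^sup>+ z\<in>B. V i z \<partial>lborel)"
      by blast
    note [measurable] = \<phi>(1)
    have inc: "incseq (\<lambda>i z. V i z * indicator S z)" for S
      using seq.hyps(3) by (auto simp: incseq_def le_fun_def intro: mult_right_mono)
    have sup: "(SUP i. V i) z * indicator S z = (SUP i. V i z * indicator S z)" for S z
      by (simp add: SUP_mult_right_ennreal image_comp o_def)
    \<comment> \<open>The majorants come from arbitrary choices and need not increase with
      \<open>i\<close>. A lower limit still works, because the integrals that they dominate do
      increase.\<close>
    define \<Phi> where "\<Phi> r = liminf (\<lambda>i. \<phi> i r)" for r
    have "(\<integral>\<^sup>+ z\<in>{z \<in> B. u z = r}. (SUP i. V i) z \<partial>hausdorff1) \<le> \<Phi> r" for r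
    proof -
      let ?J = "\<lambda>i. \<integral>\<^sup>+ z\<in>{z \<in> B. u z = r}. V i z \<partial>hausdorff1"
      have "(\<integral>\<^sup>+ z\<in>{z \<in> B. u z = r}. (SUP i. V i) z \<partial>hausdorff1) = (SUP i. ?J i)"
        unfolding sup by (rule nn_integral_monotone_convergence_SUP[OF inc]) measurable
      also have "\<dots> \<le> \<Phi> r"
      proof (rule SUP_least)
        fix i
        show "?J i \<le> \<Phi> r"
          unfolding \<Phi>_def
        proof (intro Liminf_bounded eventually_sequentiallyI[of i])
          fix j assume "i \<le> j"
          then have "?J i \<le> ?J j"
            using inc by (intro nn_integral_mono) (auto simp: incseq_def le_fun_def)
          then show "?J i \<le> \<phi> j r" using \<phi>(2) order_trans by blast
        qed
      qed
      finally show ?thesis .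
    qed
    moreover have "(\<integral>\<^sup>+ r. \<Phi> r \<partial>lborel) \<le> 4 * (\<integral>\<^sup>+ z\<in>B. (SUP i. V i) z \<partial>lborel)"
    proof -
      have "(\<integral>\<^sup>+ r. \<Phi> r \<partial>lborel) \<le> liminf (\<lambda>i. \<integral>\<^sup>+ r. \<phi> i r \<partial>lborel)"
        unfolding \<Phi>_def by (rule nn_integral_liminf) simp
      also have "\<dots> \<le> limsup (\<lambda>i. \<integral>\<^sup>+ r. \<phi> i r \<partial>lborel)"
        by (rule Liminf_le_Limsup) simp
      also have "\<dots> \<le> 4 * (\<integral>\<^sup>+ z\<in>B. (SUP i. V i) z \<partial>lborel)"
      proof (intro Limsup_bounded always_eventually allI)
        fix i
        have "(\<integral>\<^sup>+ z\<in>B. V i z \<partial>lborel) \<le> (\<integral>\<^sup>+ z\<in>B. (SUP i. V i) z \<partial>lborel)"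
          by (intro nn_integral_mono mult_right_mono) (auto intro: SUP_upper)
        then show "(\<integral>\<^sup>+ r. \<phi> i r \<partial>lborel) \<le> 4 * (\<integral>\<^sup>+ z\<in>B. (SUP i. V i) z \<partial>lborel)"
          by (rule order_trans[OF \<phi>(3) mult_left_mono]) simp
      qed
      finally show ?thesis .
    qed
    moreover have "\<Phi> \<in> borel_measurable borel" unfolding \<Phi>_def by measurable
    ultimately show ?case by (intro bexI[of _ \<Phi>]) auto
  qed
  then show thesis using that by blast
qed

section \<open>Length and area under conformal maps\<close>

lemma borel_preimage_continuous_on:
  fixes f :: "complex \<Rightarrow> 'b::topological_space"
  assumes "continuous_on E f" "E \<in> sets borel" "J \<in> sets borel"
  shows "{z \<in> E. f z \<in> J} \<in> sets borel"
proof -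
  have "f \<in> borel_measurable (restrict_space borel E)"
    using assms(1) by (rule borel_measurable_continuous_on_restrict)
  from measurable_sets[OF this assms(3)]
  have "f -` J \<inter> E \<in> sets (restrict_space borel E)" by (simp add: space_restrict_space)
  then have "f -` J \<inter> E \<in> sets borel" using assms(2) by (auto simp: sets_restrict_space_iff)
  moreover have "f -` J \<inter> E = {z \<in> E. f z \<in> J}" by auto
  ultimately show ?thesis by simp
qed

lemma ennreal_le_cmult_of_le_inverse:
  fixes X a C :: ennreal
  assumes C: "C < top" and le: "\<And>n. X \<le> C * (a + ennreal (1 / Suc n))"
  shows "X \<le> C * a"
proof -
  have "(\<lambda>n. 1 / real (Suc n)) \<longlonglongrightarrow> 0"
    by (rule one_over_Suc_tendsto_0)
  then have "(\<lambda>n. C * (a + ennreal (1 / Suc n))) \<longlonglongrightarrow> C * (a + ennreal 0)"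
    by (intro ennreal_tendsto_cmult C tendsto_add tendsto_const tendsto_ennrealI)
  then have "X \<le> C * (a + ennreal 0)"
    by (rule LIMSEQ_le_const) (use le in blast)
  then show ?thesis by simp
qed

text \<open>A covering set of diameter \<open>d\<close> is mapped into an interval of length
  \<open>2 * c * d\<close> around the image of one of its points. The Borel superset
  \<open>N\<close> avoids the question whether the image itself is measurable.\<close>

lemma lipschitz_image_hausdorff1:
  fixes u :: "complex \<Rightarrow> real"
  assumes c: "0 < c" and u: "\<And>x y. x \<in> A \<Longrightarrow> y \<in> A \<Longrightarrow> \<bar>u x - u y\<bar> \<le> c * dist x y"
  obtains N where "N \<in> sets borel" "u ` A \<subseteq> N" "emeasure lborel N \<le> ennreal (2 * c) * hausdorff1_outer A"
proof (cases "hausdorff1_outer A = \<infinity>")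
  case True
  show ?thesis
    by (rule that[of UNIV]) (use True c in \<open>auto simp: ennreal_mult_top\<close>)
next
  case fin: False
  have "\<exists>N\<in>sets borel. u ` A \<subseteq> N \<and> emeasure lborel N \<le> ennreal (2 * c) * (hausdorff1_outer A + ennreal (1 / Suc n))" for n
  proof -
    have "hausdorff1_pre 1 A \<le> hausdorff1_outer A"
      unfolding hausdorff1_outer_def by (rule SUP_upper) simp
    also have "\<dots> < hausdorff1_outer A + ennreal (1 / Suc n)"
      using fin by (simp add: ennreal_add_left_cancel_less less_top)
    finally obtain U :: "nat \<Rightarrow> complex set" where U: "A \<subseteq> (\<Union>i. U i)" "\<And>i. bounded (U i)"
      "(\<Sum>i. ennreal (diameter (U i))) < hausdorff1_outer A + ennreal (1 / Suc n)"
      unfolding hausdorff1_pre_def INF_less_iff by blast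
    define x where "x i = (SOME x. x \<in> U i \<inter> A)" for i
    define d where "d i = c * diameter (U i)" for i
    define I where "I i = (if U i \<inter> A = {} then {} else {u (x i) - d i .. u (x i) + d i})" for i
    have "u ` A \<subseteq> (\<Union>i. I i)"
    proof
      fix t assume "t \<in> u ` A"
      then obtain y where y: "y \<in> A" "t = u y" by blast
      with U(1) obtain i where i: "y \<in> U i" by blast
      then have x: "x i \<in> U i \<inter> A" unfolding x_def using y by (metis IntI someI_ex)
      have "\<bar>u y - u (x i)\<bar> \<le> c * dist y (x i)" using x y u by blast
      also have "\<dots> \<le> d i" unfolding d_def using c diameter_bounded_bound[OF U(2) i] x by simp
      finally show "t \<in> (\<Union>i. I i)" using x y by (auto simp: I_def abs_le_iff intro!: exI[of _ i])
    qed
    moreover have I: "I i \<in> sets borel" for i by (simp add: I_def)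
    moreover have "emeasure lborel (\<Union>i. I i) \<le> (\<Sum>i. emeasure lborel (I i))"
      using I by (intro emeasure_subadditive_countably) auto
    moreover have "(\<Sum>i. emeasure lborel (I i)) \<le> (\<Sum>i. ennreal (2 * c) * ennreal (diameter (U i)))"
    proof (intro suminf_le)
      fix i
      have "0 \<le> diameter (U i)" using diameter_ge_0[OF U(2)] .
      then show "emeasure lborel (I i) \<le> ennreal (2 * c) * ennreal (diameter (U i))"
        using c by (auto simp: I_def d_def mult_ac simp flip: ennreal_mult)
    qed auto
    moreover have "\<dots> \<le> ennreal (2 * c) * (hausdorff1_outer A + ennreal (1 / Suc n))"
      using U(3) by (simp add: mult_left_mono)
    ultimately show ?thesis by (intro bexI[of _ "\<Union>i. I i"]) (auto intro: order_trans)
  qed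
  then obtain N where N: "\<And>n. N n \<in> sets borel" "\<And>n. u ` A \<subseteq> N n"
    "\<And>n. emeasure lborel (N n) \<le> ennreal (2 * c) * (hausdorff1_outer A + ennreal (1 / Suc n))"
    by metis
  show ?thesis
  proof (rule that)
    show "(\<Inter>n. N n) \<in> sets borel" using N(1) by auto
    show "u ` A \<subseteq> (\<Inter>n. N n)" using N(2) by blast
    show "emeasure lborel (\<Inter>n. N n) \<le> ennreal (2 * c) * hausdorff1_outer A"
    proof (rule ennreal_le_cmult_of_le_inverse)
      fix n
      show "emeasure lborel (\<Inter>n. N n) \<le> ennreal (2 * c) * (hausdorff1_outer A + ennreal (1 / Suc n))"
        by (rule order_trans[OF emeasure_mono N(3)]) (use N(1) in auto)
    qed simp
  qed
qed

text \<open>The part of \<open>A\<close> in a set of diameter \<open>d\<close> is mapped into a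
  square of side \<open>2 * c * d\<close>, and small squares cover \<open>A\<close> with squared
  diameters summing to about twice its area. Hence 8 = 4 * 2.\<close>

lemma lipschitz_image_lborel:
  fixes F :: "complex \<Rightarrow> complex"
  assumes A: "A \<in> sets borel" "bounded A" and c: "0 < c"
    and F: "\<And>x y. x \<in> A \<Longrightarrow> y \<in> A \<Longrightarrow> dist (F x) (F y) \<le> c * dist x y"
    and FA: "F ` A \<in> sets borel"
  shows "emeasure lborel (F ` A) \<le> ennreal (8 * c\<^sup>2) * emeasure lborel A"
proof -
  have main: "emeasure lborel (F ` A) \<le> ennreal (8 * c\<^sup>2) * (emeasure lborel A + ennreal (1 / Suc n))" for n
  proof -
    obtain U :: "nat \<Rightarrow> complex set" where U: "A \<subseteq> (\<Union>i. U i)" "\<And>i. compact (U i)"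
      "(\<Sum>i. ennreal ((diameter (U i))\<^sup>2)) \<le> 2 * (emeasure lborel A + ennreal (1 / Suc n))"
      by (rule small_square_cover[OF A zero_less_one, of "1 / Suc n"]) (simp, blast)
    define x where "x i = (SOME x. x \<in> U i \<inter> A)" for i
    define d where "d i = c * diameter (U i)" for i
    define I where "I i = (if U i \<inter> A = {} then {} else
      cbox (F (x i) - Complex (d i) (d i)) (F (x i) + Complex (d i) (d i)))" for i
    have d0: "0 \<le> d i" for i
      unfolding d_def using c diameter_ge_0[OF compact_imp_bounded[OF U(2)]] by simp
    have "F ` A \<subseteq> (\<Union>i. I i)"
    proof
      fix t assume "t \<in> F ` A"
      then obtain y where y: "y \<in> A" "t = F y" by blast
      with U(1) obtain i where i: "y \<in> U i" by blast
      then have x: "x i \<in> U i \<inter> A" unfolding x_def using y by (metis IntI someI_ex)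
      have "dist (F y) (F (x i)) \<le> c * dist y (x i)" using x y F by blast
      also have "\<dots> \<le> d i"
        unfolding d_def using c diameter_bounded_bound[OF compact_imp_bounded[OF U(2)] i] x by simp
      finally have "cmod (F y - F (x i)) \<le> d i" by (simp add: dist_norm)
      then have "F y \<in> cbox (F (x i) - Complex (d i) (d i)) (F (x i) + Complex (d i) (d i))"
        using abs_Re_le_cmod[of "F y - F (x i)"] abs_Im_le_cmod[of "F y - F (x i)"]
        by (auto simp: in_cbox_complex_iff abs_le_iff)
      then show "t \<in> (\<Union>i. I i)" using x y by (auto simp: I_def intro!: exI[of _ i])
    qed
    then have "emeasure lborel (F ` A) \<le> emeasure lborel (\<Union>i. I i)"
      by (rule emeasure_mono) (auto simp: I_def)
    also have "\<dots> \<le> (\<Sum>i. emeasure lborel (I i))"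
      by (rule emeasure_subadditive_countably) (auto simp: I_def)
    also have "\<dots> \<le> (\<Sum>i. ennreal (4 * c\<^sup>2) * ennreal ((diameter (U i))\<^sup>2))"
    proof (intro suminf_le)
      fix i
      have "emeasure lborel (cbox (F (x i) - Complex (d i) (d i)) (F (x i) + Complex (d i) (d i))) = ennreal (4 * (d i)\<^sup>2)"
        using d0[of i] by (subst emeasure_lborel_cbox) (auto simp: Basis_complex_def power2_eq_square)
      also have "4 * (d i)\<^sup>2 = 4 * c\<^sup>2 * (diameter (U i))\<^sup>2" by (simp add: d_def power_mult_distrib)
      also have "ennreal \<dots> = ennreal (4 * c\<^sup>2) * ennreal ((diameter (U i))\<^sup>2)"
        by (simp flip: ennreal_mult)
      finally show "emeasure lborel (I i) \<le> ennreal (4 * c\<^sup>2) * ennreal ((diameter (U i))\<^sup>2)"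
        by (auto simp: I_def)
    qed auto
    also have "\<dots> = ennreal (4 * c\<^sup>2) * (\<Sum>i. ennreal ((diameter (U i))\<^sup>2))" by simp
    also have "\<dots> \<le> ennreal (4 * c\<^sup>2) * (2 * (emeasure lborel A + ennreal (1 / Suc n)))"
      by (intro mult_left_mono U(3)) simp
    also have "\<dots> = (ennreal (4 * c\<^sup>2) * 2) * (emeasure lborel A + ennreal (1 / Suc n))"
      by (simp only: mult.assoc)
    also have "ennreal (4 * c\<^sup>2) * 2 = ennreal (8 * c\<^sup>2)"
      by (simp flip: ennreal_numeral ennreal_mult)
    finally show ?thesis .
  qed
  show ?thesis by (rule ennreal_le_cmult_of_le_inverse[OF _ main]) simp
qed

text \<open>Up to a factor 2, \<open>k\<close> is a similarity with ratio \<open>L i\<close> on the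
  piece \<open>A i\<close>. Summing crude Lipschitz estimates over such pieces replaces the change
  of variables formula, at the price of a constant.\<close>

definition bilipschitz_partition ::
  "(complex \<Rightarrow> complex) \<Rightarrow> complex set \<Rightarrow> (nat \<Rightarrow> complex set) \<Rightarrow> (nat \<Rightarrow> real) \<Rightarrow> bool" where
  "bilipschitz_partition k E A L \<longleftrightarrow> disjoint_family A \<and> (\<Union>i. A i) = E \<and>
     (\<forall>i. A i \<in> sets borel \<and> bounded (A i) \<and> 0 < L i \<and>
       (\<forall>z\<in>A i. L i \<le> cmod (deriv k z) \<and> cmod (deriv k z) \<le> 2 * L i) \<and>
       (\<forall>y\<in>A i. \<forall>z\<in>A i. L i * dist y z \<le> dist (k y) (k z) \<and> dist (k y) (k z) \<le> 2 * L i * dist y z))"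

lemma bilipschitz_partitionD:
  assumes "bilipschitz_partition k E A L"
  shows "disjoint_family A" "(\<Union>i. A i) = E" "\<And>i. A i \<in> sets borel" "\<And>i. bounded (A i)" "\<And>i. 0 < L i"
    "\<And>i z. z \<in> A i \<Longrightarrow> L i \<le> cmod (deriv k z) \<and> cmod (deriv k z) \<le> 2 * L i"
    "\<And>i y z. y \<in> A i \<Longrightarrow> z \<in> A i \<Longrightarrow>
       L i * dist y z \<le> dist (k y) (k z) \<and> dist (k y) (k z) \<le> 2 * L i * dist y z"
  using assms unfolding bilipschitz_partition_def by simp_all

text \<open>Let \<open>c\<close> be the modulus of the derivative at \<open>x\<close>. Near
  \<open>x\<close> the derivative varies by at most \<open>c / 3\<close>, so \<open>k\<close> minus
  its linear part is Lipschitz with this constant on a ball. Derivative and difference quotients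
  then lie between \<open>2/3 * c\<close> and \<open>4/3 * c\<close>, whose ratio is 2. Countably
  many such balls suffice by Lindelof, and they are made disjoint.\<close>

lemma holomorphic_bilipschitz_partition:
  assumes k: "k holomorphic_on E" "open E" "\<forall>z\<in>E. deriv k z \<noteq> 0"
  obtains A L where "bilipschitz_partition k E A L"
proof -
  define good where "good S L \<longleftrightarrow> 0 < L \<and>
    (\<forall>z\<in>S. L \<le> cmod (deriv k z) \<and> cmod (deriv k z) \<le> 2 * L) \<and>
    (\<forall>y\<in>S. \<forall>z\<in>S. L * dist y z \<le> dist (k y) (k z) \<and> dist (k y) (k z) \<le> 2 * L * dist y z)" for S L
  define \<F> where "\<F> = {S. open S \<and> bounded S \<and> S \<subseteq> E \<and> (\<exists>L. good S L)}"
  have cover: "\<exists>S\<in>\<F>. x \<in> S" if x: "x \<in> E" for x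
  proof -
    define c where "c = cmod (deriv k x)"
    have c: "0 < c" using k(3) x by (simp add: c_def)
    have "continuous_on E (deriv k)"
      using holomorphic_deriv[OF k(1,2)] holomorphic_on_imp_continuous_on by blast
    then have "isCont (deriv k) x" using x k(2) by (simp add: continuous_on_eq_continuous_at)
    then obtain r1 where r1: "0 < r1" "\<And>y. dist y x < r1 \<Longrightarrow> dist (deriv k y) (deriv k x) < c / 3"
      using c unfolding continuous_at_eps_delta by (metis divide_pos_pos zero_less_numeral)
    obtain r2 where r2: "0 < r2" "ball x r2 \<subseteq> E" using k(2) x open_contains_ball by blast
    define S where "S = ball x (min r1 r2)"
    have SE: "S \<subseteq> E" using r2 by (auto simp: S_def)
    have near: "cmod (deriv k y - deriv k x) \<le> c / 3" if "y \<in> S" for y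
      using r1(2)[of y] that by (auto simp: S_def dist_norm norm_minus_commute)
    have b: "cmod ((k y - deriv k x * y) - (k z - deriv k x * z)) \<le> c / 3 * cmod (y - z)"
      if "y \<in> S" "z \<in> S" for y z
    proof (rule field_differentiable_bound[of S _ "\<lambda>w. deriv k w - deriv k x"])
      show "convex S" by (simp add: S_def)
      fix w assume w: "w \<in> S"
      then have "(k has_field_derivative deriv k w) (at w)"
        using SE by (intro holomorphic_derivI[OF k(1,2)]) blast
      then have "(k has_field_derivative deriv k w) (at w within S)"
        by (rule has_field_derivative_at_within)
      then show "((\<lambda>w. k w - deriv k x * w) has_field_derivative deriv k w - deriv k x) (at w within S)"
        by (rule DERIV_diff[OF _ DERIV_cmult_Id])
    qed (use that near in auto)
    have "good S (2/3 * c)"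
      unfolding good_def
    proof (intro conjI ballI)
      fix z assume z: "z \<in> S"
      have "c \<le> cmod (deriv k z) + cmod (deriv k z - deriv k x)"
        unfolding c_def by (metis norm_minus_commute norm_triangle_sub)
      moreover have "cmod (deriv k z) \<le> c + cmod (deriv k z - deriv k x)"
        unfolding c_def by (rule norm_triangle_sub)
      ultimately show "2/3 * c \<le> cmod (deriv k z)" "cmod (deriv k z) \<le> 2 * (2/3 * c)"
        using near[OF z] by simp_all
    next
      fix y z assume yz: "y \<in> S" "z \<in> S"
      have e: "(k y - deriv k x * y) - (k z - deriv k x * z) = (k y - k z) - deriv k x * (y - z)"
        by (simp add: algebra_simps)
      have m: "cmod (deriv k x * (y - z)) = c * cmod (y - z)" by (simp add: norm_mult c_def)
      have 1: "c * cmod (y - z) - cmod (k y - k z) \<le> c / 3 * cmod (y - z)"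
        using b[OF yz] norm_triangle_ineq2[of "deriv k x * (y - z)" "k y - k z"] unfolding e m
        by (simp add: norm_minus_commute)
      have 2: "cmod (k y - k z) - c * cmod (y - z) \<le> c / 3 * cmod (y - z)"
        using b[OF yz] norm_triangle_ineq2[of "k y - k z" "deriv k x * (y - z)"] unfolding e m
        by simp
      show "2/3 * c * dist y z \<le> dist (k y) (k z)" "dist (k y) (k z) \<le> 2 * (2/3 * c) * dist y z"
        using 1 2 by (auto simp: dist_norm)
    qed (use c in auto)
    then show ?thesis
      using SE r1 r2 by (intro bexI[of _ S]) (auto simp: \<F>_def S_def)
  qed
  have "\<And>S. S \<in> \<F> \<Longrightarrow> open S" by (simp add: \<F>_def)
  then obtain \<F>' where F': "\<F>' \<subseteq> \<F>" "countable \<F>'" "\<Union>\<F>' = \<Union>\<F>"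
    by (rule Lindelof)
  have "{} \<in> \<F>" by (auto simp: \<F>_def good_def intro: exI[of _ 1])
  define B where "B = from_nat_into (insert {} \<F>')"
  have rB: "range B = insert {} \<F>'"
    unfolding B_def using F' by (intro range_from_nat_into) auto
  have BF: "B i \<in> \<F>" for i
    using rangeI[of B i] F'(1) \<open>{} \<in> \<F>\<close> unfolding rB by auto
  then have "\<forall>i. \<exists>L. good (B i) L" by (auto simp: \<F>_def)
  then obtain L where L: "\<And>i. good (B i) (L i)" by metis
  have sub: "disjointed B i \<subseteq> B i" for i by (rule disjointed_subset)
  show thesis
  proof (rule that[of "disjointed B" L], unfold bilipschitz_partition_def, intro conjI allI ballI)
    show "disjoint_family (disjointed B)" by (rule disjoint_family_disjointed)
    have "(\<Union>i. B i) = E"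
    proof -
      have "\<Union>\<F> = E" using cover by (auto simp: \<F>_def)
      then show ?thesis using rB F' by simp
    qed
    then show "(\<Union>i. disjointed B i) = E" by (simp add: UN_disjointed_eq)
    have "range (disjointed B) \<subseteq> sets borel"
      by (rule sets.range_disjointed_sets) (use BF in \<open>auto simp: \<F>_def\<close>)
    then show "disjointed B i \<in> sets borel" for i by auto
    show "bounded (disjointed B i)" for i
      using BF[of i] sub[of i] bounded_subset by (auto simp: \<F>_def)
    show "0 < L i" for i using L by (simp add: good_def)
    fix i
    show "L i \<le> cmod (deriv k z)" "cmod (deriv k z) \<le> 2 * L i" if "z \<in> disjointed B i" for z
      using L[of i] sub[of i] that by (auto simp: good_def)
    show "L i * dist y z \<le> dist (k y) (k z)" "dist (k y) (k z) \<le> 2 * L i * dist y z"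
      if "y \<in> disjointed B i" "z \<in> disjointed B i" for y z
      using L[of i] sub[of i] that by (auto simp: good_def)
  qed
qed

section \<open>One-sided change of variables for length and area\<close>

lemma borel_measurable_times_indicator:
  fixes F :: "complex \<Rightarrow> complex"
  assumes "continuous_on E F" "open E"
  shows "(\<lambda>z. ennreal (cmod (F z)) * indicator E z) \<in> borel_measurable borel"
proof -
  have "(\<lambda>z. indicator E z *\<^sub>R cmod (F z)) \<in> borel_measurable borel"
    using assms by (intro borel_measurable_continuous_on_indicator continuous_on_norm) auto
  then have "(\<lambda>z. ennreal (indicator E z *\<^sub>R cmod (F z))) \<in> borel_measurable borel" by measurable
  also have "(\<lambda>z. ennreal (indicator E z *\<^sub>R cmod (F z))) = (\<lambda>z. ennreal (cmod (F z)) * indicator E z)"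
    by (auto split: split_indicator)
  finally show ?thesis .
qed

lemma borel_measurable_deriv_times_indicator:
  assumes "k holomorphic_on E" "open E"
  shows "(\<lambda>z. ennreal (cmod (deriv k z)) * indicator E z) \<in> borel_measurable borel"
  using holomorphic_on_imp_continuous_on[OF holomorphic_deriv[OF assms]] assms(2)
  by (rule borel_measurable_times_indicator)

lemma nn_integral_mono_borel:
  fixes M N :: "'a::topological_space measure" and \<phi> :: "'a \<Rightarrow> ennreal"
  assumes "sets M = sets borel" "sets N = sets borel"
    and "\<And>J. J \<in> sets borel \<Longrightarrow> emeasure M J \<le> emeasure N J"
  shows "(\<integral>\<^sup>+ t. \<phi> t \<partial>M) \<le> (\<integral>\<^sup>+ t. \<phi> t \<partial>N)"
proof (rule nn_integral_mono_measure)
  show "M \<le> N" using assms by (subst le_measure) auto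
qed (use assms in auto)

text \<open>The distance of \<open>k z\<close> to \<open>p\<close> is locally Lipschitz with constant about \<open>\<bar>deriv k z\<bar>\<close>.\<close>
lemma length_lower_bound:
  assumes k: "k holomorphic_on E" "open E" "\<forall>z\<in>E. deriv k z \<noteq> 0"
    and \<Gamma>: "\<Gamma> \<in> sets borel" "\<Gamma> \<subseteq> E"
    and J: "J \<in> sets borel" "J \<subseteq> (\<lambda>z. dist (k z) p) ` \<Gamma>"
    and \<phi>: "\<phi> \<in> borel_measurable borel"
  shows "(\<integral>\<^sup>+ t\<in>J. \<phi> t \<partial>lborel) \<le>
    4 * (\<integral>\<^sup>+ z\<in>\<Gamma>. \<phi> (dist (k z) p) * ennreal (cmod (deriv k z)) \<partial>hausdorff1)"
proof -
  \<comment> \<open>The value 0 off \<open>E\<close> makes this a Borel function on the whole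
    plane.\<close>
  define u where "u z = (if z \<in> E then dist (k z) p else 0)" for z
  \<comment> \<open>The factor 4 is 2 from \<open>lipschitz_image_hausdorff1\<close> times 2 from
    the Lipschitz constant \<open>2 * L i\<close>, where \<open>L i\<close> is at most the modulus
    of the derivative.\<close>
  define w where "w z = 4 * (ennreal (cmod (deriv k z)) * indicator E z) * indicator \<Gamma> z" for z
  have kc: "continuous_on E k" using k(1) by (rule holomorphic_on_imp_continuous_on)
  have dm [measurable]: "(\<lambda>z. ennreal (cmod (deriv k z)) * indicator E z) \<in> borel_measurable borel"
    using borel_measurable_deriv_times_indicator[OF k(1,2)] .
  have [measurable]: "E \<in> sets borel" using k(2) by simp
  note \<Gamma>(1)[measurable] J(1)[measurable] \<phi>[measurable]
  have w [measurable]: "w \<in> borel_measurable borel" unfolding w_def by measurable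
  have "(\<lambda>z. indicator E z *\<^sub>R dist (k z) p) \<in> borel_measurable borel"
    using kc by (intro borel_measurable_continuous_on_indicator continuous_on_dist) auto
  also have "(\<lambda>z. indicator E z *\<^sub>R dist (k z) p) = u"
    by (auto simp: u_def split: split_indicator)
  finally have u [measurable]: "u \<in> borel_measurable borel" .
  \<comment> \<open>As an inequality between measures, the claim has to be checked on Borel sets of
    levels only: \<open>M\<close> is length on \<open>J\<close>, and \<open>N\<close> is the image
    under \<open>u\<close> of the weighted length on \<Gamma>.\<close>
  define M where "M = density lborel (indicator J :: real \<Rightarrow> ennreal)"
  define N where "N = distr (density hausdorff1 w) borel u"
  have "(\<integral>\<^sup>+ t. \<phi> t \<partial>M) \<le> (\<integral>\<^sup>+ t. \<phi> t \<partial>N)"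
  proof (rule nn_integral_mono_borel)
    fix I :: "real set" assume I [measurable]: "I \<in> sets borel"
    obtain A L where "bilipschitz_partition k E A L"
      by (rule holomorphic_bilipschitz_partition[OF k])
    note A = bilipschitz_partitionD[OF this]
    note A(3)[measurable]
    define B where "B i = A i \<inter> \<Gamma> \<inter> u -` (I \<inter> J)" for i
    have B [measurable]: "B i \<in> sets borel" for i
      unfolding B_def using measurable_sets[OF u, of "I \<inter> J"] by auto
    have piece: "\<exists>S\<in>sets borel. u ` B i \<subseteq> S \<and> emeasure lborel S \<le> emeasure (density hausdorff1 w) (B i)" for i
    proof -
      have "\<bar>u x - u y\<bar> \<le> 2 * L i * dist x y" if "x \<in> B i" "y \<in> B i" for x y
      proof -
        have xy: "x \<in> A i" "y \<in> A i" "x \<in> E" "y \<in> E" using that A(2) by (auto simp: B_def)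
        then have "\<bar>u x - u y\<bar> \<le> dist (k x) (k y)"
          unfolding u_def using abs_dist_diff_le[of "k x" p "k y"] by (simp add: dist_commute)
        with A(7)[OF xy(1,2)] show ?thesis by linarith
      qed
      then obtain S where S: "S \<in> sets borel" "u ` B i \<subseteq> S"
        "emeasure lborel S \<le> ennreal (2 * (2 * L i)) * hausdorff1_outer (B i)"
        using lipschitz_image_hausdorff1[of "2 * L i" "B i" u] A(5)[of i] by auto
      have "ennreal (2 * (2 * L i)) * hausdorff1_outer (B i) = ennreal (4 * L i) * emeasure hausdorff1 (B i)"
        using B[of i] by (simp add: emeasure_hausdorff1_borel)
      also have "\<dots> = (\<integral>\<^sup>+ z. ennreal (4 * L i) * indicator (B i) z \<partial>hausdorff1)"
        using B[of i] by (simp add: nn_integral_cmult_indicator borel_sets_hausdorff1)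
      also have "\<dots> \<le> (\<integral>\<^sup>+ z. w z * indicator (B i) z \<partial>hausdorff1)"
      proof (rule nn_integral_mono)
        fix z show "ennreal (4 * L i) * indicator (B i) z \<le> w z * indicator (B i) z"
        proof (cases "z \<in> B i")
          case True
          then have z: "z \<in> A i" "z \<in> E" "z \<in> \<Gamma>" using A(2) by (auto simp: B_def)
          then have "ennreal (4 * L i) \<le> ennreal (4 * cmod (deriv k z))" using A(6) by (intro ennreal_leI) auto
          with z True show ?thesis by (simp add: w_def ennreal_mult)
        qed simp
      qed
      also have "\<dots> = emeasure (density hausdorff1 w) (B i)"
        using w B[of i] by (simp add: emeasure_density borel_sets_hausdorff1)
      finally show ?thesis using S by (intro bexI[of _ S]) auto
    qed
    then obtain S where S: "\<And>i. S i \<in> sets borel" "\<And>i. u ` B i \<subseteq> S i"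
      "\<And>i. emeasure lborel (S i) \<le> emeasure (density hausdorff1 w) (B i)"
      by metis
    have "I \<inter> J \<subseteq> (\<Union>i. S i)"
    proof
      fix t assume t: "t \<in> I \<inter> J"
      then obtain z where z: "z \<in> \<Gamma>" "t = dist (k z) p" using J(2) by blast
      then have "z \<in> E" using \<Gamma> by blast
      then obtain i where "z \<in> A i" using A(2) by blast
      with z t \<open>z \<in> E\<close> have "z \<in> B i" "t = u z" by (auto simp: B_def u_def)
      then show "t \<in> (\<Union>i. S i)" using S(2)[of i] by blast
    qed
    then have "emeasure lborel (I \<inter> J) \<le> emeasure lborel (\<Union>i. S i)"
      by (rule emeasure_mono) (use S in auto)
    also have "\<dots> \<le> (\<Sum>i. emeasure lborel (S i))"
      by (rule emeasure_subadditive_countably) (use S in auto)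
    also have "\<dots> \<le> (\<Sum>i. emeasure (density hausdorff1 w) (B i))"
      by (intro suminf_le S) auto
    also have "\<dots> = emeasure (density hausdorff1 w) (\<Union>i. B i)"
      by (rule suminf_emeasure)
        (use A(1) in \<open>auto simp: borel_sets_hausdorff1 B_def disjoint_family_on_def\<close>)
    also have "\<dots> \<le> emeasure (density hausdorff1 w) (u -` I \<inter> space hausdorff1)"
    proof (rule emeasure_mono)
      show "u -` I \<inter> space hausdorff1 \<in> sets (density hausdorff1 w)"
        using measurable_sets[OF u I] by (simp add: borel_sets_hausdorff1)
    qed (auto simp: B_def)
    also have "\<dots> = emeasure N I"
      unfolding N_def by (subst emeasure_distr) auto
    finally show "emeasure M I \<le> emeasure N I"
      by (simp add: M_def emeasure_density Int_commute flip: indicator_inter_arith)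
  qed (auto simp: M_def N_def)
  also have "(\<integral>\<^sup>+ t. \<phi> t \<partial>N) = (\<integral>\<^sup>+ z. w z * \<phi> (u z) \<partial>hausdorff1)"
    unfolding N_def by (subst nn_integral_distr) (auto simp: nn_integral_density)
  also have "\<dots> = (\<integral>\<^sup>+ z. 4 * (\<phi> (dist (k z) p) * ennreal (cmod (deriv k z)) * indicator \<Gamma> z) \<partial>hausdorff1)"
    by (rule nn_integral_cong) (use \<Gamma> in \<open>auto simp: w_def u_def mult_ac split: split_indicator\<close>)
  also have "\<dots> = 4 * (\<integral>\<^sup>+ z\<in>\<Gamma>. \<phi> (dist (k z) p) * ennreal (cmod (deriv k z)) \<partial>hausdorff1)"
  proof (rule nn_integral_cmult)
    have "(\<lambda>z. \<phi> (u z) * (ennreal (cmod (deriv k z)) * indicator E z) * indicator \<Gamma> z) \<in> borel_measurable borel"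
      by measurable
    also have "(\<lambda>z. \<phi> (u z) * (ennreal (cmod (deriv k z)) * indicator E z) * indicator \<Gamma> z) =
      (\<lambda>z. \<phi> (dist (k z) p) * ennreal (cmod (deriv k z)) * indicator \<Gamma> z)"
      using \<Gamma> by (auto simp: u_def fun_eq_iff split: split_indicator)
    finally show "(\<lambda>z. \<phi> (dist (k z) p) * ennreal (cmod (deriv k z)) * indicator \<Gamma> z) \<in> borel_measurable hausdorff1"
      by (rule borel_measurable_hausdorff1)
  qed
  also have "(\<integral>\<^sup>+ t. \<phi> t \<partial>M) = (\<integral>\<^sup>+ t\<in>J. \<phi> t \<partial>lborel)"
    by (simp add: M_def nn_integral_density mult.commute)
  finally show ?thesis .
qed

text \<open>On a piece of the partition the squared derivative is at most
  \<open>4 * (L i)\<^sup>2\<close>. The inverse map has Lipschitz constant \<open>1 / L i\<close>,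
  so the piece has at most \<open>8 / (L i)\<^sup>2\<close> times the area of its image. This gives
  32 = 4 * 8, and injectivity keeps the images of the pieces disjoint.\<close>

lemma area_upper_bound:
  assumes k: "k holomorphic_on E" "open E" "inj_on k E" and \<phi>: "\<phi> \<in> borel_measurable borel"
  shows "(\<integral>\<^sup>+ z\<in>E. \<phi> (k z) * (ennreal (cmod (deriv k z)))\<^sup>2 \<partial>lborel) \<le> 32 * (\<integral>\<^sup>+ z\<in>k ` E. \<phi> z \<partial>lborel)"
proof -
  have nz: "\<forall>z\<in>E. deriv k z \<noteq> 0"
    using holomorphic_injective_imp_regular[OF k] by blast
  obtain g where g: "g holomorphic_on (k ` E)" "\<And>z. z \<in> E \<Longrightarrow> g (k z) = z"
    using holomorphic_has_inverse[OF k] by metis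
  have oW: "open (k ` E)" using open_mapping_thm3[OF k] .
  have kc: "continuous_on E k" using k(1) by (rule holomorphic_on_imp_continuous_on)
  have gc: "continuous_on (k ` E) g" using g(1) by (rule holomorphic_on_imp_continuous_on)
  define k' where "k' z = indicator E z *\<^sub>R k z" for z
  define w where "w z = (ennreal (cmod (deriv k z)) * indicator E z)\<^sup>2" for z
  have dm [measurable]: "(\<lambda>z. ennreal (cmod (deriv k z)) * indicator E z) \<in> borel_measurable borel"
    using borel_measurable_deriv_times_indicator[OF k(1,2)] .
  have [measurable]: "E \<in> sets borel" "k ` E \<in> sets borel" using k(2) oW by auto
  note \<phi>[measurable]
  have w [measurable]: "w \<in> borel_measurable borel" unfolding w_def by measurable
  have k' [measurable]: "k' \<in> borel_measurable borel"
    unfolding k'_def using kc by (intro borel_measurable_continuous_on_indicator) auto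
  define M where "M = distr (density lborel w) borel k'"
  define N where "N = density lborel (\<lambda>z. 32 * indicator (k ` E) z :: ennreal)"
  have "(\<integral>\<^sup>+ t. \<phi> t \<partial>M) \<le> (\<integral>\<^sup>+ t. \<phi> t \<partial>N)"
  proof (rule nn_integral_mono_borel)
    fix J :: "complex set" assume J [measurable]: "J \<in> sets borel"
    obtain A L where "bilipschitz_partition k E A L"
      by (rule holomorphic_bilipschitz_partition[OF k(1,2) nz])
    note A = bilipschitz_partitionD[OF this]
    note A(3)[measurable]
    define B where "B i = {z \<in> E. k z \<in> J} \<inter> A i" for i
    have B [measurable]: "B i \<in> sets borel" for i
      unfolding B_def using borel_preimage_continuous_on[OF kc _ J] by auto
    have BE: "B i \<subseteq> E" for i by (auto simp: B_def)
    \<comment> \<open>Images of Borel sets are Borel here because they are preimages under the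
      continuous inverse.\<close>
    have img: "k ` B i = {y \<in> k ` E. g y \<in> B i}" for i
      using BE[of i] g(2) by (auto simp: image_iff)
    have kB [measurable]: "k ` B i \<in> sets borel" for i
      unfolding img using gc by (intro borel_preimage_continuous_on) auto
    have gkB: "g ` k ` B i = B i" for i
      using BE[of i] g(2) by (force simp: image_image)
    have piece: "emeasure (density lborel w) (B i) \<le> 32 * emeasure lborel (k ` B i)" for i
    proof -
      have L: "0 < L i" by (rule A(5))
      have "emeasure (density lborel w) (B i) = (\<integral>\<^sup>+ z. w z * indicator (B i) z \<partial>lborel)"
        by (simp add: emeasure_density)
      also have "\<dots> \<le> (\<integral>\<^sup>+ z. ennreal (4 * (L i)\<^sup>2) * indicator (B i) z \<partial>lborel)"
      proof (rule nn_integral_mono)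
        fix z show "w z * indicator (B i) z \<le> ennreal (4 * (L i)\<^sup>2) * indicator (B i) z"
        proof (cases "z \<in> B i")
          case True
          then have "z \<in> A i" "z \<in> E" by (auto simp: B_def)
          then have "(cmod (deriv k z))\<^sup>2 \<le> (2 * L i)\<^sup>2" using A(6) by (intro power_mono) auto
          then show ?thesis
            using True \<open>z \<in> E\<close> by (simp add: w_def ennreal_power power_mult_distrib ennreal_leI)
        qed simp
      qed
      also have "\<dots> = ennreal (4 * (L i)\<^sup>2) * emeasure lborel (B i)"
        by (simp add: nn_integral_cmult_indicator)
      also have "\<dots> = ennreal (4 * (L i)\<^sup>2) * emeasure lborel (g ` k ` B i)" by (simp only: gkB)
      also have "\<dots> \<le> ennreal (4 * (L i)\<^sup>2) * (ennreal (8 * (1 / L i)\<^sup>2) * emeasure lborel (k ` B i))"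
      proof (intro mult_left_mono lipschitz_image_lborel)
        show "k ` B i \<in> sets borel" "g ` k ` B i \<in> sets borel" unfolding gkB by simp_all
        show "0 < 1 / L i" using L by simp
        fix x y assume "x \<in> k ` B i" "y \<in> k ` B i"
        then obtain a b where ab: "a \<in> B i" "b \<in> B i" "x = k a" "y = k b" by blast
        then have "L i * dist a b \<le> dist (k a) (k b)" "a \<in> E" "b \<in> E" using A(7) by (auto simp: B_def)
        then show "dist (g x) (g y) \<le> 1 / L i * dist x y"
          using ab L g(2) by (simp add: field_simps)
      next
        obtain R where R: "\<And>x. x \<in> A i \<Longrightarrow> cmod x \<le> R" using A(4)[of i] by (auto simp: bounded_iff)
        show "bounded (k ` B i)"
        proof (cases "B i = {}")
          case False
          then obtain b where b: "b \<in> A i" by (auto simp: B_def)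
          have "dist (k b) (k z) \<le> 2 * L i * (2 * R)" if "z \<in> B i" for z
          proof -
            have z: "z \<in> A i" using that by (simp add: B_def)
            have "dist b z \<le> cmod b + cmod z" by (simp add: dist_norm norm_triangle_ineq4)
            also have "\<dots> \<le> 2 * R" using R[OF b] R[OF z] by simp
            finally have "2 * L i * dist b z \<le> 2 * L i * (2 * R)" using L by simp
            with A(7)[OF b z] show ?thesis by linarith
          qed
          then show ?thesis unfolding bounded_def by blast
        qed simp
      qed simp
      also have "\<dots> = 32 * emeasure lborel (k ` B i)"
      proof -
        have "ennreal (4 * (L i)\<^sup>2) * ennreal (8 * (1 / L i)\<^sup>2) = 32"
          using L by (simp add: power_divide flip: ennreal_mult ennreal_numeral)
        then show ?thesis by (simp add: mult.assoc[symmetric])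
      qed
      finally show ?thesis .
    qed
    have "emeasure M J = emeasure (density lborel w) (k' -` J)"
      unfolding M_def by (subst emeasure_distr) auto
    also have "\<dots> = emeasure (density lborel w) (\<Union>i. B i)"
    proof -
      have "k' -` J \<in> sets borel" using measurable_sets[OF k' J] by simp
      moreover have "w z * indicator (k' -` J) z = w z * indicator (\<Union>i. B i) z" for z
      proof (cases "z \<in> E")
        case True
        then obtain i where "z \<in> A i" using A(2) by blast
        with True show ?thesis by (auto simp: k'_def B_def split: split_indicator)
      qed (simp add: w_def)
      ultimately show ?thesis by (subst (1 2) emeasure_density) auto
    qed
    also have "\<dots> = (\<Sum>i. emeasure (density lborel w) (B i))"
    proof (rule suminf_emeasure[symmetric])
      show "disjoint_family B" using A(1) by (auto simp: B_def disjoint_family_on_def)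
    qed auto
    also have "\<dots> \<le> (\<Sum>i. 32 * emeasure lborel (k ` B i))" by (intro suminf_le piece) auto
    also have "\<dots> = 32 * emeasure lborel (\<Union>i. k ` B i)"
    proof -
      have "disjoint_family (\<lambda>i. k ` B i)"
        unfolding disjoint_family_on_def
      proof safe
        fix i j x y assume ij: "i \<noteq> j" "x \<in> B i" "y \<in> B j" "k x = k y"
        then have "x = y" using k(3) BE[of i] BE[of j] by (auto dest: inj_onD)
        with ij A(1) show "k x \<in> {}" by (auto simp: B_def disjoint_family_on_def)
      qed
      then have "(\<Sum>i. emeasure lborel (k ` B i)) = emeasure lborel (\<Union>i. k ` B i)"
        by (intro suminf_emeasure) auto
      then show ?thesis by simp
    qed
    also have "\<dots> \<le> 32 * emeasure lborel (k ` E \<inter> J)"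
      by (intro mult_left_mono emeasure_mono) (auto simp: B_def)
    also have "\<dots> = emeasure N J"
    proof -
      have "emeasure N J = (\<integral>\<^sup>+ z. 32 * indicator (k ` E \<inter> J) z \<partial>lborel)"
        unfolding N_def by (subst emeasure_density) (auto intro!: nn_integral_cong split: split_indicator)
      then show ?thesis by (simp add: nn_integral_cmult_indicator)
    qed
    finally show "emeasure M J \<le> emeasure N J" .
  qed (auto simp: M_def N_def)
  also have "(\<integral>\<^sup>+ t. \<phi> t \<partial>M) = (\<integral>\<^sup>+ z. w z * \<phi> (k' z) \<partial>lborel)"
    unfolding M_def by (subst nn_integral_distr) (auto simp: nn_integral_density)
  also have "\<dots> = (\<integral>\<^sup>+ z\<in>E. \<phi> (k z) * (ennreal (cmod (deriv k z)))\<^sup>2 \<partial>lborel)"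
    by (rule nn_integral_cong) (auto simp: w_def k'_def mult_ac split: split_indicator)
  also have "(\<integral>\<^sup>+ t. \<phi> t \<partial>N) = (\<integral>\<^sup>+ z. 32 * (\<phi> z * indicator (k ` E) z) \<partial>lborel)"
    unfolding N_def by (subst nn_integral_density) (auto intro!: nn_integral_cong simp: mult_ac)
  also have "\<dots> = 32 * (\<integral>\<^sup>+ z\<in>k ` E. \<phi> z \<partial>lborel)"
    by (rule nn_integral_cmult) measurable
  finally show ?thesis .
qed

section \<open>The length-area principle\<close>

text \<open>A step function of the size of \<open>1 / (t * ln (1 / t))\<close>: not integrable at \<open>0\<close> on the line, but
  square integrable as a radial function in the plane.\<close>
definition log_weight :: "real \<Rightarrow> ennreal" where
  "log_weight t = (\<Sum>n. ennreal (2 ^ n / real (n + 1)) * indicator {1 / 2 ^ (n + 1)<..<1 / 2 ^ n} t)"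

lemma log_weight_measurable [measurable]: "log_weight \<in> borel_measurable borel"
  unfolding log_weight_def[abs_def] by measurable

text \<open>The open dyadic intervals are disjoint, so at most one term of the series is nonzero at
  \<open>t\<close>.\<close>

lemma log_weight_power2:
  "(log_weight t)\<^sup>2 = (\<Sum>n. ennreal ((2 ^ n / real (n + 1))\<^sup>2) * indicator {1 / 2 ^ (n + 1)<..<1 / 2 ^ n} t)"
proof (cases "\<exists>n. t \<in> {1 / 2 ^ (n + 1)<..<1 / 2 ^ n}")
  case True
  let ?I = "\<lambda>n. {1 / 2 ^ (n + 1)<..<1 / 2 ^ n} :: real set"
  from True obtain n where n: "t \<in> ?I n" by blast
  have other: "t \<notin> ?I m" if "m \<noteq> n" for m
  proof (cases "m < n")
    case True
    then have "(1::real) / 2 ^ n \<le> 1 / 2 ^ (m + 1)"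
      by (intro divide_left_mono power_increasing) auto
    with n show ?thesis by auto
  next
    case False
    with that have "(1::real) / 2 ^ m \<le> 1 / 2 ^ (n + 1)"
      by (intro divide_left_mono power_increasing) auto
    with n show ?thesis by auto
  qed
  have eq: "(\<Sum>m. ennreal (a m) * indicator (?I m) t) = ennreal (a n)" for a
  proof -
    have "(\<Sum>m. ennreal (a m) * indicator (?I m) t) = (\<Sum>m\<in>{n}. ennreal (a m) * indicator (?I m) t)"
      by (rule suminf_finite) (use other in \<open>auto simp: indicator_def\<close>)
    also have "\<dots> = ennreal (a n) * indicator (?I n) t" by (simp del: sum_mult_indicator)
    also have "\<dots> = ennreal (a n)" using n by (simp only: indicator_simps mult_1_right)
    finally show ?thesis .
  qed
  show ?thesis unfolding log_weight_def eq by (simp add: ennreal_power)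
next
  case False
  then have "indicator {1 / 2 ^ (n + 1)<..<1 / 2 ^ n} t = (0::ennreal)" for n
    by (auto simp: indicator_def)
  then show ?thesis unfolding log_weight_def by (simp only: mult_zero_right suminf_zero) simp
qed

lemma emeasure_cball_le:
  fixes p :: complex
  assumes "0 \<le> r"
  shows "emeasure lborel (cball p r) \<le> ennreal (4 * r\<^sup>2)"
proof -
  have "cball p r \<subseteq> cbox (p - Complex r r) (p + Complex r r)"
  proof
    fix z assume "z \<in> cball p r"
    then have "cmod (z - p) \<le> r" by (simp add: dist_norm norm_minus_commute)
    then show "z \<in> cbox (p - Complex r r) (p + Complex r r)"
      using abs_Re_le_cmod[of "z - p"] abs_Im_le_cmod[of "z - p"]
      by (auto simp: in_cbox_complex_iff abs_le_iff)
  qed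
  then have "emeasure lborel (cball p r) \<le> emeasure lborel (cbox (p - Complex r r) (p + Complex r r))"
    by (rule emeasure_mono) simp
  also have "\<dots> = ennreal (4 * r\<^sup>2)"
    using assms by (subst emeasure_lborel_cbox) (auto simp: Basis_complex_def power2_eq_square)
  finally show ?thesis .
qed

text \<open>The disc of radius \<open>1 / 2 ^ n\<close> has area at most \<open>4 / 4 ^ n\<close>,
  which cancels the factor \<open>4 ^ n\<close> of the squared weight. The sum of
  \<open>4 / (n + 1)\<^sup>2\<close> remains.\<close>

lemma log_weight_square_integrable:
  fixes p :: complex
  shows "(\<integral>\<^sup>+ z. (log_weight (dist z p))\<^sup>2 \<partial>lborel) < \<infinity>"
proof -
  let ?I = "\<lambda>n. {1 / 2 ^ (n + 1)<..<1 / 2 ^ n} :: real set"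
  have "(\<integral>\<^sup>+ z. (log_weight (dist z p))\<^sup>2 \<partial>lborel) =
      (\<Sum>n. \<integral>\<^sup>+ z. ennreal ((2 ^ n / real (n + 1))\<^sup>2) * indicator (?I n) (dist z p) \<partial>lborel)"
    unfolding log_weight_power2 by (rule nn_integral_suminf) measurable
  also have "\<dots> \<le> (\<Sum>n. ennreal (4 * inverse (real (n + 1) ^ 2)))"
  proof (intro suminf_le)
    fix n
    have "(\<integral>\<^sup>+ z. ennreal ((2 ^ n / real (n + 1))\<^sup>2) * indicator (?I n) (dist z p) \<partial>lborel) \<le>
        (\<integral>\<^sup>+ z. ennreal ((2 ^ n / real (n + 1))\<^sup>2) * indicator (cball p (1 / 2 ^ n)) z \<partial>lborel)"
      by (intro nn_integral_mono mult_left_mono) (auto simp: dist_commute split: split_indicator)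
    also have "\<dots> = ennreal ((2 ^ n / real (n + 1))\<^sup>2) * emeasure lborel (cball p (1 / 2 ^ n))"
      by (rule nn_integral_cmult_indicator) simp
    also have "\<dots> \<le> ennreal ((2 ^ n / real (n + 1))\<^sup>2) * ennreal (4 * (1 / 2 ^ n)\<^sup>2)"
      by (intro mult_left_mono emeasure_cball_le) auto
    also have "\<dots> = ennreal (4 * inverse (real (n + 1) ^ 2))"
    proof -
      have "(2 ^ n / real (n + 1))\<^sup>2 * (4 * (1 / 2 ^ n)\<^sup>2) = 4 * inverse (real (n + 1) ^ 2)"
        by (simp add: power_divide power_mult_distrib divide_simps)
      moreover have "ennreal ((2 ^ n / real (n + 1))\<^sup>2) * ennreal (4 * (1 / 2 ^ n)\<^sup>2) =
          ennreal ((2 ^ n / real (n + 1))\<^sup>2 * (4 * (1 / 2 ^ n)\<^sup>2))"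
        by (rule ennreal_mult[symmetric]) auto
      ultimately show ?thesis by (simp only:)
    qed
    finally show "(\<integral>\<^sup>+ z. ennreal ((2 ^ n / real (n + 1))\<^sup>2) * indicator (?I n) (dist z p) \<partial>lborel) \<le>
        ennreal (4 * inverse (real (n + 1) ^ 2))" .
  qed auto
  also have "\<dots> < \<infinity>"
  proof -
    have "summable (\<lambda>n. inverse (real n ^ 2))"
      using inverse_power_summable[of 2, where 'a = real] by simp
    then have "summable (\<lambda>n. inverse (real (Suc n) ^ 2))"
      by (subst summable_Suc_iff)
    then have "summable (\<lambda>n. 4 * inverse (real (n + 1) ^ 2))"
      by (intro summable_mult) simp
    then show ?thesis
      using ennreal_suminf_neq_top less_top by fastforce
  qed
  finally show ?thesis .
qed

lemma log_weight_square_integrable_on: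
  fixes p :: complex
  shows "(\<integral>\<^sup>+ z\<in>S. (log_weight (dist z p))\<^sup>2 \<partial>lborel) < \<infinity>"
  by (rule le_less_trans[OF nn_integral_mono log_weight_square_integrable[of p]])
    (auto split: split_indicator)

lemma log_weight_not_integrable:
  assumes "0 < \<eta>"
  shows "(\<integral>\<^sup>+ t\<in>{0<..<\<eta>}. log_weight t \<partial>lborel) = \<infinity>"
proof -
  let ?I = "\<lambda>n. {1 / 2 ^ (n + 1)<..<1 / 2 ^ n} :: real set"
  obtain N where "(1 / 2 :: real) ^ N < \<eta>"
    using real_arch_pow_inv[OF assms, of "1 / 2"] by auto
  then have N: "(1::real) / 2 ^ N < \<eta>" by (simp add: power_one_over)
  \<comment> \<open>For \<open>N\<close> \<le> \<open>n\<close> the dyadic interval lies inside the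
    domain of integration. Its length \<open>1 / 2 ^ (n + 1)\<close> times the weight
    \<open>2 ^ n / (n + 1)\<close> is this term of a harmonic series.\<close>
  define a where "a n = (if N \<le> n then 1 / (2 * real (n + 1)) else 0)" for n
  have "\<infinity> = (\<Sum>n. ennreal (a n))"
  proof (rule ccontr)
    assume "\<infinity> \<noteq> (\<Sum>n. ennreal (a n))"
    then have "summable a"
      by (intro summable_suminf_not_top) (auto simp: a_def)
    then have "summable (\<lambda>n. 2 * a (n + N))"
      by (intro summable_mult) (simp add: summable_iff_shift)
    moreover have "(\<lambda>n. 2 * a (n + N)) = (\<lambda>n. inverse (real (n + (N + 1))))"
      by (auto simp: a_def field_simps)
    ultimately have "summable (\<lambda>n. inverse (real n))"
      using summable_iff_shift[of "\<lambda>n. inverse (real n)" "N + 1"] by simp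
    then show False using not_summable_harmonic[where 'a = real] by simp
  qed
  also have "\<dots> \<le> (\<Sum>n. \<integral>\<^sup>+ t. ennreal (2 ^ n / real (n + 1)) * indicator (?I n \<inter> {0<..<\<eta>}) t \<partial>lborel)"
  proof (intro suminf_le)
    fix n
    show "ennreal (a n) \<le> (\<integral>\<^sup>+ t. ennreal (2 ^ n / real (n + 1)) * indicator (?I n \<inter> {0<..<\<eta>}) t \<partial>lborel)"
    proof (cases "N \<le> n")
      case True
      have "(1::real) / 2 ^ n \<le> 1 / 2 ^ N"
        using True by (intro divide_left_mono power_increasing) auto
      then have "1 / 2 ^ n < \<eta>" using N by simp
      moreover have "(0::real) < 1 / 2 ^ (n + 1)" by simp
      ultimately have sub: "?I n \<inter> {0<..<\<eta>} = ?I n"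
        unfolding greaterThanLessThan_def by (force intro: less_trans)
      have "ennreal (a n) = ennreal (2 ^ n / real (n + 1)) * ennreal (1 / 2 ^ n - 1 / 2 ^ (n + 1))"
      proof -
        have "(1::real) / 2 ^ n - 1 / 2 ^ (n + 1) = 1 / (2 * 2 ^ n)" by (simp add: divide_simps)
        then have "2 ^ n / real (n + 1) * (1 / 2 ^ n - 1 / 2 ^ (n + 1)) = a n"
          using True by (simp add: a_def)
        moreover have "(0::real) \<le> 1 / 2 ^ n - 1 / 2 ^ (n + 1)" by (simp add: divide_simps)
        ultimately show ?thesis by (metis ennreal_mult'')
      qed
      also have "\<dots> = ennreal (2 ^ n / real (n + 1)) * emeasure lborel (?I n)"
        by (subst emeasure_lborel_Ioo) (auto simp: field_simps)
      finally show ?thesis unfolding sub by (simp add: nn_integral_cmult_indicator)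
    qed (simp add: a_def)
  qed auto
  also have "\<dots> = (\<integral>\<^sup>+ t. (\<Sum>n. ennreal (2 ^ n / real (n + 1)) * indicator (?I n \<inter> {0<..<\<eta>}) t) \<partial>lborel)"
    by (rule nn_integral_suminf[symmetric]) measurable
  also have "\<dots> = (\<integral>\<^sup>+ t\<in>{0<..<\<eta>}. log_weight t \<partial>lborel)"
    by (simp only: log_weight_def indicator_inter_arith mult.assoc[symmetric] ennreal_suminf_multc)
  finally show ?thesis by (simp add: top_unique)
qed

text \<open>Eilenberg's inequality takes the place of polar coordinates around \<zeta>. The
  Cauchy-Schwarz inequality then separates the weight \<open>a\<close> in the source from the weight
  \<open>b\<close> in the target, and \<open>area_upper_bound\<close> moves the second factor to the
  image. Below, one of the weights is \<open>log_weight\<close> and the other is 1.\<close>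

lemma length_area:
  fixes k :: "complex \<Rightarrow> complex"
  assumes k: "k holomorphic_on E" "inj_on k E" and E: "open E" "bounded E"
    and a: "a \<in> borel_measurable borel" "(\<integral>\<^sup>+ z\<in>E. (a z)\<^sup>2 \<partial>lborel) < \<infinity>"
    and b: "b \<in> borel_measurable borel" "(\<integral>\<^sup>+ z\<in>k ` E. (b z)\<^sup>2 \<partial>lborel) < \<infinity>"
  obtains \<Phi> where "\<Phi> \<in> borel_measurable borel"
    "\<And>r. (\<integral>\<^sup>+ z\<in>{z \<in> E. dist z \<zeta> = r}. a z * (b (k z) * ennreal (cmod (deriv k z))) \<partial>hausdorff1) \<le> \<Phi> r"
    "(\<integral>\<^sup>+ r. \<Phi> r \<partial>lborel) < \<infinity>"
proof -
  define dk where "dk z = ennreal (cmod (deriv k z)) * indicator E z" for z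
  define k' where "k' z = indicator E z *\<^sub>R k z" for z
  note a(1)[measurable] b(1)[measurable]
  have [measurable]: "dk \<in> borel_measurable borel"
    unfolding dk_def[abs_def] using borel_measurable_deriv_times_indicator[OF k(1) E(1)] .
  have [measurable]: "k' \<in> borel_measurable borel"
    unfolding k'_def using holomorphic_on_imp_continuous_on[OF k(1)] E
    by (intro borel_measurable_continuous_on_indicator) auto
  have Em [measurable]: "E \<in> sets borel" using E by simp
  have lip: "\<bar>dist x \<zeta> - dist y \<zeta>\<bar> \<le> dist x y" for x y
    using abs_dist_diff_le[of x \<zeta> y] by (simp add: dist_commute)
  define \<rho> where "\<rho> z = a z * (b (k' z) * dk z)" for z
  have \<rho>: "\<rho> \<in> borel_measurable borel" unfolding \<rho>_def by measurable
  obtain \<Phi> where \<Phi>: "\<Phi> \<in> borel_measurable borel"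
    "\<And>r. (\<integral>\<^sup>+ z\<in>{z \<in> E. dist z \<zeta> = r}. \<rho> z \<partial>hausdorff1) \<le> \<Phi> r"
    "(\<integral>\<^sup>+ r. \<Phi> r \<partial>lborel) \<le> 4 * (\<integral>\<^sup>+ z\<in>E. \<rho> z \<partial>lborel)"
    using eilenberg[OF \<rho> Em E(2) lip] by blast
  have "(\<integral>\<^sup>+ z\<in>E. \<rho> z \<partial>lborel) = (\<integral>\<^sup>+ z. (a z * indicator E z) * (b (k' z) * dk z) \<partial>lborel)"
    by (rule nn_integral_cong) (simp add: \<rho>_def mult_ac)
  then have "(\<integral>\<^sup>+ z\<in>E. \<rho> z \<partial>lborel)\<^sup>2 \<le>
      (\<integral>\<^sup>+ z. (a z * indicator E z)\<^sup>2 \<partial>lborel) * (\<integral>\<^sup>+ z. (b (k' z) * dk z)\<^sup>2 \<partial>lborel)"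
    using Cauchy_Schwarz_nn_integral[of "\<lambda>z. a z * indicator E z" lborel "\<lambda>z. b (k' z) * dk z"] by simp
  also have "(\<integral>\<^sup>+ z. (a z * indicator E z)\<^sup>2 \<partial>lborel) = (\<integral>\<^sup>+ z\<in>E. (a z)\<^sup>2 \<partial>lborel)"
    by (rule nn_integral_cong) (auto split: split_indicator)
  also have "(\<integral>\<^sup>+ z. (b (k' z) * dk z)\<^sup>2 \<partial>lborel) =
      (\<integral>\<^sup>+ z\<in>E. (b (k z))\<^sup>2 * (ennreal (cmod (deriv k z)))\<^sup>2 \<partial>lborel)"
    by (rule nn_integral_cong) (auto simp: dk_def k'_def power_mult_distrib split: split_indicator)
  finally have "(\<integral>\<^sup>+ z\<in>E. \<rho> z \<partial>lborel)\<^sup>2 \<le> (\<integral>\<^sup>+ z\<in>E. (a z)\<^sup>2 \<partial>lborel) *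
      (\<integral>\<^sup>+ z\<in>E. (b (k z))\<^sup>2 * (ennreal (cmod (deriv k z)))\<^sup>2 \<partial>lborel)" .
  also have "\<dots> < \<infinity>"
  proof -
    have "(\<integral>\<^sup>+ z\<in>E. (b (k z))\<^sup>2 * (ennreal (cmod (deriv k z)))\<^sup>2 \<partial>lborel) \<le> 32 * (\<integral>\<^sup>+ z\<in>k ` E. (b z)\<^sup>2 \<partial>lborel)"
      by (rule area_upper_bound[OF k(1) E(1) k(2)]) measurable
    also have "\<dots> < \<infinity>" using b(2) by (simp add: ennreal_mult_less_top)
    finally show ?thesis using a(2) by (simp add: ennreal_mult_less_top)
  qed
  finally have "(\<integral>\<^sup>+ z\<in>E. \<rho> z \<partial>lborel) < \<infinity>" by (auto simp: power2_eq_square ennreal_mult_less_top)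
  then have fin: "(\<integral>\<^sup>+ r. \<Phi> r \<partial>lborel) < \<infinity>"
    by (intro le_less_trans[OF \<Phi>(3)]) (simp add: ennreal_mult_less_top)
  show thesis
  proof (rule that[OF \<Phi>(1) _ fin])
    fix r
    have "(\<integral>\<^sup>+ z\<in>{z \<in> E. dist z \<zeta> = r}. a z * (b (k z) * ennreal (cmod (deriv k z))) \<partial>hausdorff1) =
        (\<integral>\<^sup>+ z\<in>{z \<in> E. dist z \<zeta> = r}. \<rho> z \<partial>hausdorff1)"
      by (rule nn_integral_cong) (auto simp: \<rho>_def dk_def k'_def split: split_indicator)
    with \<Phi>(2) show "(\<integral>\<^sup>+ z\<in>{z \<in> E. dist z \<zeta> = r}. a z * (b (k z) * ennreal (cmod (deriv k z))) \<partial>hausdorff1) \<le> \<Phi> r"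
      by simp
  qed
qed

section \<open>Images of circles and sets of infinite weighted length\<close>

lemma emeasure_lborel_bounded_finite:
  fixes S :: "complex set"
  assumes "bounded S"
  shows "emeasure lborel S < \<infinity>"
proof -
  obtain a where "S \<subseteq> cbox (- a) a" using bounded_subset_cbox_symmetric[OF assms] by blast
  then have "emeasure lborel S \<le> emeasure lborel (cbox (- a) a)" by (rule emeasure_mono) simp
  also have "\<dots> < \<infinity>" by (rule emeasure_lborel_cbox_finite)
  finally show ?thesis .
qed

text \<open>Wolff's argument: a positive lower bound for the lengths of the images of all circles would
  contradict the divergence of the integral of the weight.\<close>
lemma circle_with_small_image:
  fixes k :: "complex \<Rightarrow> complex"
  assumes k: "k holomorphic_on E" "inj_on k E" and E: "open E" "bounded E" "bounded (k ` E)"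
    and conn: "\<forall>t\<in>{0<..<t0}. connected {z \<in> E. dist z \<zeta> = t}"
    and pos: "0 < t0" "0 < e"
  obtains t where "0 < t" "t < t0"
    "\<And>x y. x \<in> E \<Longrightarrow> y \<in> E \<Longrightarrow> dist x \<zeta> = t \<Longrightarrow> dist y \<zeta> = t \<Longrightarrow> dist (k x) (k y) \<le> e"
proof -
  let ?S = "\<lambda>t. {z \<in> E. dist z \<zeta> = t}"
  have nz: "\<forall>z\<in>E. deriv k z \<noteq> 0"
    using holomorphic_injective_imp_regular[OF k(1) E(1) k(2)] by blast
  have kc: "continuous_on E k" using k(1) by (rule holomorphic_on_imp_continuous_on)
  have [measurable]: "E \<in> sets borel" using E by simp
  have Sm [measurable]: "?S t \<in> sets borel" for t by measurable
  define dk where "dk z = ennreal (cmod (deriv k z)) * indicator E z" for z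
  have [measurable]: "dk \<in> borel_measurable borel"
    unfolding dk_def[abs_def] using borel_measurable_deriv_times_indicator[OF k(1) E(1)] .
  \<comment> \<open>One quarter of \<open>e\<close>, since \<open>length_lower_bound\<close> loses a
    factor 4 when turning length into distance.\<close>
  have "\<exists>t. 0 < t \<and> t < t0 \<and> (\<integral>\<^sup>+ z\<in>?S t. ennreal (cmod (deriv k z)) \<partial>hausdorff1) < ennreal (e / 4)"
  proof (rule ccontr)
    assume "\<not> ?thesis"
    then have big: "ennreal (e / 4) \<le> (\<integral>\<^sup>+ z\<in>?S t. ennreal (cmod (deriv k z)) \<partial>hausdorff1)"
      if "0 < t" "t < t0" for t
      using that by (meson not_le)
    have 1: "(\<integral>\<^sup>+ z\<in>E. (log_weight (dist z \<zeta>))\<^sup>2 \<partial>lborel) < \<infinity>"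
      by (rule log_weight_square_integrable_on)
    have "k ` E \<in> sets borel" using open_mapping_thm3[OF k(1) E(1) k(2)] by simp
    then have 2: "(\<integral>\<^sup>+ z\<in>k ` E. (1::ennreal)\<^sup>2 \<partial>lborel) < \<infinity>"
      using emeasure_lborel_bounded_finite[OF E(3)] by simp
    obtain \<Phi> where \<Phi>: "\<Phi> \<in> borel_measurable borel"
      "\<And>r. (\<integral>\<^sup>+ z\<in>?S r. log_weight (dist z \<zeta>) * (1 * ennreal (cmod (deriv k z))) \<partial>hausdorff1) \<le> \<Phi> r"
      "(\<integral>\<^sup>+ r. \<Phi> r \<partial>lborel) < \<infinity>"
      using length_area[OF k E(1,2) _ 1 _ 2, of \<zeta>] by auto
    have "ennreal (e / 4) * log_weight t \<le> \<Phi> t" if t: "0 < t" "t < t0" for t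
    proof -
      have "ennreal (e / 4) * log_weight t \<le> log_weight t * (\<integral>\<^sup>+ z\<in>?S t. ennreal (cmod (deriv k z)) \<partial>hausdorff1)"
        using big[OF t] by (simp add: mult.commute mult_left_mono)
      also have "(\<integral>\<^sup>+ z\<in>?S t. ennreal (cmod (deriv k z)) \<partial>hausdorff1) = (\<integral>\<^sup>+ z\<in>?S t. dk z \<partial>hausdorff1)"
        by (rule nn_integral_cong) (auto simp: dk_def split: split_indicator)
      also have "log_weight t * \<dots> = (\<integral>\<^sup>+ z. log_weight t * (dk z * indicator (?S t) z) \<partial>hausdorff1)"
        by (rule nn_integral_cmult[symmetric]) measurable
      also have "\<dots> = (\<integral>\<^sup>+ z\<in>?S t. log_weight (dist z \<zeta>) * (1 * ennreal (cmod (deriv k z))) \<partial>hausdorff1)"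
        by (rule nn_integral_cong) (auto simp: dk_def split: split_indicator)
      also have "\<dots> \<le> \<Phi> t" by (rule \<Phi>)
      finally show ?thesis .
    qed
    then have "(\<integral>\<^sup>+ t. ennreal (e / 4) * (log_weight t * indicator {0<..<t0} t) \<partial>lborel) \<le> (\<integral>\<^sup>+ t. \<Phi> t \<partial>lborel)"
      by (intro nn_integral_mono) (auto split: split_indicator)
    also have "(\<integral>\<^sup>+ t. ennreal (e / 4) * (log_weight t * indicator {0<..<t0} t) \<partial>lborel) =
        ennreal (e / 4) * (\<integral>\<^sup>+ t\<in>{0<..<t0}. log_weight t \<partial>lborel)"
      by (rule nn_integral_cmult) measurable
    also have "\<dots> = \<infinity>"
      using log_weight_not_integrable[OF pos(1)] pos(2) by (simp add: ennreal_mult_eq_top_iff)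
    finally show False using \<Phi>(3) by simp
  qed
  then obtain t where t: "0 < t" "t < t0"
    "(\<integral>\<^sup>+ z\<in>?S t. ennreal (cmod (deriv k z)) \<partial>hausdorff1) < ennreal (e / 4)" by blast
  show thesis
  proof (rule that[OF t(1,2)])
    fix x y assume xy: "x \<in> E" "y \<in> E" "dist x \<zeta> = t" "dist y \<zeta> = t"
    \<comment> \<open>On the connected arc this function takes all values between 0 and the distance
      of the two images, so the length of the image controls that distance.\<close>
    let ?u = "\<lambda>z. dist (k z) (k y)"
    have "connected (?S t)" using conn t by simp
    moreover have "continuous_on (?S t) ?u"
      by (intro continuous_on_dist continuous_on_const continuous_on_subset[OF kc]) auto
    ultimately have "connected (?u ` ?S t)" by (intro connected_continuous_image)
    moreover have "?u x \<in> ?u ` ?S t" "0 \<in> ?u ` ?S t" using xy by auto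
    ultimately have J: "{0..?u x} \<subseteq> ?u ` ?S t" by (auto dest: connected_contains_Icc)
    have "ennreal (?u x) = (\<integral>\<^sup>+ s\<in>{0..?u x}. 1 \<partial>lborel)" by simp
    also have "\<dots> \<le> 4 * (\<integral>\<^sup>+ z\<in>?S t. 1 * ennreal (cmod (deriv k z)) \<partial>hausdorff1)"
      by (rule length_lower_bound[OF k(1) E(1) nz Sm _ _ J]) auto
    also have "\<dots> \<le> 4 * ennreal (e / 4)" using t(3) by (intro mult_left_mono) auto
    also have "\<dots> = ennreal e" using pos by (simp flip: ennreal_mult ennreal_numeral)
    finally show "?u x \<le> e" using pos by (simp add: ennreal_le_iff)
  qed
qed

text \<open>The distance of \<open>k z\<close> to \<open>p\<close> is continuous on the connected
  set \<open>C\<close>, never 0, and has infimum 0. It therefore sweeps out a full interval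
  \<open>{0<..<\<eta>}\<close>, on which the weight is not integrable. No parametrisation of
  \<open>C\<close> is needed.\<close>

lemma line_integral_log_weight_diverges:
  assumes k: "k holomorphic_on E" "open E" "\<forall>z\<in>E. deriv k z \<noteq> 0"
    and \<Gamma>: "\<Gamma> \<in> sets borel" "\<Gamma> \<subseteq> E" and C: "connected C" "C \<subseteq> \<Gamma>" "\<And>z. z \<in> C \<Longrightarrow> k z \<noteq> p"
    and cluster: "\<And>e. 0 < e \<Longrightarrow> \<exists>z\<in>C. dist (k z) p < e"
  shows "(\<integral>\<^sup>+ z\<in>\<Gamma>. log_weight (dist (k z) p) * ennreal (cmod (deriv k z)) \<partial>hausdorff1) = \<infinity>"
proof -
  let ?u = "\<lambda>z. dist (k z) p"
  obtain x where x: "x \<in> C" using cluster[of 1] by auto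
  then have ux: "0 < ?u x" using C by auto
  have "continuous_on C k"
    using holomorphic_on_imp_continuous_on[OF k(1)] C \<Gamma> continuous_on_subset by blast
  then have conn: "connected (?u ` C)"
    by (intro connected_continuous_image C continuous_on_dist continuous_on_const)
  have J: "{0<..<?u x} \<subseteq> ?u ` \<Gamma>"
  proof
    fix s assume s: "s \<in> {0<..<?u x}"
    then obtain z where z: "z \<in> C" "?u z < s" using cluster[of s] by auto
    then have "{?u z..?u x} \<subseteq> ?u ` C" using connected_contains_Icc[OF conn] x by blast
    moreover have "s \<in> {?u z..?u x}" using s z(2) by simp
    ultimately show "s \<in> ?u ` \<Gamma>" using C(2) by blast
  qed
  have "\<infinity> = (\<integral>\<^sup>+ s\<in>{0<..<?u x}. log_weight s \<partial>lborel)"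
    using log_weight_not_integrable[OF ux] by simp
  also have "\<dots> \<le> 4 * (\<integral>\<^sup>+ z\<in>\<Gamma>. log_weight (?u z) * ennreal (cmod (deriv k z)) \<partial>hausdorff1)"
    by (rule length_lower_bound[OF k \<Gamma> _ J]) auto
  finally show ?thesis by (simp add: top_unique ennreal_mult_eq_top_iff)
qed

text \<open>Here the weight sits in the target, centred at \<open>p\<close>. The weighted lengths of
  the images have an integrable majorant \<Phi>, so one of them is finite; an image clustering at
  \<open>p\<close> would have infinite weighted length.\<close>

lemma circle_with_image_off_point:
  fixes k :: "complex \<Rightarrow> complex"
  assumes k: "k holomorphic_on E" "inj_on k E" and E: "open E" "bounded E"
    and conn: "\<forall>t\<in>{0<..<t0}. connected {z \<in> E. dist z \<zeta> = t}"
    and pos: "0 < t0" and p: "p \<notin> k ` E"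
  obtains t e where "0 < t" "t < t0" "0 < e" "\<And>z. z \<in> E \<Longrightarrow> dist z \<zeta> = t \<Longrightarrow> e \<le> dist (k z) p"
proof -
  let ?S = "\<lambda>t. {z \<in> E. dist z \<zeta> = t}"
  have nz: "\<forall>z\<in>E. deriv k z \<noteq> 0"
    using holomorphic_injective_imp_regular[OF k(1) E(1) k(2)] by blast
  have [measurable]: "E \<in> sets borel" using E by simp
  have Sm: "?S t \<in> sets borel" for t by measurable
  have 1: "(\<integral>\<^sup>+ z\<in>E. (1::ennreal)\<^sup>2 \<partial>lborel) < \<infinity>"
    using emeasure_lborel_bounded_finite[OF E(2)] by simp
  have 2: "(\<integral>\<^sup>+ z\<in>k ` E. (log_weight (dist z p))\<^sup>2 \<partial>lborel) < \<infinity>"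
    by (rule log_weight_square_integrable_on)
  obtain \<Phi> where \<Phi>: "\<Phi> \<in> borel_measurable borel"
    "\<And>r. (\<integral>\<^sup>+ z\<in>?S r. 1 * (log_weight (dist (k z) p) * ennreal (cmod (deriv k z))) \<partial>hausdorff1) \<le> \<Phi> r"
    "(\<integral>\<^sup>+ r. \<Phi> r \<partial>lborel) < \<infinity>"
    using length_area[OF k E _ 1 _ 2, of \<zeta>] by auto
  have "\<exists>t. 0 < t \<and> t < t0 \<and> \<Phi> t \<noteq> \<infinity>"
  proof (rule ccontr)
    assume "\<not> ?thesis"
    then have "(\<integral>\<^sup>+ t. \<infinity> * indicator {0<..<t0} t \<partial>lborel) \<le> (\<integral>\<^sup>+ r. \<Phi> r \<partial>lborel)"
      by (intro nn_integral_mono) (auto split: split_indicator)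
    also have "(\<integral>\<^sup>+ t. \<infinity> * indicator {0<..<t0} t \<partial>lborel) = (\<infinity>::ennreal)"
      using pos by (subst nn_integral_cmult_indicator) (auto simp: ennreal_mult_eq_top_iff)
    finally show False using \<Phi>(3) by simp
  qed
  then obtain t where t: "0 < t" "t < t0" "\<Phi> t \<noteq> \<infinity>" by blast
  have ct: "connected (?S t)" using conn t by simp
  have "\<exists>e>0. \<forall>z\<in>?S t. e \<le> dist (k z) p"
  proof (rule ccontr)
    assume "\<not> ?thesis"
    then have cl: "\<exists>z\<in>?S t. dist (k z) p < e" if "0 < e" for e using that by (meson not_le)
    have "(\<integral>\<^sup>+ z\<in>?S t. log_weight (dist (k z) p) * ennreal (cmod (deriv k z)) \<partial>hausdorff1) = \<infinity>"
      by (rule line_integral_log_weight_diverges[OF k(1) E(1) nz Sm _ ct _ _ cl])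
        (use p in auto)
    with \<Phi>(2)[of t] t(3) show False by (simp add: top_unique)
  qed
  then show thesis using that t by blast
qed

text \<open>Every multiple \<open>d * \<rho>\<close> with \<open>0 < d\<close> still has infinite
  integral along each member, hence is admissible, while its squared norm tends to 0 with
  \<open>d\<close>. Measurable multiplicities allow the factor to be pulled out of the line
  integral.\<close>

lemma modulus_eq_0I:
  assumes \<rho>: "\<rho> \<in> borel_measurable borel" "(\<integral>\<^sup>+ z. (\<rho> z)\<^sup>2 \<partial>lborel) < \<infinity>"
    and inf: "\<And>\<gamma>. \<gamma> \<in> \<Gamma> \<Longrightarrow> multiplicity_at \<gamma> \<in> borel_measurable borel"
    "\<And>\<gamma>. \<gamma> \<in> \<Gamma> \<Longrightarrow> line_integral \<gamma> \<rho> = \<infinity>"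
  shows "modulus \<Gamma> = 0"
proof -
  note \<rho>(1)[measurable]
  obtain q where q: "(\<integral>\<^sup>+ z. (\<rho> z)\<^sup>2 \<partial>lborel) = ennreal q" "0 \<le> q"
    using \<rho>(2) by (cases "\<integral>\<^sup>+ z. (\<rho> z)\<^sup>2 \<partial>lborel") auto
  have le: "modulus \<Gamma> \<le> ennreal (d\<^sup>2 * q)" if d: "0 < d" for d
  proof -
    have "(\<lambda>z. ennreal d * \<rho> z) \<in> adm \<Gamma>"
      unfolding adm_def
    proof safe
      fix \<gamma> assume \<gamma>: "\<gamma> \<in> \<Gamma>"
      have [measurable]: "multiplicity_at \<gamma> \<in> borel_measurable borel" using inf(1)[OF \<gamma>] .
      have "line_integral \<gamma> (\<lambda>z. ennreal d * \<rho> z) = ennreal d * line_integral \<gamma> \<rho>"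
        unfolding line_integral_def mult.assoc by (rule nn_integral_cmult) measurable
      then show "1 \<le> line_integral \<gamma> (\<lambda>z. ennreal d * \<rho> z)"
        using d inf(2)[OF \<gamma>] by (simp add: ennreal_mult_top)
    qed measurable
    then have "modulus \<Gamma> \<le> (\<integral>\<^sup>+ z. (ennreal d * \<rho> z)\<^sup>2 \<partial>lebesgue)"
      unfolding modulus_def by (rule INF_lower)
    also have "\<dots> = (\<integral>\<^sup>+ z. (ennreal d)\<^sup>2 * (\<rho> z)\<^sup>2 \<partial>lborel)"
      by (simp add: nn_integral_completion power_mult_distrib)
    also have "\<dots> = (ennreal d)\<^sup>2 * ennreal q"
      unfolding q(1)[symmetric] by (rule nn_integral_cmult) measurable
    also have "\<dots> = ennreal (d\<^sup>2 * q)" using d q by (simp add: ennreal_power ennreal_mult)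
    finally show ?thesis .
  qed
  have "modulus \<Gamma> \<le> 0 + ennreal e" if "0 < e" for e
  proof -
    define d where "d = sqrt (e / (q + 1))"
    have "0 < d" using that q by (simp add: d_def)
    moreover have "d\<^sup>2 * q \<le> e" using that q by (simp add: d_def field_simps)
    ultimately show ?thesis using le[of d] by (metis add_0 ennreal_leI order_trans)
  qed
  then show ?thesis using ennreal_le_epsilon[of 0 "modulus \<Gamma>"] by simp
qed

section \<open>Modulus of the image of a family of circles\<close>

lemma multiplicity_at_inj:
  assumes "inj_on F A"
  shows "multiplicity_at (A, F) z = indicator (F ` A) z"
proof (cases "z \<in> F ` A")
  case True
  then obtain t where t: "t \<in> A" "z = F t" by blast
  then have "{t \<in> A. F t = z} = {t}" using assms by (auto dest: inj_onD)
  then show ?thesis using True by (simp add: multiplicity_at_def)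
next
  case False
  then have e: "{t \<in> A. F t = z} = {}" by auto
  show ?thesis unfolding multiplicity_at_def fst_conv snd_conv e using False by simp
qed

lemma line_integral_inj:
  "inj_on F A \<Longrightarrow> line_integral (A, F) \<rho> = (\<integral>\<^sup>+ z\<in>F ` A. \<rho> z \<partial>hausdorff1)"
  by (simp add: line_integral_def multiplicity_at_inj)

section \<open>Positive lower bound for the modulus\<close>

lemma ennreal_power2_le_imp_le:
  fixes x y :: ennreal
  assumes "x\<^sup>2 \<le> y\<^sup>2"
  shows "x \<le> y"
proof (cases y)
  case y: (real b)
  then have "x \<noteq> \<infinity>" using assms by (auto simp: ennreal_power top_unique)
  then obtain a where a: "x = ennreal a" "0 \<le> a" by (cases x) auto
  then have "a\<^sup>2 \<le> b\<^sup>2" using assms y by (simp add: ennreal_power)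
  then show ?thesis using a y by (auto intro: ennreal_leI power2_le_imp_le)
qed simp

text \<open>Almost everywhere equality says nothing on a single circle, which is a null set. The
  Borel version is therefore raised to infinity on a Borel null set, so that line integrals cannot
  decrease.\<close>

lemma lebesgue_borel_majorant:
  fixes \<rho> :: "complex \<Rightarrow> ennreal"
  assumes "\<rho> \<in> borel_measurable lebesgue"
  obtains \<rho>' where "\<rho>' \<in> borel_measurable borel" "\<And>z. \<rho> z \<le> \<rho>' z" "AE z in lborel. \<rho>' z = \<rho> z"
proof -
  obtain \<rho>1 where \<rho>1: "\<rho>1 \<in> borel_measurable lborel" "AE z in lborel. \<rho> z = \<rho>1 z"
    using completion_ex_borel_measurable[OF assms] by blast
  obtain N where N: "{z \<in> space lborel. \<rho> z \<noteq> \<rho>1 z} \<subseteq> N" "emeasure lborel N = 0" "N \<in> sets lborel"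
    using \<rho>1(2) by (rule AE_E)
  have Nn: "N \<in> null_sets lborel" using N by auto
  note \<rho>1(1)[measurable]
  have [measurable]: "N \<in> sets borel" using N(3) by simp
  show thesis
  proof (rule that)
    show "(\<lambda>z. \<rho>1 z + \<infinity> * indicator N z) \<in> borel_measurable borel"
      using \<rho>1(1) by measurable
    show "\<rho> z \<le> \<rho>1 z + \<infinity> * indicator N z" for z
    proof (cases "z \<in> N")
      case False
      then have "\<rho> z = \<rho>1 z" using N(1) by auto
      then show ?thesis by simp
    qed simp
    show "AE z in lborel. \<rho>1 z + \<infinity> * indicator N z = \<rho> z"
      using \<rho>1(2) AE_not_in[OF Nn] by eventually_elim simp
  qed
qed

text \<open>An extensively admissible function becomes admissible for all circles after adding a function
  of small \<open>L\<^sup>2\<close> norm that is admissible for the exceptional ones.\<close>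
lemma lower_Q_modulus_pos:
  assumes D: "open D" "bounded D" and Q: "Q \<in> borel_measurable lebesgue" "\<And>z. 0 < Q z"
    and QL1: "set_integrable lebesgue D Q" and f: "lower_Q_at Q D f z0"
    and e: "0 < \<epsilon>" "\<epsilon> < \<epsilon>0" "\<epsilon>0 < (SUP z\<in>D. dist z z0)"
  shows "0 < modulus (image_family f (circle_family D z0 \<epsilon> \<epsilon>0))"
proof -
  define q where "q = (\<integral>\<^sup>+ z\<in>D. ennreal (Q z) \<partial>lebesgue)"
  have Dm [measurable]: "D \<in> sets borel" using D by simp
  have "q = (\<integral>\<^sup>+ z. ennreal (norm (indicator D z *\<^sub>R Q z)) \<partial>lebesgue)"
    unfolding q_def using less_imp_le[OF Q(2)] by (intro nn_integral_cong) (auto split: split_indicator)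
  also have "\<dots> < \<infinity>"
    using QL1 unfolding set_integrable_def by (simp add: integrable_iff_bounded)
  finally obtain q' where q': "q = ennreal q'" "0 \<le> q'" by (cases q) auto
  define B where "B = D \<inter> annulus z0 \<epsilon> \<epsilon>0"
  have ann: "annulus z0 \<epsilon> \<epsilon>0 = ball z0 \<epsilon>0 - cball z0 \<epsilon>" by (auto simp: annulus_def dist_commute)
  have Bm [measurable]: "B \<in> sets borel" and Bb: "bounded B"
    unfolding B_def ann using D by (auto intro: bounded_subset)
  have lip: "\<bar>dist x z0 - dist y z0\<bar> \<le> dist x y" for x y
    using abs_dist_diff_le[of x z0 y] by (simp add: dist_commute)
  \<comment> \<open>Every circle has integral at least 1, so Eilenberg's inequality gives
    \<open>\<epsilon>0 - \<epsilon> \<le> 4 * x\<close> for the integral \<open>x\<close> of \<rho>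
    over \<open>B\<close>. Cauchy-Schwarz with the factors \<open>\<rho> / sqrt Q\<close> and
    \<open>sqrt Q\<close> gives \<open>x\<^sup>2 \<le> I * q\<close>, hence 16. The summand 1 guards
    against \<open>q' = 0\<close>.\<close>
  define c where "c = (\<epsilon>0 - \<epsilon>)\<^sup>2 / (16 * (q' + 1))"
  have c: "0 < c" using e q' by (simp add: c_def)
  have "ennreal c \<le> (\<integral>\<^sup>+ z\<in>B. ((\<rho> z)\<^sup>2 / ennreal (Q z)) \<partial>lebesgue)"
    if \<rho>: "\<rho> \<in> ext_adm (circle_family D z0 \<epsilon> \<epsilon>0)" for \<rho>
  proof -
    define I where "I = (\<integral>\<^sup>+ z\<in>B. ((\<rho> z)\<^sup>2 / ennreal (Q z)) \<partial>lebesgue)"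
    define x where "x = (\<integral>\<^sup>+ z\<in>B. \<rho> z \<partial>lebesgue)"
    have \<rho>m: "\<rho> \<in> borel_measurable lebesgue" using \<rho> by (simp add: ext_adm_def)
    note \<rho>m[measurable] Q(1)[measurable]
    have Bl [measurable]: "B \<in> sets lebesgue" using Bm by (simp add: sets_completionI_sets)
    have "x\<^sup>2 \<le> I * q"
    proof -
      have "x = (\<integral>\<^sup>+ z. (\<rho> z * ennreal (1 / sqrt (Q z)) * indicator B z) * (ennreal (sqrt (Q z)) * indicator B z) \<partial>lebesgue)"
        unfolding x_def
      proof (rule nn_integral_cong)
        fix z
        have "ennreal (1 / sqrt (Q z)) * ennreal (sqrt (Q z)) = 1"
          using Q(2)[of z] by (simp flip: ennreal_mult)
        then show "\<rho> z * indicator B z = (\<rho> z * ennreal (1 / sqrt (Q z)) * indicator B z) * (ennreal (sqrt (Q z)) * indicator B z)"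
          by (auto simp: mult.assoc split: split_indicator)
      qed
      also have "\<dots>\<^sup>2 \<le> (\<integral>\<^sup>+ z. (\<rho> z * ennreal (1 / sqrt (Q z)) * indicator B z)\<^sup>2 \<partial>lebesgue) *
          (\<integral>\<^sup>+ z. (ennreal (sqrt (Q z)) * indicator B z)\<^sup>2 \<partial>lebesgue)"
        by (rule Cauchy_Schwarz_nn_integral) measurable
      also have "(\<integral>\<^sup>+ z. (\<rho> z * ennreal (1 / sqrt (Q z)) * indicator B z)\<^sup>2 \<partial>lebesgue) = I"
        unfolding I_def
      proof (rule nn_integral_cong)
        fix z
        have "(ennreal (1 / sqrt (Q z)))\<^sup>2 = inverse (ennreal (Q z))"
          using Q(2)[of z] by (simp add: ennreal_power power_divide inverse_ennreal inverse_eq_divide less_imp_le)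
        then show "(\<rho> z * ennreal (1 / sqrt (Q z)) * indicator B z)\<^sup>2 = (\<rho> z)\<^sup>2 / ennreal (Q z) * indicator B z"
          by (auto simp: power_mult_distrib divide_ennreal_def split: split_indicator)
      qed
      also have "(\<integral>\<^sup>+ z. (ennreal (sqrt (Q z)) * indicator B z)\<^sup>2 \<partial>lebesgue) \<le> q"
        unfolding q_def
      proof (rule nn_integral_mono)
        fix z
        have "(ennreal (sqrt (Q z)))\<^sup>2 = ennreal (Q z)"
          using Q(2)[of z] by (simp add: ennreal_power less_imp_le)
        then show "(ennreal (sqrt (Q z)) * indicator B z)\<^sup>2 \<le> ennreal (Q z) * indicator D z"
          by (auto simp: power_mult_distrib B_def split: split_indicator)
      qed
      finally show ?thesis by (simp add: mult_left_mono)
    qed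
    have "ennreal (\<epsilon>0 - \<epsilon>) \<le> 4 * x"
    proof (rule ennreal_le_epsilon)
      fix \<eta> :: real assume \<eta>: "0 < \<eta>"
      define m where "m = emeasure lborel B"
      have "m < \<infinity>" unfolding m_def using emeasure_lborel_bounded_finite[OF Bb] .
      then obtain m' where m': "m = ennreal m'" "0 \<le> m'" by (cases m) auto
      \<comment> \<open>Chosen so that the correction \<open>\<rho>1\<close> costs at most \<eta>:
        by Cauchy-Schwarz the square of four times its integral over \<open>B\<close> is at most
        \<open>16 * \<delta> * m'\<close>.\<close>
      define \<delta> where "\<delta> = \<eta>\<^sup>2 / (16 * (m' + 1))"
      have \<delta>: "0 < \<delta>" using \<eta> m' by (simp add: \<delta>_def)
      define bad where "bad = {\<gamma> \<in> circle_family D z0 \<epsilon> \<epsilon>0. \<not> 1 \<le> line_integral \<gamma> \<rho>}"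
      have "modulus bad < ennreal \<delta>" using \<rho> \<delta> by (simp add: ext_adm_def bad_def)
      then obtain \<rho>1 where \<rho>1: "\<rho>1 \<in> adm bad" "(\<integral>\<^sup>+ z. (\<rho>1 z)\<^sup>2 \<partial>lebesgue) < ennreal \<delta>"
        unfolding modulus_def INF_less_iff by blast
      have \<rho>1m [measurable]: "\<rho>1 \<in> borel_measurable borel" using \<rho>1(1) by (simp add: adm_def)
      obtain \<rho>2 where \<rho>2: "\<rho>2 \<in> borel_measurable borel" "\<And>z. \<rho> z \<le> \<rho>2 z" "AE z in lborel. \<rho>2 z = \<rho> z"
        by (rule lebesgue_borel_majorant[OF \<rho>m]) blast
      note \<rho>2(1)[measurable]
      define P where "P z = \<rho>2 z + \<rho>1 z" for z
      have Pm: "P \<in> borel_measurable borel" unfolding P_def by measurable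
      obtain \<Phi> where \<Phi>: "\<Phi> \<in> borel_measurable borel"
        "\<And>r. (\<integral>\<^sup>+ z\<in>{z \<in> B. dist z z0 = r}. P z \<partial>hausdorff1) \<le> \<Phi> r"
        "(\<integral>\<^sup>+ r. \<Phi> r \<partial>lborel) \<le> 4 * (\<integral>\<^sup>+ z\<in>B. P z \<partial>lborel)"
        using eilenberg[OF Pm Bm Bb lip] by blast
      have "1 \<le> \<Phi> r" if r: "\<epsilon> < r" "r < \<epsilon>0" for r
      proof -
        let ?\<gamma> = "(D \<inter> sphere z0 r, id :: complex \<Rightarrow> complex)"
        have \<gamma>: "?\<gamma> \<in> circle_family D z0 \<epsilon> \<epsilon>0" using r by (auto simp: circle_family_def)
        have S: "{z \<in> B. dist z z0 = r} = D \<inter> sphere z0 r"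
          using r by (auto simp: B_def annulus_def dist_commute)
        have li: "line_integral ?\<gamma> \<tau> = (\<integral>\<^sup>+ z\<in>{z \<in> B. dist z z0 = r}. \<tau> z \<partial>hausdorff1)" for \<tau>
          unfolding S by (subst line_integral_inj) auto
        have "1 \<le> (\<integral>\<^sup>+ z\<in>{z \<in> B. dist z z0 = r}. P z \<partial>hausdorff1)"
        proof (cases "1 \<le> line_integral ?\<gamma> \<rho>")
          case True
          also have "line_integral ?\<gamma> \<rho> \<le> (\<integral>\<^sup>+ z\<in>{z \<in> B. dist z z0 = r}. P z \<partial>hausdorff1)"
            unfolding li P_def using \<rho>2(2) by (intro nn_integral_mono mult_right_mono) (auto intro: add_increasing2)
          finally show ?thesis .
        next
          case False
          then have "?\<gamma> \<in> bad" using \<gamma> by (simp add: bad_def)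
          then have "1 \<le> line_integral ?\<gamma> \<rho>1" using \<rho>1(1) unfolding adm_def by blast
          also have "\<dots> \<le> (\<integral>\<^sup>+ z\<in>{z \<in> B. dist z z0 = r}. P z \<partial>hausdorff1)"
            unfolding li P_def by (intro nn_integral_mono mult_right_mono) (auto intro: add_increasing)
          finally show ?thesis .
        qed
        with \<Phi>(2) show ?thesis using order_trans by blast
      qed
      then have "(\<integral>\<^sup>+ r. indicator {\<epsilon><..<\<epsilon>0} r \<partial>lborel) \<le> (\<integral>\<^sup>+ r. \<Phi> r \<partial>lborel)"
        by (intro nn_integral_mono) (auto split: split_indicator)
      then have "ennreal (\<epsilon>0 - \<epsilon>) \<le> (\<integral>\<^sup>+ r. \<Phi> r \<partial>lborel)" using e by simp
      also have "\<dots> \<le> 4 * (\<integral>\<^sup>+ z\<in>B. P z \<partial>lborel)" by (rule \<Phi>)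
      also have "(\<integral>\<^sup>+ z\<in>B. P z \<partial>lborel) = (\<integral>\<^sup>+ z\<in>B. \<rho>2 z \<partial>lborel) + (\<integral>\<^sup>+ z\<in>B. \<rho>1 z \<partial>lborel)"
        unfolding P_def distrib_right by (rule nn_integral_add) measurable
      also have "(\<integral>\<^sup>+ z\<in>B. \<rho>2 z \<partial>lborel) = x"
        unfolding x_def nn_integral_completion
        by (rule nn_integral_cong_AE) (use \<rho>2(3) in \<open>eventually_elim, simp\<close>)
      finally have main: "ennreal (\<epsilon>0 - \<epsilon>) \<le> 4 * x + 4 * (\<integral>\<^sup>+ z\<in>B. \<rho>1 z \<partial>lborel)"
        by (simp add: distrib_left)
      have "4 * (\<integral>\<^sup>+ z\<in>B. \<rho>1 z \<partial>lborel) \<le> ennreal \<eta>"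
      proof (rule ennreal_power2_le_imp_le)
        have "(\<integral>\<^sup>+ z\<in>B. \<rho>1 z \<partial>lborel)\<^sup>2 \<le> (\<integral>\<^sup>+ z. (\<rho>1 z)\<^sup>2 \<partial>lborel) * (\<integral>\<^sup>+ z. (indicator B z)\<^sup>2 \<partial>lborel)"
          by (rule Cauchy_Schwarz_nn_integral) measurable
        also have "(\<integral>\<^sup>+ z. (indicator B z)\<^sup>2 \<partial>lborel) = (\<integral>\<^sup>+ z. indicator B z \<partial>lborel)"
          by (rule nn_integral_cong) (auto split: split_indicator)
        also have "\<dots> = ennreal m'" using m' by (simp add: m_def)
        also have "(\<integral>\<^sup>+ z. (\<rho>1 z)\<^sup>2 \<partial>lborel) * ennreal m' \<le> ennreal \<delta> * ennreal m'"
          using \<rho>1(2) by (intro mult_right_mono) (auto simp: nn_integral_completion)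
        also have "\<dots> = ennreal (\<delta> * m')" using \<delta> m' by (simp flip: ennreal_mult)
        finally have "(4::ennreal)\<^sup>2 * (\<integral>\<^sup>+ z\<in>B. \<rho>1 z \<partial>lborel)\<^sup>2 \<le> 4\<^sup>2 * ennreal (\<delta> * m')"
          by (intro mult_left_mono) auto
        also have "\<dots> = ennreal (16 * (\<delta> * m'))" using \<delta> m' by (subst ennreal_mult) auto
        also have "\<dots> \<le> ennreal (\<eta>\<^sup>2)"
        proof (rule ennreal_leI)
          have "16 * (\<delta> * m') = \<eta>\<^sup>2 * (m' / (m' + 1))" using m' by (simp add: \<delta>_def divide_simps)
          also have "\<dots> \<le> \<eta>\<^sup>2 * 1" using m' by (intro mult_left_mono) auto
          finally show "16 * (\<delta> * m') \<le> \<eta>\<^sup>2" by simp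
        qed
        finally show "(4 * (\<integral>\<^sup>+ z\<in>B. \<rho>1 z \<partial>lborel))\<^sup>2 \<le> (ennreal \<eta>)\<^sup>2"
          using \<eta> by (simp add: power_mult_distrib ennreal_power)
      qed
      with main show "ennreal (\<epsilon>0 - \<epsilon>) \<le> 4 * x + ennreal \<eta>"
        by (meson add_left_mono order_trans)
    qed
    then have "(ennreal (\<epsilon>0 - \<epsilon>))\<^sup>2 \<le> (4 * x)\<^sup>2" by (rule power_mono) simp
    also have "\<dots> = 16 * x\<^sup>2" by (simp add: power_mult_distrib)
    also have "\<dots> \<le> 16 * (I * q)" using \<open>x\<^sup>2 \<le> I * q\<close> by (rule mult_left_mono) simp
    finally have fin: "(ennreal (\<epsilon>0 - \<epsilon>))\<^sup>2 \<le> 16 * (I * q)" .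
    have "ennreal c \<le> I"
    proof (cases I)
      case (real i)
      have "ennreal ((\<epsilon>0 - \<epsilon>)\<^sup>2) \<le> ennreal (16 * (i * q'))"
        using fin e q' real by (simp add: ennreal_power ennreal_mult)
      then have "(\<epsilon>0 - \<epsilon>)\<^sup>2 \<le> 16 * (i * q')" using real q' by (simp add: ennreal_le_iff)
      also have "\<dots> \<le> 16 * (i * (q' + 1))" using real by (simp add: algebra_simps)
      finally have "c \<le> i" using q' by (simp add: c_def divide_simps mult_ac)
      then show ?thesis using real by (simp add: ennreal_leI)
    qed simp
    then show ?thesis by (simp add: I_def)
  qed
  then have "ennreal c \<le> (INF \<rho>\<in>ext_adm (circle_family D z0 \<epsilon> \<epsilon>0).
      \<integral>\<^sup>+ z\<in>D \<inter> annulus z0 \<epsilon> \<epsilon>0. ((\<rho> z)\<^sup>2 / ennreal (Q z)) \<partial>lebesgue)"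
    unfolding B_def by (rule INF_greatest)
  also have "\<dots> \<le> modulus (image_family f (circle_family D z0 \<epsilon> \<epsilon>0))"
    using f e unfolding lower_Q_at_def by auto
  finally show ?thesis using c by (meson ennreal_less_zero_iff less_le_trans)
qed

section \<open>Boundary points of circular domains\<close>

text \<open>With the angle \<theta> measured from the direction of \<open>n\<close>, the inner
  product is \<open>s * cmod n * cos \<theta>\<close>. As the cosine decreases in
  \<bar>\<theta>\<bar> up to pi, the admissible angles form an interval around 0. For
  \<open>n = 0\<close> any direction serves.\<close>

lemma connected_circle_halfplane:
  fixes n :: complex
  assumes "0 < s"
  shows "connected {w. cmod w = s \<and> c < w \<bullet> n}"
proof -
  define m where "m = (if n = 0 then 1 else sgn n)"
  have m: "cmod m = 1" "n = of_real (cmod n) * m"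
    by (simp add: m_def norm_sgn) (simp add: m_def sgn_div_norm scaleR_conv_of_real)
  define A where "A = {\<theta>\<in>{-pi..pi}. c < s * cmod n * cos \<theta>}"
  have inner: "(of_real s * m * cis \<theta>) \<bullet> n = s * cmod n * cos \<theta>" for \<theta>
  proof -
    have "(of_real s * m * cis \<theta>) \<bullet> n = Re ((of_real s * m * cis \<theta>) * cnj n)"
      by (simp add: inner_complex_def algebra_simps)
    also have "(of_real s * m * cis \<theta>) * cnj n = of_real (s * cmod n) * (m * cnj m) * cis \<theta>"
      by (subst m(2)) (simp add: mult_ac)
    also have "m * cnj m = 1" using m(1) by (simp flip: complex_norm_square)
    finally show ?thesis by simp
  qed
  have "is_interval A"
    unfolding is_interval_1
  proof (intro ballI allI impI)
    fix a b x assume ab: "a \<in> A" "b \<in> A" and x: "a \<le> x \<and> x \<le> b"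
    have "\<bar>x\<bar> \<le> max \<bar>a\<bar> \<bar>b\<bar>" using x by auto
    then obtain d where d: "d \<in> A" "\<bar>x\<bar> \<le> \<bar>d\<bar>" using ab by (metis max_def)
    then have "cos \<bar>d\<bar> \<le> cos \<bar>x\<bar>" by (intro cos_monotone_0_pi_le) (auto simp: A_def)
    then have "cos d \<le> cos x" by simp
    then have "s * cmod n * cos d \<le> s * cmod n * cos x" using assms by (intro mult_left_mono) auto
    then show "x \<in> A" using d ab x by (auto simp: A_def)
  qed
  then have "connected A" by (simp add: is_interval_connected_1)
  then have "connected ((\<lambda>\<theta>. of_real s * m * cis \<theta>) ` A)"
    by (intro connected_continuous_image continuous_intros)
  moreover have "(\<lambda>\<theta>. of_real s * m * cis \<theta>) ` A = {w. cmod w = s \<and> c < w \<bullet> n}"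
  proof (intro equalityI subsetI)
    fix w assume "w \<in> (\<lambda>\<theta>. of_real s * m * cis \<theta>) ` A"
    then show "w \<in> {w. cmod w = s \<and> c < w \<bullet> n}"
      using inner assms m by (auto simp: A_def norm_mult)
  next
    fix w assume w: "w \<in> {w. cmod w = s \<and> c < w \<bullet> n}"
    define \<theta> where "\<theta> = Arg (w / m)"
    have m0: "m \<noteq> 0" using m(1) by auto
    have "w / m = rcis (cmod (w / m)) \<theta>" by (simp add: \<theta>_def rcis_cmod_Arg)
    then have wm: "w = of_real s * m * cis \<theta>"
      using w m(1) m0 by (auto simp: rcis_def norm_divide field_simps)
    moreover have "\<theta> \<in> A"
    proof -
      have "w \<bullet> n = s * cmod n * cos \<theta>" using inner[of \<theta>] unfolding wm[symmetric] .
      moreover have "- pi \<le> \<theta>" "\<theta> \<le> pi" using Arg_bounded[of "w / m"] by (auto simp: \<theta>_def)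
      ultimately show ?thesis using w by (simp add: A_def)
    qed
    ultimately show "w \<in> (\<lambda>\<theta>. of_real s * m * cis \<theta>) ` A" by blast
  qed
  ultimately show ?thesis by simp
qed

section \<open>Circles and discs centred on the boundary of another disc\<close>

lemma cmod_add_power2: "(cmod (w + n))\<^sup>2 = (cmod w)\<^sup>2 + 2 * (w \<bullet> n) + (cmod n)\<^sup>2"
  by (simp add: power2_norm_eq_inner inner_simps inner_commute)

lemma power2_less_power2_iff:
  fixes x y :: real
  assumes "0 \<le> x" "0 \<le> y"
  shows "x\<^sup>2 < y\<^sup>2 \<longleftrightarrow> x < y"
  using assms by (auto intro: power2_less_imp_less power_strict_mono)

text \<open>Since \<zeta> lies on the circle around \<open>a\<close>, squaring the condition
  \<open>R < dist z a\<close> cancels the terms \<open>R\<^sup>2\<close>. On a fixed circle around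
  \<zeta> what remains is linear, that is, a half-plane.\<close>

lemma connected_circle_Diff_cball:
  fixes \<zeta> a :: complex
  assumes "dist \<zeta> a = R" "0 < s"
  shows "connected {z. dist z \<zeta> = s \<and> z \<notin> cball a R}"
proof -
  have "{z. dist z \<zeta> = s \<and> z \<notin> cball a R} = (+) \<zeta> ` {w. cmod w = s \<and> - (s\<^sup>2 / 2) < w \<bullet> (\<zeta> - a)}"
  proof (intro set_eqI)
    fix z
    have R: "0 \<le> R" "cmod (\<zeta> - a) = R" using assms by (auto simp: dist_norm)
    have "z \<notin> cball a R \<longleftrightarrow> R < cmod ((z - \<zeta>) + (\<zeta> - a))" by (simp add: dist_norm norm_minus_commute not_le)
    also have "\<dots> \<longleftrightarrow> R\<^sup>2 < (cmod ((z - \<zeta>) + (\<zeta> - a)))\<^sup>2"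
      using R by (simp add: power2_less_power2_iff)
    also have "\<dots> \<longleftrightarrow> - ((cmod (z - \<zeta>))\<^sup>2 / 2) < (z - \<zeta>) \<bullet> (\<zeta> - a)"
      unfolding cmod_add_power2 R by auto
    finally have eq: "z \<notin> cball a R \<longleftrightarrow> - ((cmod (z - \<zeta>))\<^sup>2 / 2) < (z - \<zeta>) \<bullet> (\<zeta> - a)" .
    show "z \<in> {z. dist z \<zeta> = s \<and> z \<notin> cball a R} \<longleftrightarrow>
      z \<in> (+) \<zeta> ` {w. cmod w = s \<and> - (s\<^sup>2 / 2) < w \<bullet> (\<zeta> - a)}"
      using eq by (auto simp: dist_norm image_iff intro!: exI[of _ "z - \<zeta>"])
  qed
  then show ?thesis
    by (simp only:) (intro connected_continuous_image connected_circle_halfplane[OF assms(2)] continuous_intros)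
qed

lemma connected_circle_Int_ball:
  fixes \<zeta> a :: complex
  assumes "dist \<zeta> a = R" "0 < s"
  shows "connected {z. dist z \<zeta> = s \<and> z \<in> ball a R}"
proof -
  have "{z. dist z \<zeta> = s \<and> z \<in> ball a R} = (+) \<zeta> ` {w. cmod w = s \<and> s\<^sup>2 / 2 < w \<bullet> (a - \<zeta>)}"
  proof (intro set_eqI)
    fix z
    have R: "0 \<le> R" "cmod (\<zeta> - a) = R" using assms by (auto simp: dist_norm)
    have "z \<in> ball a R \<longleftrightarrow> cmod ((z - \<zeta>) + (\<zeta> - a)) < R" by (simp add: dist_norm norm_minus_commute)
    also have "\<dots> \<longleftrightarrow> (cmod ((z - \<zeta>) + (\<zeta> - a)))\<^sup>2 < R\<^sup>2"
      using R by (simp add: power2_less_power2_iff)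
    also have "\<dots> \<longleftrightarrow> (cmod (z - \<zeta>))\<^sup>2 / 2 < (z - \<zeta>) \<bullet> (a - \<zeta>)"
      unfolding cmod_add_power2 R by (auto simp: inner_diff_right)
    finally have eq: "z \<in> ball a R \<longleftrightarrow> (cmod (z - \<zeta>))\<^sup>2 / 2 < (z - \<zeta>) \<bullet> (a - \<zeta>)" .
    show "z \<in> {z. dist z \<zeta> = s \<and> z \<in> ball a R} \<longleftrightarrow>
      z \<in> (+) \<zeta> ` {w. cmod w = s \<and> s\<^sup>2 / 2 < w \<bullet> (a - \<zeta>)}"
      using eq by (auto simp: dist_norm image_iff intro!: exI[of _ "z - \<zeta>"])
  qed
  then show ?thesis
    by (simp only:) (intro connected_continuous_image connected_circle_halfplane[OF assms(2)] continuous_intros)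
qed

text \<open>The set is a union of arcs of circles around \<zeta>, each connected, and the outward
  normal ray from \<zeta> meets all of them. When \<open>R = 0\<close> any ray will do.\<close>

lemma connected_ball_Diff_cball:
  fixes \<zeta> a :: complex
  assumes R: "dist \<zeta> a = R"
  shows "connected (ball \<zeta> t - cball a R)"
proof -
  define m where "m = (if \<zeta> = a then 1 else sgn (\<zeta> - a))"
  have m: "cmod m = 1" "\<zeta> - a = of_real R * m"
    by (simp add: m_def norm_sgn) (use R in \<open>auto simp: m_def sgn_div_norm scaleR_conv_of_real dist_norm\<close>)
  define ray where "ray = (\<lambda>s. \<zeta> + of_real s * m) ` {0<..<t}"
  define S where "S s = {z. dist z \<zeta> = s \<and> z \<notin> cball a R}" for s
  have R0: "0 \<le> R" using R by auto
  have pt: "\<zeta> + of_real s * m \<in> S s" if "0 < s" for s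
  proof -
    have "dist a (\<zeta> + of_real s * m) = cmod ((\<zeta> - a) + of_real s * m)"
      by (simp add: dist_norm norm_minus_commute algebra_simps)
    also have "\<dots> = cmod (of_real (R + s) * m)" unfolding m(2) by (simp add: algebra_simps)
    also have "\<dots> = R + s" using that R0 m(1) by (simp add: norm_mult del: of_real_add)
    finally show ?thesis using that m(1) by (simp add: S_def dist_norm norm_mult)
  qed
  have ray_c: "connected ray" unfolding ray_def by (intro connected_continuous_image continuous_intros) auto
  have eq: "ball \<zeta> t - cball a R = ray \<union> (\<Union>s\<in>{0<..<t}. ray \<union> S s)"
  proof (intro equalityI subsetI)
    fix z assume z: "z \<in> ball \<zeta> t - cball a R"
    moreover have "z \<noteq> \<zeta>" using z R by (auto simp: dist_commute)
    ultimately have "dist z \<zeta> \<in> {0<..<t}" "z \<in> S (dist z \<zeta>)" by (auto simp: S_def dist_commute)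
    then show "z \<in> ray \<union> (\<Union>s\<in>{0<..<t}. ray \<union> S s)" by blast
  next
    fix z assume "z \<in> ray \<union> (\<Union>s\<in>{0<..<t}. ray \<union> S s)"
    then consider "z \<in> ray" | "\<exists>s\<in>{0<..<t}. z \<in> S s" by blast
    then have "\<exists>s\<in>{0<..<t}. z \<in> S s"
    proof cases
      case 1
      then obtain s where "s \<in> {0<..<t}" "z = \<zeta> + of_real s * m" by (auto simp: ray_def)
      then show ?thesis using pt[of s] by auto
    qed
    then show "z \<in> ball \<zeta> t - cball a R" by (auto simp: S_def dist_commute)
  qed
  have c: "connected (ray \<union> S s)" if "s \<in> {0<..<t}" for s
  proof (rule connected_Un[OF ray_c])
    show "connected (S s)" unfolding S_def using connected_circle_Diff_cball[OF R] that by simp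
    have "\<zeta> + of_real s * m \<in> ray" unfolding ray_def using that by (intro image_eqI[of _ _ s]) auto
    then show "ray \<inter> S s \<noteq> {}" using pt[of s] that by auto
  qed
  show ?thesis
  proof (cases "t \<le> 0")
    case False
    then have "t / 2 \<in> {0<..<t}" by auto
    then have ne: "ray \<noteq> {}" by (auto simp: ray_def)
    have "connected (\<Union>(insert ray ((\<lambda>s. ray \<union> S s) ` {0<..<t})))"
      by (rule connected_Union) (use c ray_c ne in auto)
    also have "\<Union>(insert ray ((\<lambda>s. ray \<union> S s) ` {0<..<t})) = ball \<zeta> t - cball a R" unfolding eq by auto
    finally show ?thesis .
  qed (simp add: ball_empty)
qed

text \<open>The case \<open>R = 0\<close> of the second alternative is that of an isolated boundary point.\<close>
lemma circular_domain_local: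
  assumes G: "bounded_circular_domain G" and \<zeta>: "\<zeta> \<in> frontier G"
  obtains a R t0 where "0 < t0" "dist \<zeta> a = R" "R = 0 \<or> t0 \<le> R"
    "(\<forall>t\<le>t0. G \<inter> ball \<zeta> t = ball a R \<inter> ball \<zeta> t) \<or> (\<forall>t\<le>t0. G \<inter> ball \<zeta> t = ball \<zeta> t - cball a R)"
proof -
  from G obtain K where dom: "open G" "connected G" "G \<noteq> {}"
    and K: "finite K" "disjoint K" "\<forall>k\<in>K. \<exists>a r. 0 \<le> r \<and> k = sphere a r" "frontier G = \<Union>K"
    by (auto simp: bounded_circular_domain_def bounded_domain_def)
  obtain k0 where k0: "k0 \<in> K" "\<zeta> \<in> k0" using \<zeta> K by auto
  then obtain a R where aR: "0 \<le> R" "k0 = sphere a R" using K by blast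
  have \<zeta>R: "dist \<zeta> a = R" using k0 aR by (simp add: dist_commute)
  have "closed (\<Union>(K - {k0}))" using K(1,3) by (intro closed_Union ballI) (simp, metis DiffD1 closed_sphere)
  moreover have "\<zeta> \<notin> \<Union>(K - {k0})" using k0 K(2) by (auto simp: disjoint_def)
  ultimately obtain t1 where t1: "0 < t1" "ball \<zeta> t1 \<inter> \<Union>(K - {k0}) = {}"
    by (meson Compl_iff disjoint_eq_subset_Compl openE open_Compl)
  \<comment> \<open>For \<open>0 < R\<close> the ball around \<zeta> must not contain the centre
    \<open>a\<close>; this is used to show that its part outside the disc is simply
    connected.\<close>
  define t0 where "t0 = (if R = 0 then t1 else min t1 R)"
  have t0: "0 < t0" "t0 \<le> t1" "R = 0 \<or> t0 \<le> R" using t1 aR by (auto simp: t0_def)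
  have fr: "frontier G \<inter> ball \<zeta> t0 \<subseteq> sphere a R"
  proof
    fix z assume z: "z \<in> frontier G \<inter> ball \<zeta> t0"
    then obtain k where k: "k \<in> K" "z \<in> k" using K by auto
    moreover have "z \<in> ball \<zeta> t1" using z t0(2) by auto
    ultimately have "k = k0" using t1(2) by blast
    with k aR show "z \<in> sphere a R" by simp
  qed
  have "G \<inter> frontier G = {}" using dom(1) by (auto simp: frontier_def interior_open)
  then have Gs: "G \<inter> sphere a R = {}" using K aR k0 by auto
  have "G \<subseteq> ball a R \<or> G \<subseteq> - cball a R"
  proof -
    have "ball a R \<inter> G = {} \<or> - cball a R \<inter> G = {}"
      by (rule connectedD[OF dom(2)]) (use Gs in \<open>auto simp: less_le\<close>)
    moreover have "z \<in> ball a R \<or> z \<in> - cball a R" if "z \<in> G" for z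
      using Gs that by (force simp: less_le)
    ultimately show ?thesis by blast
  qed
  \<comment> \<open>A connected set that meets \<open>G\<close> and misses its frontier lies in
    \<open>G\<close>. Applied to a whole side of the circle within the ball, it determines
    \<open>G\<close> near \<zeta> once the side on which \<open>G\<close> lies is known.\<close>
  moreover have fill: "U \<subseteq> G" if U: "connected U" "U \<subseteq> ball \<zeta> t0" "U \<inter> sphere a R = {}" "G \<inter> ball \<zeta> t0 \<subseteq> U" for U
  proof -
    have "\<zeta> \<in> closure G" using \<zeta> by (simp add: frontier_def)
    then obtain z where "z \<in> G" "dist z \<zeta> < t0" using t0 closure_approachable by blast
    then have "U \<inter> G \<noteq> {}" using U(4) by (auto simp: dist_commute)
    moreover have "U \<inter> frontier G = {}" using U fr by blast
    ultimately show ?thesis using connected_Int_frontier[OF U(1)] by blast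
  qed
  ultimately consider "G \<subseteq> ball a R" | "G \<subseteq> - cball a R" by blast
  then show thesis
  proof cases
    case 1
    have "ball a R \<inter> ball \<zeta> t0 \<subseteq> G"
      by (rule fill) (use 1 in \<open>auto intro!: convex_connected convex_Int\<close>)
    then have "G \<inter> ball \<zeta> t = ball a R \<inter> ball \<zeta> t" if "t \<le> t0" for t using 1 that by auto
    then show thesis using that t0 \<zeta>R by blast
  next
    case 2
    have "ball \<zeta> t0 - cball a R \<subseteq> G"
      by (rule fill) (use 2 connected_ball_Diff_cball[OF \<zeta>R] in auto)
    then have "G \<inter> ball \<zeta> t = ball \<zeta> t - cball a R" if "t \<le> t0" for t using 2 that by auto
    then show thesis using that t0 \<zeta>R by blast
  qed
qed

text \<open>Collects what is needed at boundary points: connected small balls at \<open>w\<close>,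
  and at \<zeta> connected circles for the length-area argument and the topological type for the
  separation argument.\<close>

lemma circular_domain_connected_near:
  assumes G: "bounded_circular_domain G" and \<zeta>: "\<zeta> \<in> frontier G"
  obtains t0 where "0 < t0" "\<And>t. t \<le> t0 \<Longrightarrow> connected (G \<inter> ball \<zeta> t)"
    "\<And>t. 0 < t \<Longrightarrow> t < t0 \<Longrightarrow> connected {z \<in> G. dist z \<zeta> = t}"
    "simply_connected (G \<inter> ball \<zeta> t0) \<or> G \<inter> ball \<zeta> t0 = ball \<zeta> t0 - {\<zeta>}"
proof -
  obtain a R t0 where t0: "0 < t0" "dist \<zeta> a = R" "R = 0 \<or> t0 \<le> R"
    "(\<forall>t\<le>t0. G \<inter> ball \<zeta> t = ball a R \<inter> ball \<zeta> t) \<or> (\<forall>t\<le>t0. G \<inter> ball \<zeta> t = ball \<zeta> t - cball a R)"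
    by (rule circular_domain_local[OF G \<zeta>]) blast
  have circ: "{z \<in> G. dist z \<zeta> = t} = {z. dist z \<zeta> = t \<and> z \<in> G \<inter> ball \<zeta> t0}" if "t < t0" for t
    using that by (auto simp: dist_commute)
  from t0(4) show thesis
  proof
    assume *: "\<forall>t\<le>t0. G \<inter> ball \<zeta> t = ball a R \<inter> ball \<zeta> t"
    show thesis
    proof (rule that[OF t0(1)])
      fix t assume "t \<le> t0"
      then show "connected (G \<inter> ball \<zeta> t)" using * by (simp add: convex_connected convex_Int)
    next
      fix t assume t: "0 < t" "t < t0"
      have "{z \<in> G. dist z \<zeta> = t} = {z. dist z \<zeta> = t \<and> z \<in> ball a R}"
        unfolding circ[OF t(2)] using * t by (auto simp: dist_commute)
      then show "connected {z \<in> G. dist z \<zeta> = t}" using connected_circle_Int_ball[OF t0(2) t(1)] by simp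
    next
      show "simply_connected (G \<inter> ball \<zeta> t0) \<or> G \<inter> ball \<zeta> t0 = ball \<zeta> t0 - {\<zeta>}"
        using * by (simp add: convex_imp_simply_connected convex_Int)
    qed
  next
    assume *: "\<forall>t\<le>t0. G \<inter> ball \<zeta> t = ball \<zeta> t - cball a R"
    show thesis
    proof (rule that[OF t0(1)])
      fix t assume "t \<le> t0"
      then show "connected (G \<inter> ball \<zeta> t)" using * connected_ball_Diff_cball[OF t0(2)] by simp
    next
      fix t assume t: "0 < t" "t < t0"
      have "{z \<in> G. dist z \<zeta> = t} = {z. dist z \<zeta> = t \<and> z \<notin> cball a R}"
        unfolding circ[OF t(2)] using * t by (auto simp: dist_commute)
      then show "connected {z \<in> G. dist z \<zeta> = t}" using connected_circle_Diff_cball[OF t0(2) t(1)] by simp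
    next
      show "simply_connected (G \<inter> ball \<zeta> t0) \<or> G \<inter> ball \<zeta> t0 = ball \<zeta> t0 - {\<zeta>}"
      proof (cases "R = 0")
        case True
        then show ?thesis using * t0(2) by auto
      next
        case False
        then have "t0 \<le> R" using t0 by simp
        have L: "G \<inter> ball \<zeta> t0 = ball \<zeta> t0 - cball a R" using * by simp
        have "simply_connected (ball \<zeta> t0 - cball a R)"
        proof (subst simply_connected_iff_simple)
          \<comment> \<open>The complement is the union of two connected sets that share the point
            \<open>a\<close>, and a bounded connected open set with connected complement is simply
            connected.\<close>
          have "- (ball \<zeta> t0 - cball a R) = - ball \<zeta> t0 \<union> cball a R" by auto
          moreover have "connected (- ball \<zeta> t0 \<union> cball a R)"
          proof (rule connected_Un)
            have "a \<in> - ball \<zeta> t0 \<inter> cball a R" using t0 \<open>t0 \<le> R\<close> by auto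
            then show "- ball \<zeta> t0 \<inter> cball a R \<noteq> {}" by blast
          qed (auto intro: connected_complement_bounded_convex)
          ultimately show "connected (ball \<zeta> t0 - cball a R) \<and> connected (- (ball \<zeta> t0 - cball a R))"
            using connected_ball_Diff_cball[OF t0(2)] by simp
        qed (auto intro: bounded_subset[OF bounded_ball])
        then show ?thesis unfolding L by blast
      qed
    qed
  qed
qed

text \<open>A homeomorphism of \<open>L\<close> onto the plane turns the level set into a closed
  subset of the plane. By the intermediate value theorem it separates \<open>A\<close> from
  \<open>B\<close>; the plane then provides a single component that does so.\<close>

lemma simply_connected_separating_level_component:
  fixes L :: "complex set" and v :: "complex \<Rightarrow> real"
  assumes L: "open L" "simply_connected L" and v: "continuous_on L v"
    and AB: "connected A" "A \<subseteq> L" "\<forall>z\<in>A. v z < r"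
      "connected B" "B \<subseteq> L" "\<forall>z\<in>B. r < v z"
    and ne: "A \<noteq> {}" "B \<noteq> {}"
  obtains C where "connected C" "C \<subseteq> {z \<in> L. v z = r}" "open (L - C)"
    "\<And>x y. x \<in> A \<Longrightarrow> y \<in> B \<Longrightarrow> \<not> connected_component (L - C) x y"
proof -
  have "L \<noteq> {}" using AB ne by blast
  then have "L homeomorphic ball (0::complex) 1"
    using simply_connected_eq_homeomorphic_to_disc[OF L(1)] L(2) by blast
  also have "ball (0::complex) 1 homeomorphic (UNIV :: complex set)" by (rule homeomorphic_ball_UNIV) simp
  finally obtain \<Phi> \<Psi> where h: "homeomorphism L (UNIV :: complex set) \<Phi> \<Psi>" by (auto simp: homeomorphic_def)
  note \<Psi>c = homeomorphism_cont2[OF h] and \<Phi>c = homeomorphism_cont1[OF h]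
  have \<Psi>L: "\<Psi> w \<in> L" for w using homeomorphism_image2[OF h] by blast
  have inv: "\<Phi> (\<Psi> w) = w" for w using homeomorphism_apply2[OF h] by simp
  have inv': "\<Psi> (\<Phi> z) = z" if "z \<in> L" for z using homeomorphism_apply1[OF h that] .
  define X where "X = {w. v (\<Psi> w) = r}"
  have cv: "continuous_on UNIV (\<lambda>w. v (\<Psi> w))"
    by (rule continuous_on_compose2[OF v \<Psi>c]) (use \<Psi>L in auto)
  have "closed X" unfolding X_def using cv by (intro closed_Collect_eq) auto
  obtain a b where ab: "a \<in> A" "b \<in> B" using ne by blast
  have sep: "\<not> connected_component (- X) (\<Phi> a) (\<Phi> b)"
  proof
    assume "connected_component (- X) (\<Phi> a) (\<Phi> b)"
    then obtain T where T: "connected T" "T \<subseteq> - X" "\<Phi> a \<in> T" "\<Phi> b \<in> T"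
      by (auto simp: connected_component_def)
    have "connected ((\<lambda>w. v (\<Psi> w)) ` T)"
      by (rule connected_continuous_image[OF continuous_on_subset[OF cv] T(1)]) simp
    moreover have "v a \<in> (\<lambda>w. v (\<Psi> w)) ` T" "v b \<in> (\<lambda>w. v (\<Psi> w)) ` T"
      using T inv' ab AB by (metis image_eqI subsetD)+
    ultimately have "{v a..v b} \<subseteq> (\<lambda>w. v (\<Psi> w)) ` T" by (rule connected_contains_Icc)
    moreover have "r \<in> {v a..v b}" using AB ab by (auto intro: less_imp_le)
    ultimately show False using T(2) by (auto simp: X_def)
  qed
  \<comment> \<open>If a closed set separates two points of the plane, then one of its components
    does. In an annulus this fails: two radial cuts separate, neither does alone.\<close>
  obtain C' where C': "C' \<in> components X" "\<not> connected_component (- C') (\<Phi> a) (\<Phi> b)"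
    using separation_by_component_closed_pointwise[OF \<open>closed X\<close> sep] .
  define C where "C = \<Psi> ` C'"
  have C'X: "C' \<subseteq> X" and C'c: "connected C'" "closed C'"
    using C' \<open>closed X\<close> by (auto simp: in_components_subset in_components_connected closed_components)
  have LC: "L - C = {z \<in> L. \<Phi> z \<in> - C'}"
    using \<Psi>L inv inv' by (auto simp: C_def image_iff) metis
  show thesis
  proof (rule that)
    show "connected C" unfolding C_def
      by (rule connected_continuous_image[OF continuous_on_subset[OF \<Psi>c] C'c(1)]) simp
    show "C \<subseteq> {z \<in> L. v z = r}" using C'X \<Psi>L by (auto simp: C_def X_def)
    show "open (L - C)"
    proof -
      have "open (L \<inter> \<Phi> -` (- C'))"
        using continuous_open_preimage[OF \<Phi>c L(1)] C'c(2) by (simp add: open_Compl)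
      also have "L \<inter> \<Phi> -` (- C') = L - C" unfolding LC by auto
      finally show ?thesis .
    qed
    fix x y assume xy: "x \<in> A" "y \<in> B"
    show "\<not> connected_component (L - C) x y"
    proof
      assume "connected_component (L - C) x y"
      then obtain T where T: "connected T" "T \<subseteq> L - C" "x \<in> T" "y \<in> T"
        by (auto simp: connected_component_def)
      have off: "z \<in> L - C" if "z \<in> A \<union> B" for z
        using that AB C'X unfolding C_def by (force simp: X_def)
      have "connected (A \<union> T \<union> B)"
        by (intro connected_Un) (use AB T xy in auto)
      moreover have sub: "A \<union> T \<union> B \<subseteq> L - C" using off T by auto
      ultimately have "connected (\<Phi> ` (A \<union> T \<union> B))"
        by (intro connected_continuous_image continuous_on_subset[OF \<Phi>c]) auto
      moreover have "\<Phi> ` (A \<union> T \<union> B) \<subseteq> - C'" using sub unfolding LC by blast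
      ultimately have "connected_component (- C') (\<Phi> a) (\<Phi> b)"
        using ab unfolding connected_component_def by blast
      with C' show False by simp
    qed
  qed
qed

section \<open>Arcs separating two prime ends\<close>

text \<open>Circles shrinking to \<zeta> with images of diameter tending to 0 accumulate at some
  \<open>p\<close> by compactness. If \<open>p\<close> were in the image of \<open>G\<close>,
  continuity of the inverse of \<open>k\<close> would make points on these circles converge to a
  point of \<open>G\<close> instead of \<zeta>. In prime end theory such a limit of crosscuts is
  called a principal point.\<close>

lemma principal_point:
  assumes k: "k holomorphic_on G" "inj_on k G" and G: "open G" "bounded G" "bounded (k ` G)"
    and \<zeta>: "\<zeta> \<notin> G" and t0: "0 < t0"
    and conn: "\<forall>t\<in>{0<..<t0}. connected {z \<in> G. dist z \<zeta> = t}"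
    and ne: "\<forall>t\<in>{0<..<t0}. \<exists>z\<in>G. dist z \<zeta> = t"
  obtains p where "p \<in> closure (k ` G)" "p \<notin> k ` G"
    "\<And>\<epsilon> \<tau>. 0 < \<epsilon> \<Longrightarrow> 0 < \<tau> \<Longrightarrow> \<exists>s. 0 < s \<and> s < \<tau> \<and> s < t0 \<and> (\<forall>z\<in>G. dist z \<zeta> = s \<longrightarrow> dist (k z) p < \<epsilon>)"
proof -
  define \<delta> where "\<delta> n = min t0 (1 / real (Suc n))" for n
  have \<delta>: "0 < \<delta> n" for n using t0 by (simp add: \<delta>_def)
  have "\<forall>n. \<exists>t. 0 < t \<and> t < \<delta> n \<and>
      (\<forall>x\<in>G. \<forall>y\<in>G. dist x \<zeta> = t \<longrightarrow> dist y \<zeta> = t \<longrightarrow> dist (k x) (k y) \<le> 1 / real (Suc n))"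
  proof
    fix n
    have c: "\<forall>t\<in>{0<..<\<delta> n}. connected {z \<in> G. dist z \<zeta> = t}"
      using conn by (simp add: \<delta>_def)
    have pos: "0 < 1 / real (Suc n)" by simp
    obtain t where "0 < t" "t < \<delta> n"
      "\<And>x y. x \<in> G \<Longrightarrow> y \<in> G \<Longrightarrow> dist x \<zeta> = t \<Longrightarrow> dist y \<zeta> = t \<Longrightarrow> dist (k x) (k y) \<le> 1 / real (Suc n)"
      by (rule circle_with_small_image[OF k G c \<delta> pos]) blast
    then show "\<exists>t. 0 < t \<and> t < \<delta> n \<and>
      (\<forall>x\<in>G. \<forall>y\<in>G. dist x \<zeta> = t \<longrightarrow> dist y \<zeta> = t \<longrightarrow> dist (k x) (k y) \<le> 1 / real (Suc n))" by blast
  qed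
  from choice[OF this] obtain t where t: "\<And>n. 0 < t n" "\<And>n. t n < \<delta> n"
    "\<And>n x y. x \<in> G \<Longrightarrow> y \<in> G \<Longrightarrow> dist x \<zeta> = t n \<Longrightarrow> dist y \<zeta> = t n \<Longrightarrow> dist (k x) (k y) \<le> 1 / real (Suc n)"
    by blast
  have tt0: "t n < t0" for n using t(2)[of n] by (simp add: \<delta>_def)
  have "\<forall>n. \<exists>z. z \<in> G \<and> dist z \<zeta> = t n" using ne t(1) tt0 by (auto simp: Bex_def)
  from choice[OF this] obtain q where q: "\<And>n. q n \<in> G" "\<And>n. dist (q n) \<zeta> = t n" by blast
  have "compact (closure (k ` G))" using G(3) by (simp add: compact_closure)
  moreover have "\<forall>n. (k \<circ> q) n \<in> closure (k ` G)"
    using q(1) closure_subset[of "k ` G"] by auto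
  ultimately obtain p \<sigma> where p: "p \<in> closure (k ` G)" "strict_mono (\<sigma> :: nat \<Rightarrow> nat)" "((k \<circ> q) \<circ> \<sigma>) \<longlonglongrightarrow> p"
    unfolding compact_def by blast
  have "t \<longlonglongrightarrow> 0"
  proof (rule tendsto_sandwich[of "\<lambda>_. 0" _ _ "\<lambda>n. 1 / real (Suc n)"])
    show "(\<lambda>n. 1 / real (Suc n)) \<longlonglongrightarrow> 0" by (rule one_over_Suc_tendsto_0)
    show "\<forall>\<^sub>F n in sequentially. t n \<le> 1 / real (Suc n)"
      using t(2) by (intro always_eventually allI) (auto simp: \<delta>_def less_imp_le)
  qed (use t(1) in \<open>auto intro: always_eventually less_imp_le\<close>)
  then have t\<sigma>: "(t \<circ> \<sigma>) \<longlonglongrightarrow> 0" using p(2) by (rule LIMSEQ_subseq_LIMSEQ)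
  show thesis
  proof (rule that[OF p(1)])
    show "p \<notin> k ` G"
    proof
      assume pk: "p \<in> k ` G"
      obtain g where g: "g holomorphic_on (k ` G)" "\<And>z. z \<in> G \<Longrightarrow> g (k z) = z"
        using holomorphic_has_inverse[OF k(1) G(1) k(2)] by metis
      have "(\<lambda>n. g (((k \<circ> q) \<circ> \<sigma>) n)) \<longlonglongrightarrow> g p"
        by (rule continuous_on_tendsto_compose[OF holomorphic_on_imp_continuous_on[OF g(1)] p(3) pk])
          (use q in auto)
      then have "(\<lambda>n. q (\<sigma> n)) \<longlonglongrightarrow> g p" using g(2) q(1) by simp
      moreover have "(\<lambda>n. q (\<sigma> n)) \<longlonglongrightarrow> \<zeta>"
        using t\<sigma> q(2) by (subst tendsto_dist_iff) (simp add: o_def)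
      ultimately have "g p = \<zeta>" by (rule LIMSEQ_unique)
      moreover have "g p \<in> G" using pk g(2) by auto
      ultimately show False using \<zeta> by simp
    qed
  next
    fix \<epsilon> \<tau> :: real assume e: "0 < \<epsilon>" "0 < \<tau>"
    have "\<forall>\<^sub>F n in sequentially. dist (((k \<circ> q) \<circ> \<sigma>) n) p < \<epsilon> / 2"
      by (rule tendstoD[OF p(3)]) (use e in simp)
    moreover have "\<forall>\<^sub>F n in sequentially. (t \<circ> \<sigma>) n < \<tau>" by (rule order_tendstoD(2)[OF t\<sigma> e(2)])
    moreover have "\<forall>\<^sub>F n in sequentially. 1 / real (Suc n) < \<epsilon> / 2"
    proof -
      have "(\<lambda>n. 1 / real (Suc n)) \<longlonglongrightarrow> 0" by (rule one_over_Suc_tendsto_0)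
      then show ?thesis using e by (intro order_tendstoD) auto
    qed
    ultimately have "\<forall>\<^sub>F n in sequentially. dist (((k \<circ> q) \<circ> \<sigma>) n) p < \<epsilon> / 2 \<and> (t \<circ> \<sigma>) n < \<tau> \<and> 1 / real (Suc n) < \<epsilon> / 2"
      by eventually_elim simp
    then obtain n where n: "dist (k (q (\<sigma> n))) p < \<epsilon> / 2" "t (\<sigma> n) < \<tau>" "1 / real (Suc n) < \<epsilon> / 2"
      by (auto simp: eventually_sequentially)
    have "dist (k z) p < \<epsilon>" if z: "z \<in> G" "dist z \<zeta> = t (\<sigma> n)" for z
    proof -
      have "dist (k z) (k (q (\<sigma> n))) \<le> 1 / real (Suc (\<sigma> n))" using t(3)[OF z(1) q(1) z(2) q(2)] .
      also have "\<dots> \<le> 1 / real (Suc n)"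
        using seq_suble[OF p(2), of n] by (intro divide_left_mono) auto
      finally show ?thesis using n dist_triangle[of "k z" p "k (q (\<sigma> n))"] by linarith
    qed
    then show "\<exists>s. 0 < s \<and> s < \<tau> \<and> s < t0 \<and> (\<forall>z\<in>G. dist z \<zeta> = s \<longrightarrow> dist (k z) p < \<epsilon>)"
      using n(2) t(1) tt0 by blast
  qed
qed

text \<open>At an isolated boundary point the distance to \<open>p\<close> extends continuously by \<open>0\<close>, which makes the
  domain of the level function simply connected in all cases.\<close>
lemma level_function:
  assumes k: "k holomorphic_on G" and G: "open G" "bounded (k ` G)" and \<zeta>: "\<zeta> \<notin> G" and t0: "0 < t0"
    and top: "simply_connected (G \<inter> ball \<zeta> t0) \<or> G \<inter> ball \<zeta> t0 = ball \<zeta> t0 - {\<zeta>}"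
    and p: "\<forall>\<epsilon>>0. \<forall>\<tau>>0. \<exists>z\<in>G. dist z \<zeta> < \<tau> \<and> dist (k z) p < \<epsilon>"
  obtains L v where "open L" "simply_connected L" "continuous_on L v" "G \<inter> ball \<zeta> t0 \<subseteq> L" "L \<subseteq> ball \<zeta> t0"
    "\<forall>z\<in>G \<inter> ball \<zeta> t0. v z = dist (k z) p" "\<forall>z\<in>L - G. v z = 0"
proof (cases "simply_connected (G \<inter> ball \<zeta> t0)")
  case True
  show thesis
  proof (rule that[of "G \<inter> ball \<zeta> t0" "\<lambda>z. dist (k z) p"])
    show "continuous_on (G \<inter> ball \<zeta> t0) (\<lambda>z. dist (k z) p)"
      by (intro continuous_on_dist continuous_on_const
          continuous_on_subset[OF holomorphic_on_imp_continuous_on[OF k]]) auto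
  qed (use True G in auto)
next
  case False
  then have pd: "G \<inter> ball \<zeta> t0 = ball \<zeta> t0 - {\<zeta>}" using top by blast
  then have hol: "k holomorphic_on ball \<zeta> t0 - {\<zeta>}" using k holomorphic_on_subset by blast
  obtain B where B: "\<And>z. z \<in> G \<Longrightarrow> cmod (k z) \<le> B" using G(2) by (auto simp: bounded_iff)
  have "cmod (k z) \<le> B" if "z \<noteq> \<zeta>" "dist z \<zeta> < t0" for z
  proof -
    have "z \<in> G \<inter> ball \<zeta> t0" unfolding pd using that by (auto simp: dist_commute)
    then show ?thesis using B by blast
  qed
  then have "\<forall>\<^sub>F z in at \<zeta>. cmod (k z) \<le> B"
    unfolding eventually_at using t0 by blast
  then obtain l where l: "l holomorphic_on ball \<zeta> t0" "\<And>z. z \<in> ball \<zeta> t0 - {\<zeta>} \<Longrightarrow> l z = k z"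
    using holomorphic_on_extend_bounded[OF hol] t0 by auto
  have lc: "continuous_on (ball \<zeta> t0) l" using l(1) by (rule holomorphic_on_imp_continuous_on)
  have "l \<zeta> = p"
  proof (rule ccontr)
    assume "l \<zeta> \<noteq> p"
    then have e: "0 < dist (l \<zeta>) p / 2" by simp
    have "isCont l \<zeta>" using lc t0 by (simp add: continuous_on_eq_continuous_at)
    then obtain d where d: "0 < d" "\<And>z. dist z \<zeta> < d \<Longrightarrow> dist (l z) (l \<zeta>) < dist (l \<zeta>) p / 2"
      using e unfolding continuous_at_eps_delta by blast
    obtain z where z: "z \<in> G" "dist z \<zeta> < min d t0" "dist (k z) p < dist (l \<zeta>) p / 2"
      using p[rule_format, OF e, of "min d t0"] d t0 by auto
    then have "z \<in> G \<inter> ball \<zeta> t0" by (auto simp: dist_commute)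
    then have "l z = k z" using l(2) pd by auto
    then show False using d(2)[of z] z dist_triangle[of "l \<zeta>" p "l z"] by (simp add: dist_commute)
  qed
  show thesis
  proof (rule that[of "ball \<zeta> t0" "\<lambda>z. dist (l z) p"])
    show "continuous_on (ball \<zeta> t0) (\<lambda>z. dist (l z) p)"
      by (intro continuous_on_dist continuous_on_const lc)
    show "\<forall>z\<in>G \<inter> ball \<zeta> t0. dist (l z) p = dist (k z) p" using l(2) pd by auto
    show "\<forall>z\<in>ball \<zeta> t0 - G. dist (l z) p = 0" using pd \<open>l \<zeta> = p\<close> by auto
  qed (use pd in \<open>auto simp: convex_imp_simply_connected\<close>)
qed

text \<open>The circle of radius \<open>s\<close> lies below the level \<open>r\<close> and that of
  radius \<open>t\<close> above it, so a component \<open>C\<close> of the level set separates them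
  in \<open>L\<close>. Every connected set in \<open>G\<close> leading from inside the first circle
  to outside the second has to cross \<open>C\<close>.\<close>

lemma separating_arc:
  fixes G L :: "complex set" and u v :: "complex \<Rightarrow> real"
  assumes G: "open G" and L: "open L" "simply_connected L" "continuous_on L v"
      "G \<inter> ball \<zeta> t0 \<subseteq> L" "L \<subseteq> ball \<zeta> t0"
      "\<forall>z\<in>G \<inter> ball \<zeta> t0. v z = u z" "\<forall>z\<in>L - G. v z = 0"
    and st: "0 < s" "s < t" "t < t0"
    and circ: "connected {z \<in> G. dist z \<zeta> = s}" "connected {z \<in> G. dist z \<zeta> = t}"
      "\<exists>z\<in>G. dist z \<zeta> = s" "\<exists>z\<in>G. dist z \<zeta> = t"
    and r: "0 < r" "\<forall>z\<in>G. dist z \<zeta> = s \<longrightarrow> u z < r" "\<forall>z\<in>G. dist z \<zeta> = t \<longrightarrow> r < u z"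
  obtains C where "connected C" "C \<subseteq> {z \<in> G. u z = r}"
    "\<And>T. connected T \<Longrightarrow> T \<subseteq> G \<Longrightarrow> \<exists>z\<in>T. dist z \<zeta> < s \<Longrightarrow> \<exists>z\<in>T. t < dist z \<zeta> \<Longrightarrow> T \<inter> C \<noteq> {}"
proof -
  let ?A = "{z \<in> G. dist z \<zeta> = s}" and ?B = "{z \<in> G. dist z \<zeta> = t}"
  have AL: "?A \<subseteq> G \<inter> ball \<zeta> t0" and BL: "?B \<subseteq> G \<inter> ball \<zeta> t0" using st by (auto simp: dist_commute)
  have AL': "?A \<subseteq> L" and BL': "?B \<subseteq> L" using AL BL L(4) by auto
  have vA: "\<forall>z\<in>?A. v z < r" using r(2) L(6) AL by fastforce
  have vB: "\<forall>z\<in>?B. r < v z" using r(3) L(6) BL by fastforce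
  have ne: "?A \<noteq> {}" "?B \<noteq> {}" using circ(3,4) by auto
  obtain C where C: "connected C" "C \<subseteq> {z \<in> L. v z = r}" "open (L - C)"
    "\<And>x y. x \<in> ?A \<Longrightarrow> y \<in> ?B \<Longrightarrow> \<not> connected_component (L - C) x y"
    by (rule simply_connected_separating_level_component
        [OF L(1,2,3) circ(1) AL' vA circ(2) BL' vB ne]) blast
  show thesis
  proof (rule that[OF C(1)])
    show "C \<subseteq> {z \<in> G. u z = r}"
    proof
      fix z assume "z \<in> C"
      then have z: "z \<in> L" "v z = r" using C(2) by auto
      \<comment> \<open>Off \<open>G\<close>, that is at a filled-in puncture, the level function is
        0, whereas \<open>0 < r\<close>.\<close>
      then have "z \<in> G" using L(7) r(1) by (metis DiffI less_irrefl)
      then show "z \<in> {z \<in> G. u z = r}" using z L(5,6) by auto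
    qed
    fix T assume T: "connected T" "T \<subseteq> G" "\<exists>z\<in>T. dist z \<zeta> < s" "\<exists>z\<in>T. t < dist z \<zeta>"
    show "T \<inter> C \<noteq> {}"
    proof
      assume TC: "T \<inter> C = {}"
      obtain x y where xy: "x \<in> T" "dist x \<zeta> < s" "y \<in> T" "t < dist y \<zeta>" using T by blast
      have "connected ((\<lambda>z. dist z \<zeta>) ` T)"
        by (intro connected_continuous_image T continuous_on_dist continuous_on_id continuous_on_const)
      then have "{dist x \<zeta>..dist y \<zeta>} \<subseteq> (\<lambda>z. dist z \<zeta>) ` T"
        by (rule connected_contains_Icc) (use xy in auto)
      moreover have "s \<in> {dist x \<zeta>..dist y \<zeta>}" using xy st by auto
      ultimately obtain a where a: "a \<in> T" "dist a \<zeta> = s" by (metis imageE subsetD)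
      define V where "V = connected_component_set (L - C) a"
      have Vo: "open V" unfolding V_def using C(3) by (rule open_connected_component)
      have "closedin (top_of_set (L - C)) V" unfolding V_def by (rule closedin_connected_component)
      then have "openin (top_of_set (L - C)) ((L - C) - V)"
        using openin_diff[OF openin_subtopology_self] by blast
      then have Wo: "open ((L - C) - V)" using C(3) openin_open_trans by blast
      have aG: "a \<in> ?A" using a T by auto
      have aV: "a \<in> V"
        unfolding V_def using a TC aG AL' by (simp add: connected_component_refl_eq) blast
      \<comment> \<open>\<open>T\<close> may leave the region \<open>L\<close> where components are
        controlled. It is cut off at the circle of radius \<open>t\<close>, no point of which lies
        in the component \<open>V\<close> of \<open>a\<close>. So \<open>V\<close> within the ball
        and \<open>W\<close> would disconnect \<open>T\<close>.\<close>
      define W where "W = - cball \<zeta> t \<union> ((L - C) - V)"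
      have "open W" unfolding W_def using Wo by auto
      moreover have "open (V \<inter> ball \<zeta> t)" using Vo by auto
      moreover have "(V \<inter> ball \<zeta> t) \<inter> W \<inter> T = {}" by (auto simp: W_def)
      moreover have "T \<subseteq> (V \<inter> ball \<zeta> t) \<union> W"
      proof
        fix z assume z: "z \<in> T"
        show "z \<in> (V \<inter> ball \<zeta> t) \<union> W"
        proof (cases "dist z \<zeta> \<le> t")
          case True
          then have "z \<in> L" using z T(2) L(4) st by (auto simp: dist_commute)
          then have zL: "z \<in> L - C" using z TC by blast
          have "dist z \<zeta> < t" if "z \<in> V"
          proof (rule ccontr)
            assume "\<not> dist z \<zeta> < t"
            then have "z \<in> ?B" using True z T(2) by auto
            then have "\<not> connected_component (L - C) a z" using C(4)[OF aG] by blast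
            with that show False by (simp add: V_def)
          qed
          then show ?thesis using zL by (auto simp: W_def dist_commute)
        qed (auto simp: W_def dist_commute)
      qed
      ultimately have "(V \<inter> ball \<zeta> t) \<inter> T = {} \<or> W \<inter> T = {}"
        using connectedD[OF T(1)] by blast
      moreover have "a \<in> (V \<inter> ball \<zeta> t) \<inter> T" using a aV st by (auto simp: dist_commute)
      moreover have "y \<in> W \<inter> T" using xy by (auto simp: W_def dist_commute)
      ultimately show False by blast
    qed
  qed
qed

text \<open>The images of the circles around a principal point of one of the two prime ends contain
  arcs that end at \<open>w\<close>, so the modulus of the image family vanishes.\<close>
lemma cluster_points_unique:
  assumes D: "open D" "bounded D" "D \<noteq> {}" and Q: "Q \<in> borel_measurable lebesgue" "\<And>z. 0 < Q z"
    and QL1: "set_integrable lebesgue D Q" and lower: "\<And>z0. z0 \<in> closure D \<Longrightarrow> lower_Q_at Q D f z0"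
    and f: "homeomorphism D D' f f'" and D': "open D'"
    and g: "circular_uniformization g D" and h: "circular_uniformization h D'"
    and w: "w \<in> frontier (h ` D')"
    and x: "\<And>n. x n \<in> D'" "(\<lambda>n. h (x n)) \<longlonglongrightarrow> w" "(\<lambda>n. g (f' (x n))) \<longlonglongrightarrow> \<zeta>"
    and y: "\<And>n. y n \<in> D'" "(\<lambda>n. h (y n)) \<longlonglongrightarrow> w" "(\<lambda>n. g (f' (y n))) \<longlonglongrightarrow> \<xi>"
  shows "\<zeta> = \<xi>"
proof (rule ccontr)
  assume neq: "\<zeta> \<noteq> \<xi>"
  define G where "G = g ` D"
  define H where "H = h ` D'"
  have gG: "g holomorphic_on D" "inj_on g D" "bounded_circular_domain G"
    and hH: "h holomorphic_on D'" "inj_on h D'" "bounded_circular_domain H"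
    using g h by (auto simp: circular_uniformization_def G_def H_def)
  have G: "open G" "bounded G" "connected G" and H: "open H"
    using gG(3) hH(3) by (auto simp: bounded_circular_domain_def bounded_domain_def)
  obtain k where k: "k holomorphic_on G" "\<And>z. z \<in> D \<Longrightarrow> k (g z) = z"
    using holomorphic_has_inverse[OF gG(1) D(1) gG(2)] unfolding G_def by metis
  obtain l where l: "l holomorphic_on H" "\<And>z. z \<in> D' \<Longrightarrow> l (h z) = z"
    using holomorphic_has_inverse[OF hH(1) D' hH(2)] unfolding H_def by metis
  have kinj: "inj_on k G" using k(2) by (intro inj_onI) (auto simp: G_def)
  have kG: "k ` G = D" using k(2) by (force simp: G_def)
  have gk: "g (k z) = z" "k z \<in> D" if "z \<in> G" for z using that k(2) by (auto simp: G_def)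
  have fc: "continuous_on D f" and fc': "continuous_on D' f'"
    and ff: "\<And>z. z \<in> D \<Longrightarrow> f' (f z) = z" "\<And>z. z \<in> D' \<Longrightarrow> f (f' z) = z" "f ` D = D'" "f' ` D' = D"
    using f by (auto simp: homeomorphism_def)
  have wH: "w \<notin> H" using w H by (simp add: H_def frontier_def interior_open)
  \<comment> \<open>Otherwise continuity of \<open>h\<close>, \<open>f\<close> and \<open>k\<close>
    would make \<open>h (x n)\<close> converge to a point of the open set \<open>H\<close>, while
    \<open>w\<close> is on its frontier.\<close>
  have \<zeta>G: "\<zeta> \<notin> G"
  proof
    assume "\<zeta> \<in> G"
    have "continuous_on G (\<lambda>z. h (f (k z)))"
    proof -
      have "continuous_on G k" using k(1) by (rule holomorphic_on_imp_continuous_on)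
      then have "continuous_on G (\<lambda>z. f (k z))" using continuous_on_compose2[OF fc] gk(2) by blast
      then show ?thesis
        using continuous_on_compose2[OF holomorphic_on_imp_continuous_on[OF hH(1)]] gk(2) ff(3) by blast
    qed
    then have "(\<lambda>n. h (f (k (g (f' (x n)))))) \<longlonglongrightarrow> h (f (k \<zeta>))"
      by (rule continuous_on_tendsto_compose[OF _ x(3) \<open>\<zeta> \<in> G\<close>])
        (use x(1) ff(4) in \<open>auto simp: G_def\<close>)
    moreover have "h (f (k (g (f' (x n))))) = h (x n)" for n
    proof -
      have "f' (x n) \<in> D" using x(1) ff(4) by blast
      then show ?thesis using k(2) ff(2) x(1) by simp
    qed
    ultimately have "(\<lambda>n. h (x n)) \<longlonglongrightarrow> h (f (k \<zeta>))" by simp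
    then have "h (f (k \<zeta>)) = w" using x(2) LIMSEQ_unique by blast
    moreover have "h (f (k \<zeta>)) \<in> H" using gk(2)[OF \<open>\<zeta> \<in> G\<close>] ff(3) by (auto simp: H_def)
    ultimately show False using wH by simp
  qed
  have "\<zeta> \<in> closure G"
    unfolding closure_sequential using x(1,3) ff(4) by (intro exI[of _ "\<lambda>n. g (f' (x n))"]) (auto simp: G_def)
  then have \<zeta>fr: "\<zeta> \<in> frontier G" using \<zeta>G G by (simp add: frontier_def interior_open)
  obtain t0 where t0: "0 < t0" "\<And>t. 0 < t \<Longrightarrow> t < t0 \<Longrightarrow> connected {z \<in> G. dist z \<zeta> = t}"
    "simply_connected (G \<inter> ball \<zeta> t0) \<or> G \<inter> ball \<zeta> t0 = ball \<zeta> t0 - {\<zeta>}"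
    by (rule circular_domain_connected_near[OF gG(3) \<zeta>fr]) blast
  obtain \<delta>0 where \<delta>0: "0 < \<delta>0" "\<And>t. t \<le> \<delta>0 \<Longrightarrow> connected (H \<inter> ball w t)"
    by (rule circular_domain_connected_near[OF hH(3) w[folded H_def]]) blast
  \<comment> \<open>Circles around \<zeta> of radius below \<open>t1\<close> eventually have the
    first sequence inside and the second outside; in particular they meet the connected set
    \<open>G\<close>.\<close>
  define t1 where "t1 = min t0 (dist \<zeta> \<xi>)"
  have t1: "0 < t1" "t1 \<le> t0" "t1 \<le> dist \<zeta> \<xi>" using t0 neq by (auto simp: t1_def)
  have xs: "\<forall>\<^sub>F n in sequentially. dist (g (f' (x n))) \<zeta> < s" if "0 < s" for s
    using x(3) that by (rule tendstoD)
  have ys: "\<forall>\<^sub>F n in sequentially. s < dist (g (f' (y n))) \<zeta>" if "s < t1" for s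
  proof -
    have "(\<lambda>n. dist (g (f' (y n))) \<zeta>) \<longlonglongrightarrow> dist \<xi> \<zeta>" by (intro tendsto_dist y(3) tendsto_const)
    then show ?thesis by (rule order_tendstoD) (use that t1 in \<open>simp add: dist_commute\<close>)
  qed
  have xG: "g (f' (x n)) \<in> G" and yG: "g (f' (y n)) \<in> G" for n using x(1) y(1) ff(4) by (auto simp: G_def)
  have circ_c: "\<forall>t\<in>{0<..<t1}. connected {z \<in> G. dist z \<zeta> = t}" using t0(2) t1 by simp
  have circ_ne: "\<forall>t\<in>{0<..<t1}. \<exists>z\<in>G. dist z \<zeta> = t"
  proof
    fix t assume "t \<in> {0<..<t1}"
    then have t: "0 < t" "t < t1" by auto
    obtain n m where "dist (g (f' (x n))) \<zeta> < t" "t < dist (g (f' (y m))) \<zeta>"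
      using eventually_happens[OF xs[OF t(1)]] eventually_happens[OF ys[OF t(2)]] by auto
    moreover have "connected ((\<lambda>z. dist z \<zeta>) ` G)"
      by (intro connected_continuous_image G continuous_on_dist continuous_on_id continuous_on_const)
    then have "{dist (g (f' (x n))) \<zeta>..dist (g (f' (y m))) \<zeta>} \<subseteq> (\<lambda>z. dist z \<zeta>) ` G"
      by (rule connected_contains_Icc) (use xG yG in auto)
    ultimately have "t \<in> (\<lambda>z. dist z \<zeta>) ` G" by auto
    then show "\<exists>z\<in>G. dist z \<zeta> = t" by auto
  qed
  have bkG: "bounded (k ` G)" using D(2) kG by simp
  obtain z0 where z0: "z0 \<in> closure D" "z0 \<notin> D"
    "\<And>\<epsilon> \<tau>. 0 < \<epsilon> \<Longrightarrow> 0 < \<tau> \<Longrightarrow> \<exists>s. 0 < s \<and> s < \<tau> \<and> s < t1 \<and> (\<forall>z\<in>G. dist z \<zeta> = s \<longrightarrow> dist (k z) z0 < \<epsilon>)"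
    by (rule principal_point[OF k(1) kinj G(1,2) bkG \<zeta>G t1(1) circ_c circ_ne, unfolded kG]) blast
  obtain t e1 where t: "0 < t" "t < t1" "0 < e1" "\<And>z. z \<in> G \<Longrightarrow> dist z \<zeta> = t \<Longrightarrow> e1 \<le> dist (k z) z0"
    by (rule circle_with_image_off_point[OF k(1) kinj G(1,2) circ_c t1(1) z0(2)[folded kG]]) blast
  define d0 where "d0 = (SUP z\<in>D. dist z z0)"
  have d0: "0 < d0"
  proof -
    obtain z where z: "z \<in> D" using D(3) by blast
    then have "0 < dist z z0" using z0(2) by auto
    also have "\<dots> \<le> d0"
      unfolding d0_def
    proof (rule cSUP_upper[OF z])
      obtain B where "\<forall>z\<in>D. dist z0 z \<le> B" using D(2) bounded_any_center by blast
      then show "bdd_above ((\<lambda>z. dist z z0) ` D)" by (auto simp: dist_commute intro: bdd_aboveI)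
    qed
    finally show ?thesis .
  qed
  \<comment> \<open>Below \<open>e1\<close>, so that the image of the circle of radius
    \<open>t\<close> stays outside all the circles about \<open>z0\<close> under consideration, and
    below \<open>d0\<close>, as the lower Q condition requires.\<close>
  define \<epsilon>0 where "\<epsilon>0 = min e1 d0 / 2"
  define \<epsilon> where "\<epsilon> = \<epsilon>0 / 2"
  have eps: "0 < \<epsilon>" "\<epsilon> < \<epsilon>0" "\<epsilon>0 < d0" "\<epsilon>0 < e1" using t d0 by (auto simp: \<epsilon>_def \<epsilon>0_def)
  obtain s where s: "0 < s" "s < t" "\<And>z. z \<in> G \<Longrightarrow> dist z \<zeta> = s \<Longrightarrow> dist (k z) z0 < \<epsilon>"
    using z0(3)[OF eps(1) t(1)] by blast
  have near: "\<forall>e>0. \<forall>\<tau>>0. \<exists>z\<in>G. dist z \<zeta> < \<tau> \<and> dist (k z) z0 < e"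
  proof (intro allI impI)
    fix e \<tau> :: real assume e: "0 < e" "0 < \<tau>"
    obtain s' where "0 < s'" "s' < \<tau>" "s' < t1" "\<forall>z\<in>G. dist z \<zeta> = s' \<longrightarrow> dist (k z) z0 < e"
      using z0(3)[OF e] by blast
    then show "\<exists>z\<in>G. dist z \<zeta> < \<tau> \<and> dist (k z) z0 < e" using circ_ne by force
  qed
  obtain L v where L: "open L" "simply_connected L" "continuous_on L v" "G \<inter> ball \<zeta> t0 \<subseteq> L" "L \<subseteq> ball \<zeta> t0"
    "\<forall>z\<in>G \<inter> ball \<zeta> t0. v z = dist (k z) z0" "\<forall>z\<in>L - G. v z = 0"
    by (rule level_function[OF k(1) G(1) bkG \<zeta>G t0(1,3) near]) blast
  have nz: "\<forall>z\<in>D'. deriv h z \<noteq> 0"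
    using holomorphic_injective_imp_regular[OF hH(1) D' hH(2)] by blast
  have cross: "\<Gamma> \<in> sets borel \<and>
      (\<integral>\<^sup>+ z\<in>\<Gamma>. log_weight (dist (h z) w) * ennreal (cmod (deriv h z)) \<partial>hausdorff1) = \<infinity>"
    if r: "\<epsilon> < r" "r < \<epsilon>0" and \<Gamma>: "\<Gamma> = f ` (D \<inter> sphere z0 r)" for r \<Gamma>
  proof
    have eq: "\<Gamma> = {z \<in> D'. f' z \<in> sphere z0 r}" unfolding \<Gamma> using ff by force
    show \<Gamma>m: "\<Gamma> \<in> sets borel"
      unfolding eq using fc' D' by (intro borel_preimage_continuous_on) auto
    have rs: "\<forall>z\<in>G. dist z \<zeta> = s \<longrightarrow> dist (k z) z0 < r" using s(3) r by fastforce
    have rt: "\<forall>z\<in>G. dist z \<zeta> = t \<longrightarrow> r < dist (k z) z0" using t(4) r eps by fastforce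
    have lt: "t < t0" "0 < r" using t t1 r eps by auto
    have st: "s \<in> {0<..<t1}" "t \<in> {0<..<t1}" using s t by auto
    obtain C where C: "connected C" "C \<subseteq> {z \<in> G. dist (k z) z0 = r}"
      "\<And>T. connected T \<Longrightarrow> T \<subseteq> G \<Longrightarrow> \<exists>z\<in>T. dist z \<zeta> < s \<Longrightarrow> \<exists>z\<in>T. t < dist z \<zeta> \<Longrightarrow> T \<inter> C \<noteq> {}"
      by (rule separating_arc[OF G(1) L s(1,2) lt(1) bspec[OF circ_c st(1)] bspec[OF circ_c st(2)]
            bspec[OF circ_ne st(1)] bspec[OF circ_ne st(2)] lt(2) rs rt]) blast
    show "(\<integral>\<^sup>+ z\<in>\<Gamma>. log_weight (dist (h z) w) * ennreal (cmod (deriv h z)) \<partial>hausdorff1) = \<infinity>"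
    proof (rule line_integral_log_weight_diverges[OF hH(1) D' nz \<Gamma>m])
      show "\<Gamma> \<subseteq> D'" unfolding eq by blast
      have "continuous_on C k"
        using holomorphic_on_imp_continuous_on[OF k(1)] C(2) continuous_on_subset by blast
      then have "continuous_on C (\<lambda>z. f (k z))"
        by (rule continuous_on_compose2[OF fc]) (use C(2) gk in auto)
      then show "connected ((\<lambda>z. f (k z)) ` C)" using C(1) by (rule connected_continuous_image)
      show "(\<lambda>z. f (k z)) ` C \<subseteq> \<Gamma>"
        unfolding \<Gamma> using C(2) gk(2) by (auto simp: dist_commute)
      show "h z \<noteq> w" if "z \<in> (\<lambda>z. f (k z)) ` C" for z
      proof -
        have "z \<in> D'" using that C(2) gk(2) ff(3) by blast
        then show ?thesis using wH by (auto simp: H_def)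
      qed
      fix e :: real assume e: "0 < e"
      define \<delta> where "\<delta> = min e \<delta>0"
      have \<delta>: "0 < \<delta>" "\<delta> \<le> \<delta>0" "\<delta> \<le> e" using e \<delta>0 by (auto simp: \<delta>_def)
      \<comment> \<open>A small connected neighbourhood of \<open>w\<close> in \<open>H\<close>,
        transported to \<open>G\<close>. It contains terms of both sequences, hence points inside
        radius \<open>s\<close> and outside radius \<open>t\<close>, so it crosses \<open>C\<close>.
        As the neighbourhood is arbitrarily small, the image of \<open>C\<close> in \<open>H\<close>
        clusters at \<open>w\<close>.\<close>
      define T where "T = (\<lambda>y. g (f' (l y))) ` (H \<inter> ball w \<delta>)"
      have lD: "l y \<in> D'" if "y \<in> H" for y using that l(2) by (auto simp: H_def)
      have "continuous_on (H \<inter> ball w \<delta>) l"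
        using holomorphic_on_imp_continuous_on[OF l(1)] continuous_on_subset by blast
      then have "continuous_on (H \<inter> ball w \<delta>) (\<lambda>y. f' (l y))"
        by (rule continuous_on_compose2[OF fc']) (use lD in auto)
      then have "continuous_on (H \<inter> ball w \<delta>) (\<lambda>y. g (f' (l y)))"
        by (rule continuous_on_compose2[OF holomorphic_on_imp_continuous_on[OF gG(1)]]) (use lD ff(4) in auto)
      then have "connected T" unfolding T_def using \<delta>0(2)[OF \<delta>(2)] by (rule connected_continuous_image)
      moreover have "T \<subseteq> G" unfolding T_def G_def using lD ff(4) by blast
      moreover have "\<exists>z\<in>T. dist z \<zeta> < s"
      proof -
        have "\<forall>\<^sub>F n in sequentially. dist (h (x n)) w < \<delta>" using x(2) \<delta>(1) by (rule tendstoD)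
        with xs[OF s(1)] have "\<forall>\<^sub>F n in sequentially. dist (g (f' (x n))) \<zeta> < s \<and> dist (h (x n)) w < \<delta>"
          by eventually_elim simp
        then obtain n where n: "dist (g (f' (x n))) \<zeta> < s" "dist (h (x n)) w < \<delta>"
          by (auto simp: eventually_sequentially)
        have "g (f' (l (h (x n)))) \<in> T"
          unfolding T_def using n(2) x(1) by (intro imageI) (auto simp: H_def dist_commute)
        then show ?thesis using n(1) l(2)[OF x(1)] by auto
      qed
      moreover have "\<exists>z\<in>T. t < dist z \<zeta>"
      proof -
        have "\<forall>\<^sub>F n in sequentially. dist (h (y n)) w < \<delta>" using y(2) \<delta>(1) by (rule tendstoD)
        with ys[OF t(2)] have "\<forall>\<^sub>F n in sequentially. t < dist (g (f' (y n))) \<zeta> \<and> dist (h (y n)) w < \<delta>"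
          by eventually_elim simp
        then obtain n where n: "t < dist (g (f' (y n))) \<zeta>" "dist (h (y n)) w < \<delta>"
          by (auto simp: eventually_sequentially)
        have "g (f' (l (h (y n)))) \<in> T"
          unfolding T_def using n(2) y(1) by (intro imageI) (auto simp: H_def dist_commute)
        then show ?thesis using n(1) l(2)[OF y(1)] by auto
      qed
      ultimately have "T \<inter> C \<noteq> {}" by (rule C(3))
      then obtain q where q: "q \<in> H" "dist w q < \<delta>" "g (f' (l q)) \<in> C" by (auto simp: T_def)
      have "f' (l q) \<in> D" using lD[OF q(1)] ff(4) by blast
      then have "f (k (g (f' (l q)))) = l q" using k(2) ff(2) lD[OF q(1)] by simp
      moreover have "h (l q) = q" using q(1) l(2) by (auto simp: H_def)
      ultimately have "dist (h (f (k (g (f' (l q)))))) w < e" using q(2) \<delta>(3) by (simp add: dist_commute)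
      then show "\<exists>z\<in>(\<lambda>z. f (k z)) ` C. dist (h z) w < e" using q(3) by blast
    qed
  qed
  define h' where "h' z = indicator D' z *\<^sub>R h z" for z
  \<comment> \<open>The weight around \<open>w\<close> pulled back by \<open>h\<close>. Its squared
    integral is bounded through \<open>area_upper_bound\<close> by that of the weight on the image
    of \<open>h\<close>, hence is finite.\<close>
  define \<rho> where "\<rho> z = log_weight (dist (h' z) w) * (ennreal (cmod (deriv h z)) * indicator D' z)" for z
  have [measurable]: "h' \<in> borel_measurable borel"
    unfolding h'_def using holomorphic_on_imp_continuous_on[OF hH(1)] D'
    by (intro borel_measurable_continuous_on_indicator) auto
  have [measurable]: "(\<lambda>z. ennreal (cmod (deriv h z)) * indicator D' z) \<in> borel_measurable borel"
    using borel_measurable_deriv_times_indicator[OF hH(1) D'] .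
  have \<rho>m: "\<rho> \<in> borel_measurable borel" unfolding \<rho>_def by measurable
  have \<rho>eq: "\<rho> z = log_weight (dist (h z) w) * ennreal (cmod (deriv h z))" if "z \<in> D'" for z
    using that by (simp add: \<rho>_def h'_def)
  have "(\<integral>\<^sup>+ z. (\<rho> z)\<^sup>2 \<partial>lborel) = (\<integral>\<^sup>+ z\<in>D'. (log_weight (dist (h z) w))\<^sup>2 * (ennreal (cmod (deriv h z)))\<^sup>2 \<partial>lborel)"
    by (rule nn_integral_cong) (auto simp: \<rho>_def h'_def power_mult_distrib split: split_indicator)
  also have "\<dots> \<le> 32 * (\<integral>\<^sup>+ z\<in>h ` D'. (log_weight (dist z w))\<^sup>2 \<partial>lborel)"
    by (rule area_upper_bound[OF hH(1) D' hH(2)]) measurable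
  also have "\<dots> < \<infinity>" using log_weight_square_integrable_on[of w] by (simp add: ennreal_mult_less_top)
  finally have \<rho>2: "(\<integral>\<^sup>+ z. (\<rho> z)\<^sup>2 \<partial>lborel) < \<infinity>" .
  have finj: "inj_on f D" using ff(1) by (rule inj_on_inverseI)
  have "modulus (image_family f (circle_family D z0 \<epsilon> \<epsilon>0)) = 0"
  proof (rule modulus_eq_0I[OF \<rho>m \<rho>2])
    fix \<gamma> assume "\<gamma> \<in> image_family f (circle_family D z0 \<epsilon> \<epsilon>0)"
    then obtain r where r: "\<epsilon> < r" "r < \<epsilon>0" "\<gamma> = (D \<inter> sphere z0 r, f)"
      by (auto simp: image_family_def circle_family_def)
    have inj: "inj_on f (D \<inter> sphere z0 r)" using finj by (rule inj_on_subset) simp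
    note c = cross[OF r(1,2) refl]
    have m: "multiplicity_at \<gamma> = indicator (f ` (D \<inter> sphere z0 r))"
      unfolding r(3) using multiplicity_at_inj[OF inj] by auto
    show "multiplicity_at \<gamma> \<in> borel_measurable borel"
      unfolding m by (rule borel_measurable_indicator[OF conjunct1[OF c]])
    have "line_integral \<gamma> \<rho> = (\<integral>\<^sup>+ z\<in>f ` (D \<inter> sphere z0 r). \<rho> z \<partial>hausdorff1)"
      unfolding r(3) by (rule line_integral_inj[OF inj])
    also have "\<dots> = (\<integral>\<^sup>+ z\<in>f ` (D \<inter> sphere z0 r). log_weight (dist (h z) w) * ennreal (cmod (deriv h z)) \<partial>hausdorff1)"
      using ff(3) by (intro nn_integral_cong) (auto simp: \<rho>eq split: split_indicator)
    finally show "line_integral \<gamma> \<rho> = \<infinity>" using c by simp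
  qed
  moreover have "0 < modulus (image_family f (circle_family D z0 \<epsilon> \<epsilon>0))"
    using lower_Q_modulus_pos[OF D(1,2) Q QL1 lower[OF z0(1)] eps(1,2)] eps(3) by (simp add: d0_def)
  ultimately show False by simp
qed

section \<open>Extension to the prime ends\<close>

text \<open>A failure of uniform continuity yields two sequences with distances tending to 0 and
  images at least \<open>e\<close> apart. By compactness both converge to one \<open>w\<close>, with
  two different cluster values. Uniform continuity is the form in which \<Psi> extends to the
  closure.\<close>

lemma uniformly_continuous_on_if_cluster_points_unique:
  fixes \<Psi> :: "complex \<Rightarrow> complex"
  assumes H: "bounded H" and G: "bounded (\<Psi> ` H)" and cont: "continuous_on H \<Psi>"
    and uniq: "\<And>w x y \<zeta> \<xi>. w \<in> closure H - H \<Longrightarrow> range x \<subseteq> H \<Longrightarrow> range y \<subseteq> H \<Longrightarrow> x \<longlonglongrightarrow> w \<Longrightarrow> y \<longlonglongrightarrow> w \<Longrightarrow>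
      (\<lambda>n. \<Psi> (x n)) \<longlonglongrightarrow> \<zeta> \<Longrightarrow> (\<lambda>n. \<Psi> (y n)) \<longlonglongrightarrow> \<xi> \<Longrightarrow> \<zeta> = \<xi>"
  shows "uniformly_continuous_on H \<Psi>"
proof (rule ccontr)
  assume "\<not> uniformly_continuous_on H \<Psi>"
  then obtain e where e: "0 < e" "\<And>d. 0 < d \<Longrightarrow> \<exists>x\<in>H. \<exists>y\<in>H. dist y x < d \<and> e \<le> dist (\<Psi> y) (\<Psi> x)"
    unfolding uniformly_continuous_on_def by (meson not_le)
  have "\<forall>n. \<exists>p. fst p \<in> H \<and> snd p \<in> H \<and> dist (snd p) (fst p) < 1 / real (Suc n) \<and> e \<le> dist (\<Psi> (snd p)) (\<Psi> (fst p))"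
  proof
    fix n
    have "0 < 1 / real (Suc n)" by simp
    from e(2)[OF this] obtain a b where "a \<in> H" "b \<in> H" "dist b a < 1 / real (Suc n)" "e \<le> dist (\<Psi> b) (\<Psi> a)" by blast
    then show "\<exists>p. fst p \<in> H \<and> snd p \<in> H \<and> dist (snd p) (fst p) < 1 / real (Suc n) \<and> e \<le> dist (\<Psi> (snd p)) (\<Psi> (fst p))"
      by (intro exI[of _ "(a, b)"]) simp
  qed
  from choice[OF this] obtain P where P: "\<And>n. fst (P n) \<in> H" "\<And>n. snd (P n) \<in> H"
    "\<And>n. dist (snd (P n)) (fst (P n)) < 1 / real (Suc n)" "\<And>n. e \<le> dist (\<Psi> (snd (P n))) (\<Psi> (fst (P n)))"
    by blast
  have "compact (closure H \<times> (closure (\<Psi> ` H) \<times> closure (\<Psi> ` H)))"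
    using H G by (intro compact_Times) (auto simp: compact_closure)
  \<comment> \<open>Bundling the three points gives one subsequence along which all of them
    converge. The second preimage needs no coordinate, as its distance to the first tends to
    0.\<close>
  moreover define Z where "Z n = (fst (P n), (\<Psi> (fst (P n)), \<Psi> (snd (P n))))" for n
  have "\<forall>n. Z n \<in> closure H \<times> (closure (\<Psi> ` H) \<times> closure (\<Psi> ` H))"
    using P(1,2) closure_subset[of H] closure_subset[of "\<Psi> ` H"] by (auto simp: Z_def)
  ultimately obtain q \<sigma> where q: "q \<in> closure H \<times> (closure (\<Psi> ` H) \<times> closure (\<Psi> ` H))"
    "strict_mono (\<sigma> :: nat \<Rightarrow> nat)" "(Z \<circ> \<sigma>) \<longlonglongrightarrow> q"
    unfolding compact_def by blast
  define w where "w = fst q"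
  define \<zeta> where "\<zeta> = fst (snd q)"
  define \<xi> where "\<xi> = snd (snd q)"
  have x: "(\<lambda>n. fst (P (\<sigma> n))) \<longlonglongrightarrow> w" using tendsto_fst[OF q(3)] by (simp add: o_def w_def Z_def)
  have \<Psi>x: "(\<lambda>n. \<Psi> (fst (P (\<sigma> n)))) \<longlonglongrightarrow> \<zeta>"
    using tendsto_fst[OF tendsto_snd[OF q(3)]] by (simp add: o_def \<zeta>_def Z_def)
  have \<Psi>y: "(\<lambda>n. \<Psi> (snd (P (\<sigma> n)))) \<longlonglongrightarrow> \<xi>"
    using tendsto_snd[OF tendsto_snd[OF q(3)]] by (simp add: o_def \<xi>_def Z_def)
  have "(\<lambda>n. dist (snd (P (\<sigma> n))) (fst (P (\<sigma> n)))) \<longlonglongrightarrow> 0"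
  proof (rule tendsto_sandwich[of "\<lambda>_. 0" _ _ "\<lambda>n. 1 / real (Suc n)"])
    show "(\<lambda>n. 1 / real (Suc n)) \<longlonglongrightarrow> 0" by (rule one_over_Suc_tendsto_0)
    show "\<forall>\<^sub>F n in sequentially. dist (snd (P (\<sigma> n))) (fst (P (\<sigma> n))) \<le> 1 / real (Suc n)"
    proof (intro always_eventually allI)
      fix n
      have "1 / real (Suc (\<sigma> n)) \<le> 1 / real (Suc n)"
        using seq_suble[OF q(2), of n] by (intro divide_left_mono) auto
      then show "dist (snd (P (\<sigma> n))) (fst (P (\<sigma> n))) \<le> 1 / real (Suc n)" using P(3)[of "\<sigma> n"] by linarith
    qed
  qed auto
  then have "(\<lambda>n. snd (P (\<sigma> n)) - fst (P (\<sigma> n))) \<longlonglongrightarrow> 0"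
    unfolding dist_norm by (rule tendsto_norm_zero_cancel)
  from tendsto_add[OF this x] have y: "(\<lambda>n. snd (P (\<sigma> n))) \<longlonglongrightarrow> w" by simp
  have "\<zeta> = \<xi>"
  proof (cases "w \<in> H")
    case True
    have "(\<lambda>n. \<Psi> (fst (P (\<sigma> n)))) \<longlonglongrightarrow> \<Psi> w" "(\<lambda>n. \<Psi> (snd (P (\<sigma> n)))) \<longlonglongrightarrow> \<Psi> w"
      using P(1,2) by (auto intro!: continuous_on_tendsto_compose[OF cont _ True] x y)
    then show ?thesis using \<Psi>x \<Psi>y LIMSEQ_unique by blast
  next
    case False
    then have "w \<in> closure H - H" using q(1) by (auto simp: w_def)
    then show ?thesis by (rule uniq[OF _ _ _ x y \<Psi>x \<Psi>y]) (use P(1,2) in auto)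
  qed
  moreover have "e \<le> dist \<xi> \<zeta>"
    by (rule LIMSEQ_le_const[OF tendsto_dist[OF \<Psi>y \<Psi>x]]) (use P(4) in blast)
  ultimately show False using e(1) by simp
qed

text \<open>The map \<open>pe_extension\<close> identifies each completion isometrically with the
  closure of its circular domain, so an extension of \<Psi> to the closures is all that is
  required.\<close>

lemma prime_end_extension:
  assumes uc: "uniformly_continuous_on (h ` D') \<Psi>" and im: "\<Psi> ` h ` D' = g ` D" and bd: "bounded (h ` D')"
    and \<phi>: "\<And>w. w \<in> D' \<Longrightarrow> \<phi> w \<in> D" "\<And>w. w \<in> D' \<Longrightarrow> \<Psi> (h w) = g (\<phi> w)"
  obtains F where "continuous_map (pe_topology h D') (pe_topology g D) F"
    "F ` pe_completion h D' = pe_completion g D" "\<And>w. w \<in> D' \<Longrightarrow> F (pe_embed h D' w) = pe_embed g D (\<phi> w)"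
proof -
  let ?H = "h ` D'" and ?G = "g ` D"
  obtain \<Psi>' where \<Psi>': "uniformly_continuous_on (closure ?H) \<Psi>'" "\<And>x. x \<in> ?H \<Longrightarrow> \<Psi> x = \<Psi>' x"
    using uniformly_continuous_on_extension_on_closure[OF uc] by metis
  have c: "continuous_on (closure ?H) \<Psi>'" using \<Psi>'(1) by (rule uniformly_continuous_imp_continuous)
  have im': "\<Psi>' ` ?H = ?G" unfolding im[symmetric] using \<Psi>'(2) by (intro image_cong) auto
  have surj: "\<Psi>' ` closure ?H = closure ?G"
  proof
    show "\<Psi>' ` closure ?H \<subseteq> closure ?G"
      by (rule image_closure_subset[OF c]) (simp, simp add: im' closure_subset)
    \<comment> \<open>Compactness makes the image closed. It contains the dense set
      \<open>?G\<close>, hence the whole closure.\<close>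
    have "compact (\<Psi>' ` closure ?H)" by (rule compact_continuous_image[OF c]) (use bd in \<open>simp add: compact_closure\<close>)
    moreover have "?G \<subseteq> \<Psi>' ` closure ?H" unfolding im'[symmetric] using closure_subset by blast
    ultimately show "closure ?G \<subseteq> \<Psi>' ` closure ?H" by (intro closure_minimal) (auto intro: compact_imp_closed)
  qed
  define F where "F p = {y. range y \<subseteq> D \<and> (g \<circ> y) \<longlonglongrightarrow> \<Psi>' (pe_extension h p)}" for p
  have ext: "pe_extension h p \<in> closure ?H" if "p \<in> pe_completion h D'" for p
    using bij_betw_pe_extension[of h D'] that by (auto simp: bij_betw_def)
  have \<Psi>ext: "\<Psi>' (pe_extension h p) \<in> closure ?G" if "p \<in> pe_completion h D'" for p
    using ext[OF that] surj by blast
  have Fc: "F p \<in> pe_completion g D" if "p \<in> pe_completion h D'" for p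
    using \<Psi>ext[OF that] by (auto simp: F_def pe_completion_eq)
  have Fe: "pe_extension g (F p) = \<Psi>' (pe_extension h p)" if "p \<in> pe_completion h D'" for p
    unfolding F_def by (rule pe_extension_eq[OF \<Psi>ext[OF that]])
  show thesis
  proof (rule that)
    show "continuous_map (pe_topology h D') (pe_topology g D) F"
      unfolding pe_topology_def Metric_space.metric_continuous_map[OF Metric_space_pe Metric_space_pe]
    proof (intro conjI ballI allI impI)
      show "F ` pe_completion h D' \<subseteq> pe_completion g D" using Fc by blast
      fix p and \<epsilon> :: real assume p: "p \<in> pe_completion h D'" and \<epsilon>: "0 < \<epsilon>"
      obtain \<delta> where \<delta>: "0 < \<delta>"
        "\<And>x. x \<in> closure ?H \<Longrightarrow> dist x (pe_extension h p) < \<delta> \<Longrightarrow> dist (\<Psi>' x) (\<Psi>' (pe_extension h p)) < \<epsilon>"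
        using c ext[OF p] \<epsilon> unfolding continuous_on_iff by meson
      have "pe_dist g (F p) (F x) < \<epsilon>" if "x \<in> pe_completion h D'" "pe_dist h p x < \<delta>" for x
        using \<delta>(2)[OF ext[OF that(1)]] that p by (simp add: pe_dist_def Fe dist_commute)
      then show "\<exists>\<delta>>0. \<forall>x. x \<in> pe_completion h D' \<and> pe_dist h p x < \<delta> \<longrightarrow> pe_dist g (F p) (F x) < \<epsilon>"
        using \<delta>(1) by blast
    qed
    show "F ` pe_completion h D' = pe_completion g D"
    proof
      show "F ` pe_completion h D' \<subseteq> pe_completion g D" using Fc by blast
      show "pe_completion g D \<subseteq> F ` pe_completion h D'"
      proof
        fix q assume "q \<in> pe_completion g D"
        then obtain l where l: "l \<in> closure ?G" "q = {y. range y \<subseteq> D \<and> (g \<circ> y) \<longlonglongrightarrow> l}"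
          unfolding pe_completion_eq by blast
        then obtain m where m: "m \<in> closure ?H" "l = \<Psi>' m" using surj by blast
        then obtain p where "p \<in> pe_completion h D'" "m = pe_extension h p"
          using bij_betw_pe_extension[of h D'] by (auto simp: bij_betw_def)
        then show "q \<in> F ` pe_completion h D'" using l(2) m(2) by (auto simp: F_def)
      qed
    qed
    fix w assume w: "w \<in> D'"
    then have "\<Psi>' (pe_extension h (pe_embed h D' w)) = g (\<phi> w)"
      using \<Psi>'(2)[of "h w"] \<phi>(2) by (simp add: pe_extension_embed)
    then show "F (pe_embed h D' w) = pe_embed g D (\<phi> w)"
      using pe_embed_eq[OF \<phi>(1)[OF w]] by (simp add: F_def)
  qed
qed

theorem theorem5p1:
  fixes D D' :: "complex set" and Q :: "complex \<Rightarrow> real" and f g h :: "complex \<Rightarrow> complex"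
  assumes D: "bounded_domain D" "finitely_connected D"
    and D': "bounded_domain D'" "finitely_connected D'"
    and Q: "Q \<in> borel_measurable lebesgue" "\<And>z. 0 < Q z"
    and f: "lower_Q_homeomorphism Q D D' f"
    and QL1: "set_integrable lebesgue D Q"
    and g: "circular_uniformization g D"
    and h: "circular_uniformization h D'"
  shows "\<exists>F. continuous_map (pe_topology h D') (pe_topology g D) F \<and>
             F ` pe_completion h D' = pe_completion g D \<and>
             (\<forall>w\<in>D'. F (pe_embed h D' w) = pe_embed g D (the_inv_into D f w))"
proof -
  obtain f' where f': "homeomorphism D D' f f'" and lower: "\<And>z0. z0 \<in> closure D \<Longrightarrow> lower_Q_at Q D f z0"
    using f by (auto simp: lower_Q_homeomorphism_def)
  have oD: "open D" "bounded D" "D \<noteq> {}" "open D'" using D D' by (auto simp: bounded_domain_def)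
  have hH: "h holomorphic_on D'" "inj_on h D'" and gG: "g holomorphic_on D"
    and bd: "bounded (h ` D')" "open (h ` D')" "bounded (g ` D)"
    using g h by (auto simp: circular_uniformization_def bounded_circular_domain_def bounded_domain_def)
  obtain l where l: "l holomorphic_on h ` D'" "\<And>z. z \<in> D' \<Longrightarrow> l (h z) = z"
    using holomorphic_has_inverse[OF hH(1) oD(4) hH(2)] by metis
  have ff: "\<And>z. z \<in> D' \<Longrightarrow> f' z \<in> D" "\<And>z. z \<in> D' \<Longrightarrow> f (f' z) = z" "f' ` D' = D" "continuous_on D' f'" "inj_on f D"
    using f' by (auto simp: homeomorphism_def intro: inj_on_inverseI)
  define \<Psi> where "\<Psi> y = g (f' (l y))" for y
  have \<Psi>h: "\<Psi> (h w) = g (f' w)" if "w \<in> D'" for w using l(2)[OF that] by (simp add: \<Psi>_def)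
  have lD: "l y \<in> D'" "h (l y) = y" if "y \<in> h ` D'" for y using that l(2) by auto
  have im: "\<Psi> ` h ` D' = g ` D"
  proof -
    have "\<Psi> ` h ` D' = (\<lambda>w. g (f' w)) ` D'" unfolding image_image using \<Psi>h by (intro image_cong) auto
    also have "\<dots> = g ` D" using ff(3) by (simp add: image_image[symmetric])
    finally show ?thesis .
  qed
  have "uniformly_continuous_on (h ` D') \<Psi>"
  proof (rule uniformly_continuous_on_if_cluster_points_unique[OF bd(1)])
    show "bounded (\<Psi> ` h ` D')" using bd im by simp
    have "continuous_on (h ` D') (\<lambda>y. f' (l y))"
      by (rule continuous_on_compose2[OF ff(4) holomorphic_on_imp_continuous_on[OF l(1)]]) (use lD in blast)
    then show "continuous_on (h ` D') \<Psi>"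
      unfolding \<Psi>_def
      by (rule continuous_on_compose2[OF holomorphic_on_imp_continuous_on[OF gG]]) (use lD ff in blast)
  next
    fix w x y \<zeta> \<xi>
    assume w: "w \<in> closure (h ` D') - h ` D'" and r: "range x \<subseteq> h ` D'" "range y \<subseteq> h ` D'"
      and lim: "x \<longlonglongrightarrow> w" "y \<longlonglongrightarrow> w" "(\<lambda>n. \<Psi> (x n)) \<longlonglongrightarrow> \<zeta>" "(\<lambda>n. \<Psi> (y n)) \<longlonglongrightarrow> \<xi>"
    have xy: "x n \<in> h ` D'" "y n \<in> h ` D'" for n using r by auto
    have wf: "w \<in> frontier (h ` D')" using w bd(2) by (simp add: frontier_def interior_open)
    show "\<zeta> = \<xi>"
      by (rule cluster_points_unique[OF oD(1,2,3) Q QL1 lower f' oD(4) g h wf,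
            of "\<lambda>n. l (x n)" _ "\<lambda>n. l (y n)"])
        (use lim xy lD in \<open>auto simp: \<Psi>_def\<close>)
  qed
  then obtain F where F: "continuous_map (pe_topology h D') (pe_topology g D) F"
    "F ` pe_completion h D' = pe_completion g D" "\<And>w. w \<in> D' \<Longrightarrow> F (pe_embed h D' w) = pe_embed g D (f' w)"
    using prime_end_extension[OF _ im bd(1) ff(1) \<Psi>h] by metis
  have "the_inv_into D f w = f' w" if "w \<in> D'" for w
    using that ff by (intro the_inv_into_f_eq) auto
  then show ?thesis using F by (intro exI[of _ F]) auto
qed

end
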